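(* Let $a\in(0,1)$, $s\ge 4$, $r_1,r_2>3$, and let $u\in C([0,T];\mathrm{Z}^s_{r_1,r_2})$ be a solution of the IVP $$u_t+D_x^{a+1}\partial_x u+u_{xyy}+uu_x=0,\qquad u(x,y,0)=\phi(x,y),\quad (x,y)\in\mathbb R^2.$$ If there exist three different times $t_1,t_2,t_3\in[0,T]$ such that $u(t_j)\in\mathrm{Z}^s_{7/2+a,r_2}$, $j=1,2,3$, then $u(t)\equiv 0$ for every $t\in[0,T]$.
   Context: $D_x^{a+1}$ is the Fourier multiplier $|\xi|^{a+1}$ in the $x$-variable. $H^{s_1,s_2}(\mathbb R^2)$ is the anisotropic Sobolev space with norm $\|f\|^2+\|J_x^{s_1}f\|^2+\|J_y^{s_2}f\|^2$ ($L^2$ norms, $J_x^{z},J_y^z$ the Fourier multipliers $(1+\xi^2)^{z/2}$, $(1+\eta^2)^{z/2}$). $L^2_{r_1,r_2}$ is the weighted space with norm $\left(\int(1+|x|^{2r_1}+|y|^{2r_2})|f|^2dxdy\right)^{1/2}$, and $\mathrm{Z}^s_{r_1,r_2}=H^{(1+a)s,2s}(\mathbb R^2)\cap L^2_{r_1,r_2}$. *)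

theory Defs
  imports "HOL-Analysis.Analysis"
begin

text \<open>Fourier transform in both variables, with the convention
  hat f (xi, eta) = integral of f(x,y) e^{-i(x xi + y eta)} dx dy.
  For the functions occurring below (elements of weighted L2 spaces with weights > 1)
  f is in L1, so this Lebesgue integral agrees with the L2 (Plancherel) transform.\<close>
definition fourier2 :: "(real \<times> real \<Rightarrow> real) \<Rightarrow> real \<times> real \<Rightarrow> complex" where
  "fourier2 f = (\<lambda>(xi, eta). LINT p|lborel.
      complex_of_real (f p) * cis (- (fst p * xi + snd p * eta)))"

definition weight :: "real \<Rightarrow> real \<Rightarrow> real \<times> real \<Rightarrow> real" where
  "weight r1 r2 = (\<lambda>(x, y). 1 + \<bar>x\<bar> powr (2 * r1) + \<bar>y\<bar> powr (2 * r2))"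

definition weighted_L2 :: "real \<Rightarrow> real \<Rightarrow> (real \<times> real \<Rightarrow> real) \<Rightarrow> bool" where
  "weighted_L2 r1 r2 f \<longleftrightarrow> f \<in> borel_measurable lborel \<and>
     integrable lborel (\<lambda>p. weight r1 r2 p * (f p)\<^sup>2)"

text \<open>Anisotropic Sobolev condition: J_x^{s1} f and J_y^{s2} f in L2
  (stated on the Fourier side, via Plancherel).\<close>
definition aniso_H :: "real \<Rightarrow> real \<Rightarrow> (real \<times> real \<Rightarrow> real) \<Rightarrow> bool" where
  "aniso_H s1 s2 f \<longleftrightarrow> f \<in> borel_measurable lborel \<and> integrable lborel (\<lambda>p. (f p)\<^sup>2) \<and>
     integrable lborel (\<lambda>(xi, eta). (1 + xi\<^sup>2) powr s1 * (cmod (fourier2 f (xi, eta)))\<^sup>2) \<and>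
     integrable lborel (\<lambda>(xi, eta). (1 + eta\<^sup>2) powr s2 * (cmod (fourier2 f (xi, eta)))\<^sup>2)"

definition Zspace :: "real \<Rightarrow> real \<Rightarrow> real \<Rightarrow> real \<Rightarrow> (real \<times> real \<Rightarrow> real) \<Rightarrow> bool" where
  "Zspace a s r1 r2 f \<longleftrightarrow> aniso_H ((1 + a) * s) (2 * s) f \<and> weighted_L2 r1 r2 f"

text \<open>Square of the Z norm (up to the harmless Plancherel constant).\<close>
definition Znorm_sq :: "real \<Rightarrow> real \<Rightarrow> real \<Rightarrow> real \<Rightarrow> (real \<times> real \<Rightarrow> real) \<Rightarrow> real" where
  "Znorm_sq a s r1 r2 f =
     (LINT p|lborel. weight r1 r2 p * (f p)\<^sup>2)
   + (LINT q|lborel. (1 + (fst q)\<^sup>2) powr ((1 + a) * s) * (cmod (fourier2 f q))\<^sup>2)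
   + (LINT q|lborel. (1 + (snd q)\<^sup>2) powr (2 * s) * (cmod (fourier2 f q))\<^sup>2)"

definition cont_Z :: "real \<Rightarrow> real \<Rightarrow> real \<Rightarrow> real \<Rightarrow> real \<Rightarrow> (real \<Rightarrow> real \<times> real \<Rightarrow> real) \<Rightarrow> bool" where
  "cont_Z a s r1 r2 T u \<longleftrightarrow>
     (\<forall>t\<in>{0..T}. Zspace a s r1 r2 (u t)) \<and>
     (\<forall>t0\<in>{0..T}. ((\<lambda>t. Znorm_sq a s r1 r2 (\<lambda>p. u t p - u t0 p)) \<longlongrightarrow> 0) (at t0 within {0..T}))"

text \<open>u solves u_t + D_x^{a+1} u_x + u_xyy + u u_x = 0 on [0,T] with u(0) = phi,
  in the (integrated in time, Fourier side) sense: for every frequency (xi,eta) and t in [0,T],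
  hat u(t) - hat u(0) = int_0^t [ -i xi |xi|^{a+1} hat u + i xi eta^2 hat u - (i xi / 2) hat(u^2) ] d tau.
  (Symbols: D_x^{a+1} d_x ~ i xi |xi|^{a+1}, d_x d_y^2 ~ -i xi eta^2, u u_x = (u^2)_x / 2.)\<close>
definition solves_IVP :: "real \<Rightarrow> real \<Rightarrow> (real \<times> real \<Rightarrow> real) \<Rightarrow> (real \<Rightarrow> real \<times> real \<Rightarrow> real) \<Rightarrow> bool" where
  "solves_IVP a T phi u \<longleftrightarrow> u 0 = phi \<and>
     (\<forall>t\<in>{0..T}. \<forall>xi eta.
        ((\<lambda>\<tau>. - \<i> * complex_of_real (xi * \<bar>xi\<bar> powr (a + 1)) * fourier2 (u \<tau>) (xi, eta)
              + \<i> * complex_of_real (xi * eta\<^sup>2) * fourier2 (u \<tau>) (xi, eta)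
              - \<i> * complex_of_real (xi / 2) * fourier2 (\<lambda>p. (u \<tau> p)\<^sup>2) (xi, eta))
          has_integral (fourier2 (u t) (xi, eta) - fourier2 (u 0) (xi, eta))) {0..t})"

end

(* Near xi = 0 the dispersion D_x^{a+1} d_x creates singular terms |xi|^{2+a} and |xi|^{3+a} in
   the Fourier transform of u, which decay of order 7/2 + a in x excludes. Weighted decay in x
   alone does not allow freezing eta, so the transform is tested in eta against eta^k e^{-eta} on
   eta > 0, i.e. u is integrated in y against k!/(1 + i y)^{k+1}, and F_k satisfies
     F_k(t) - F_k(t') = int_{t'}^t [-i xi |xi|^{a+1} F_k + i xi F_{k+2} - (i xi / 2) Q_k].
   Dilation differences of order n kill polynomials of degree at most n in xi, multiply
   xi^{m+a} by a nonzero constant, and commute with time integrals, so no expansion coefficients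
   have to be tracked. Comparing two times with good decay gives first F_k(t, 0) = 0 for all t,
   and then that M(t) = d/dxi F_0(t, 0) has vanishing time average between the two times.
   Since Re(i M)' is half the integral of u^2 / (1 + y^2), three such times force u(t) = 0 for
   some t. Uniqueness follows from (u^2)^ = (2 pi)^{-2} u^ * u^, because |xi| u^ is in L^1
   uniformly in time and so the derivative in the nonlinearity can be absorbed in the sup norm of
   u^, which is then bounded by B (C |t - t0|)^n / n! for every n. *)
theory Submission
  imports Defs "HOL-Probability.Sinc_Integral" "HOL-Probability.Characteristic_Functions"
begin

section \<open>Test kernels and dilation differences\<close>

text \<open>The dispersion shapes every exponent. Cauchy-Schwarz in x costs half a power, so decay
  7/2 + a controls exactly the order xi^{3+a}. Seeing that order requires differences that remove
  all degrees up to 3; they keep xi^{2+a} and xi^{3+a} because 2^{m+a} is none of 1, 2, 4, 8 when 0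
  < a < 1. The term u_xyy couples F_k to F_{k+2}, so the hierarchy never closes. For the order
  xi^{2+a} this is harmless: r1 > 3 gives second differences of F_{k+2} of size xi^2 at all times,
  and the factor xi does the rest. For the order xi^{3+a} it is the main obstacle, since good decay
  is known only at isolated times whereas F_2 enters through a time integral. The missing fractional
  power is obtained at intermediate times by restarting the equation for F_2 at a good time: there
  F_4 and Q_2 carry a factor xi, and F_2(., 0) is already known to vanish. The three times enter
  through a sign: a strictly increasing function cannot have mean zero on two adjacent
  intervals.\<close>

lemma integrable_inverse_1_plus_square_lborel: "integrable lborel (\<lambda>x::real. 1 / (1 + x\<^sup>2))"
  using integrable_inverse_1_plus_square by (simp add: set_integrable_def inverse_eq_divide)

lemma cis_measurable [measurable]: "cis \<in> borel_measurable borel"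
  by (intro borel_measurable_continuous_onI continuous_intros)

lemma integrable_tensor:
  fixes f g :: "real \<Rightarrow> 'a::{real_normed_field, banach, second_countable_topology}"
  assumes f: "integrable lborel f" and g: "integrable lborel g"
  shows "integrable lborel (\<lambda>p. f (fst p) * g (snd p))"
proof -
  have "integrable (lborel \<Otimes>\<^sub>M lborel) (\<lambda>(x, y). f x * g y)"
    by (rule lborel_pair.Fubini_integrable)
      (use f g in \<open>auto simp: norm_mult\<close>)
  then show ?thesis
    by (simp add: lborel_prod case_prod_beta')
qed

lemma integral_tensor:
  fixes f g :: "real \<Rightarrow> 'a::{real_normed_field, banach, second_countable_topology}"
  assumes f: "integrable lborel f" and g: "integrable lborel g"
  shows "(LINT p|lborel. f (fst p) * g (snd p)) = (LINT x|lborel. f x) * (LINT y|lborel. g y)"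
proof -
  have "integrable (lborel \<Otimes>\<^sub>M lborel) (\<lambda>p. f (fst p) * g (snd p))"
    using integrable_tensor[OF f g] by (simp add: lborel_prod)
  from lborel_pair.integral_fst'[OF this] show ?thesis
    by (simp add: lborel_prod)
qed

text \<open>The fixed integrable density of all Cauchy-Schwarz steps: one factor is the weighted
  square of the function, the other is \<open>rho\<close>. A kernel is admissible as soon as its
  square is dominated by the weight times \<open>rho\<close>.\<close>

definition rho :: "real \<times> real \<Rightarrow> real" where
  "rho p = 1 / ((1 + (fst p)\<^sup>2) * (1 + (snd p)\<^sup>2))"

lemma rho_pos: "rho p > 0"
  by (simp add: rho_def add_pos_nonneg)

lemma integrable_rho: "integrable lborel rho"
proof -
  have "rho = (\<lambda>p. (1 / (1 + (fst p)\<^sup>2)) * (1 / (1 + (snd p)\<^sup>2)))"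
    by (auto simp: rho_def)
  then show ?thesis
    using integrable_tensor[OF integrable_inverse_1_plus_square_lborel integrable_inverse_1_plus_square_lborel] by simp
qed

lemma rho_measurable [measurable]: "rho \<in> borel_measurable borel"
  using integrable_rho by (simp add: integrable_iff_bounded)

section \<open>Test kernels in the second frequency and their transforms in y\<close>

definition gamma_ker :: "nat \<Rightarrow> real \<Rightarrow> real" where
  "gamma_ker k x = indicator {0<..} x * (x ^ k * exp (- x))"

text \<open>Decay of order at least 1/|y| makes this kernel square integrable in y, so pairing with
  it spends no weight in y and leaves the whole decay in x available.\<close>

definition laplace_ker :: "nat \<Rightarrow> real \<Rightarrow> complex" where
  "laplace_ker k y = fact k / (1 + \<i> * complex_of_real y) ^ Suc k"

lemma gamma_ker_nonneg: "gamma_ker k x \<ge> 0"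
  by (simp add: gamma_ker_def indicator_def)

lemma gamma_ker_measurable [measurable]: "gamma_ker k \<in> borel_measurable borel"
  unfolding gamma_ker_def by measurable

lemma gamma_ker_mult: "gamma_ker k x * x ^ j = gamma_ker (k + j) x"
  by (simp add: gamma_ker_def power_add)

text \<open>Up to the factor k! and the single point 0 this is the Erlang density of rate 1, which
  is a probability density.\<close>

lemma integrable_gamma_ker: "integrable lborel (gamma_ker k)"
proof -
  interpret prob_space "density lborel (erlang_density k 1)"
    by (rule prob_space_erlang_density) simp
  have "integrable (density lborel (erlang_density k 1)) (\<lambda>_. 1::real)"
    by simp
  then have "integrable lborel (\<lambda>x. erlang_density k 1 x)"
    by (subst (asm) integrable_density) auto
  then have "integrable lborel (\<lambda>x. fact k * erlang_density k 1 x)"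
    by simp
  moreover have "AE x in lborel. fact k * erlang_density k 1 x = gamma_ker k x"
    using AE_lborel_singleton[of 0]
    by eventually_elim (auto simp: erlang_density_def gamma_ker_def)
  ultimately show ?thesis
    by (elim integrable_cong_AE_imp) (auto elim: AE_mp)
qed

lemma gamma_ker_fourier_integrable: "integrable lborel (\<lambda>x. complex_of_real (gamma_ker k x) * cis (- (y * x)))"
proof (rule Bochner_Integration.integrable_bound[OF integrable_gamma_ker[of k]])
  show "AE x in lborel. norm (complex_of_real (gamma_ker k x) * cis (- (y * x))) \<le> norm (gamma_ker k x)"
    by (simp add: norm_mult)
qed simp

lemma exp_mult_power_tendsto_0: "((\<lambda>x::real. x ^ k * exp (- x)) \<longlongrightarrow> 0) at_top"
  using tendsto_power_div_exp_0[of k] by (simp add: exp_minus divide_inverse)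

text \<open>With z = 1 + i y, the integral I(k) of x^k e^{-z x} over the half line satisfies I(0) =
  1/z, and integrating the derivative of -x^{k+1} e^{-z x} / z gives I(k+1) = (k+1) I(k) /
  z.\<close>

lemma gamma_ker_fourier: "(LINT x|lborel. complex_of_real (gamma_ker k x) * cis (- (y * x))) = laplace_ker k y"
proof -
  define z where "z = 1 + \<i> * complex_of_real y"
  have z0: "z \<noteq> 0" by (auto simp: z_def complex_eq_iff)
  define e where "e k x = complex_of_real x ^ k * exp (- z * complex_of_real x)" for k and x :: real
  have e_eq: "complex_of_real (gamma_ker k x) * cis (- (y * x)) = indicator {0<..} x *\<^sub>R e k x" for k x
  proof -
    have "exp (- z * complex_of_real x) = exp (of_real (- x)) * exp (\<i> * of_real (- (y * x)))"
      by (simp add: z_def exp_add[symmetric] algebra_simps)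
    then show ?thesis
      by (simp add: gamma_ker_def e_def cis_conv_exp exp_of_real[symmetric] scaleR_conv_of_real mult.assoc)
  qed
  have int: "set_integrable lborel {0<..} (e k)" for k
    using gamma_ker_fourier_integrable[of k y] by (simp add: set_integrable_def e_eq)
  have int0: "set_integrable lborel {0<..} (\<lambda>x. exp (- (z * complex_of_real x)))"
    using int[of 0] unfolding set_integrable_def by (simp add: e_def)
  have cmod_e: "cmod (e k x) = \<bar>x\<bar> ^ k * exp (- x)" for k x
    by (simp add: e_def norm_mult norm_power z_def)
  \<comment> \<open>Only for k = 0 is the antiderivative nonzero at the origin; this boundary value
    starts the recursion.\<close>
  have lim0: "((\<lambda>x. - e k x / z) \<longlongrightarrow> (if k = 0 then - 1 / z else 0)) (at_right 0)" for k
  proof -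
    have "continuous (at_right 0) (\<lambda>x. - e k x / z)"
      unfolding e_def by (intro continuous_intros) (use z0 in auto)
    then show ?thesis by (auto simp: continuous_within e_def power_0_left)
  qed
  have limI: "((\<lambda>x. - e k x / z) \<longlongrightarrow> 0) at_top" for k
  proof -
    have "((\<lambda>x. cmod (e k x)) \<longlongrightarrow> 0) at_top"
      by (rule Lim_transform_eventually[OF exp_mult_power_tendsto_0[of k]])
        (use eventually_ge_at_top[of 0] in \<open>eventually_elim, simp add: cmod_e\<close>)
    then have "(e k \<longlongrightarrow> 0) at_top" by (rule tendsto_norm_zero_cancel)
    then have "((\<lambda>x. - e k x / z) \<longlongrightarrow> - 0 / z) at_top"
      by (intro tendsto_intros) (use z0 in auto)
    then show ?thesis by simp
  qed
  define I where "I k = (LINT x:{0<..}|lborel. e k x)" for k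
  have FTC: "(LINT x:{0<..}|lborel. f x) = - A"
    if "\<And>x. (F has_vector_derivative f x) (at x)" "\<And>x. isCont f x" "set_integrable lborel {0<..} f"
      "(F \<longlongrightarrow> A) (at_right 0)" "(F \<longlongrightarrow> 0) at_top" for f F :: "real \<Rightarrow> complex" and A
    proof -
    have e: "einterval 0 \<infinity> = {0<..}"
      by (auto simp: einterval_def zero_ereal_def)
    have l: "((F \<circ> real_of_ereal) \<longlongrightarrow> A) (at_right 0)"
      using that(4) by (simp add: zero_ereal_def ereal_tendsto_simps)
    have u: "((F \<circ> real_of_ereal) \<longlongrightarrow> 0) (at_left \<infinity>)"
      using that(5) by (simp add: ereal_tendsto_simps)
    have "(LBINT x=0..\<infinity>. f x) = 0 - A"
      using that(1-3) l u by (intro interval_integral_FTC_integrable) (auto simp: e)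
    then show ?thesis
      by (simp add: interval_lebesgue_integral_0_infty)
  qed
  have I0: "I 0 = 1 / z"
  proof -
    have "((\<lambda>x. - e 0 x / z) has_vector_derivative e 0 x) (at x)" for x
      unfolding e_def
      by (rule has_vector_derivative_real_field[THEN has_vector_derivative_eq_rhs])
        (auto intro!: derivative_eq_intros simp: z0)
    then have "I 0 = - (- 1 / z)"
      unfolding I_def
      by (rule FTC) (use int0 lim0[of 0] limI[of 0] in \<open>auto simp: e_def intro!: continuous_intros\<close>)
    then show ?thesis by simp
  qed
  have IS: "I (Suc k) = of_nat (Suc k) / z * I k" for k
  proof -
    let ?f = "\<lambda>x. e (Suc k) x - of_nat (Suc k) / z * e k x"
    have "((\<lambda>x. - e (Suc k) x / z) has_vector_derivative ?f x) (at x)" for x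
      unfolding e_def
      by (rule has_vector_derivative_real_field[THEN has_vector_derivative_eq_rhs])
        (auto intro!: derivative_eq_intros simp: z0 field_simps, cases k, auto)
    moreover have "set_integrable lborel {0<..} ?f"
      by (intro set_integral_diff set_integrable_mult_right int)
    ultimately have "(LINT x:{0<..}|lborel. ?f x) = - 0"
      by (intro FTC[where F = "\<lambda>x. - e (Suc k) x / z"])
        (use lim0[of "Suc k"] limI[of "Suc k"] z0 in \<open>auto simp: e_def intro!: continuous_intros\<close>)
    then show ?thesis
      unfolding I_def using int by (simp add: set_integral_diff set_integrable_mult_right)
  qed
  have "I k = fact k / z ^ Suc k"
    by (induction k) (auto simp: I0 IS field_simps z0)
  then show ?thesis
    by (simp add: e_eq I_def set_lebesgue_integral_def laplace_ker_def z_def)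
qed

lemma one_plus_ii_norm: "cmod (1 + \<i> * complex_of_real y) = sqrt (1 + y\<^sup>2)"
  by (simp add: cmod_def)

lemma laplace_ker_measurable [measurable]: "laplace_ker k \<in> borel_measurable borel"
  unfolding laplace_ker_def by measurable

lemma cmod_laplace_ker_le: "cmod (laplace_ker k y) \<le> fact k / sqrt (1 + y\<^sup>2)"
proof -
  have 1: "1 \<le> sqrt (1 + y\<^sup>2)" by simp
  then have 2: "0 < sqrt (1 + y\<^sup>2)" by linarith
  have "sqrt (1 + y\<^sup>2) ^ 1 \<le> sqrt (1 + y\<^sup>2) ^ Suc k"
    by (rule power_increasing) (use 1 in auto)
  then show ?thesis
    using 2 by (auto simp: laplace_ker_def norm_divide norm_power one_plus_ii_norm norm_mult intro!: divide_left_mono mult_pos_pos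
        simp del: power_Suc real_sqrt_gt_0_iff)
qed

lemma cmod_laplace_ker_le_fact: "cmod (laplace_ker k y) \<le> fact k"
proof -
  have "fact k / sqrt (1 + y\<^sup>2) \<le> fact k / 1"
    by (intro divide_left_mono) (auto intro!: add_pos_nonneg)
  then show ?thesis using cmod_laplace_ker_le[of k y] by simp
qed

lemma Re_laplace_ker_0: "Re (laplace_ker 0 y) = 1 / (1 + y\<^sup>2)"
  by (simp add: laplace_ker_def Re_divide)

text \<open>The coefficients are those of (X - 1)(X - 2), and in the next two definitions of (X -
  1)(X - 2)(X - 4) and (X - 1)(X - 2)(X - 4)(X - 8), where X is dilation by 2. As X multiplies x^p
  by 2^p, the factor X - 2^j removes degree j.\<close>

definition dil_diff1 :: "(real \<Rightarrow> complex) \<Rightarrow> real \<Rightarrow> complex" where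
  "dil_diff1 f x = f (4 * x) - 3 * f (2 * x) + 2 * f x"
definition dil_diff2 :: "(real \<Rightarrow> complex) \<Rightarrow> real \<Rightarrow> complex" where
  "dil_diff2 f x = f (8 * x) - 7 * f (4 * x) + 14 * f (2 * x) - 8 * f x"
definition dil_diff3 :: "(real \<Rightarrow> complex) \<Rightarrow> real \<Rightarrow> complex" where
  "dil_diff3 f x = f (16 * x) - 15 * f (8 * x) + 70 * f (4 * x) - 120 * f (2 * x) + 64 * f x"

text \<open>Multiplication by x turns X into 2 X, and (2X - 1)(2X - 2)(2X - 4)(2X - 8) = 8 (2X -
  1)(X - 1)(X - 2)(X - 4). A factor x in the equation thus lowers by one the order of the difference
  to be estimated.\<close>

lemma dil_diff3_shift: "dil_diff3 (\<lambda>x. of_real x * f x) x = 8 * of_real x * (2 * dil_diff2 f (2 * x) - dil_diff2 f x)"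
  by (simp add: dil_diff3_def dil_diff2_def algebra_simps)

lemma dil_diff2_shift: "dil_diff2 (\<lambda>x. of_real x * f x) x = 4 * of_real x * (2 * dil_diff1 f (2 * x) - dil_diff1 f x)"
  by (simp add: dil_diff1_def dil_diff2_def algebra_simps)

section \<open>Bounds for dilation differences of the exponential\<close>

abbreviation ee :: "real \<Rightarrow> complex" where "ee x \<equiv> cis (- x)"

lemma norm_diff_le: "norm (a - b) \<le> c + d" if "norm a \<le> c" "norm b \<le> d" for a b :: complex
  using norm_triangle_ineq4[of a b] that by linarith
lemma norm_add_le: "norm (a + b) \<le> c + d" if "norm a \<le> c" "norm b \<le> d" for a b :: complex
  using norm_triangle_ineq[of a b] that by linarith

lemma norm_mult_numeral_le: "norm (a::complex) \<le> c \<Longrightarrow> norm (numeral n * a) \<le> numeral n * c"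
  by (simp add: norm_mult)

lemma cis_minus_approx: "cmod (ee x - (\<Sum>k\<le>n. (- \<i> * x) ^ k / fact k)) \<le> \<bar>x\<bar> ^ Suc n / fact (Suc n)"
  using iexp_approx1[of "- x" n] by (simp add: cis_conv_exp)

text \<open>The Taylor polynomial of degree 1 is annihilated, so only the remainder, at most x^2 /
  2, contributes; 15 is (4^2 + 3 * 2^2 + 2) / 2. The constants 180 and 6120 of the next two lemmas
  arise in the same way from the remainders of order 3 and 4.\<close>

lemma dil_diff1_ee_le: "cmod (dil_diff1 ee x) \<le> 15 * x\<^sup>2"
proof -
  define R where "R x = ee x - (\<Sum>k\<le>1. (- \<i> * complex_of_real x) ^ k / fact k)" for x
  have R: "cmod (R x) \<le> x\<^sup>2 / 2" for x
    using cis_minus_approx[of x 1] by (simp add: R_def numeral_2_eq_2)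
  have "dil_diff1 ee x = dil_diff1 R x"
    by (simp add: dil_diff1_def R_def algebra_simps)
  also have "cmod (dil_diff1 R x) \<le> (4*x)\<^sup>2/2 + 3 * ((2*x)\<^sup>2/2) + 2 * (x\<^sup>2/2)"
    unfolding dil_diff1_def by (intro norm_diff_le norm_add_le) (simp_all only: R norm_mult_numeral_le[OF R])
  finally show ?thesis by (simp add: power_mult_distrib)
qed

lemma dil_diff2_ee_le: "cmod (dil_diff2 ee x) \<le> 180 * \<bar>x\<bar> ^ 3"
proof -
  define R where "R x = ee x - (\<Sum>k\<le>2. (- \<i> * complex_of_real x) ^ k / fact k)" for x
  have R: "cmod (R x) \<le> \<bar>x\<bar> ^ 3 / 6" for x
    using cis_minus_approx[of x 2] by (simp add: R_def numeral_3_eq_3)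
  have "dil_diff2 ee x = dil_diff2 R x"
    by (simp add: dil_diff2_def R_def algebra_simps numeral_2_eq_2)
  also have "cmod (dil_diff2 R x) \<le> \<bar>8*x\<bar>^3/6 + 7 * (\<bar>4*x\<bar>^3/6) + 14 * (\<bar>2*x\<bar>^3/6) + 8 * (\<bar>x\<bar>^3/6)"
    unfolding dil_diff2_def by (intro norm_diff_le norm_add_le) (simp_all only: R norm_mult_numeral_le[OF R])
  finally show ?thesis by (simp add: power_mult_distrib abs_mult)
qed

lemma dil_diff3_ee_le: "cmod (dil_diff3 ee x) \<le> 6120 * x ^ 4"
proof -
  define R where "R x = ee x - (\<Sum>k\<le>3. (- \<i> * complex_of_real x) ^ k / fact k)" for x
  have R: "cmod (R x) \<le> x ^ 4 / 24" for x
    using cis_minus_approx[of x 3] by (simp add: R_def fact_numeral)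
  have "dil_diff3 ee x = dil_diff3 R x"
    by (simp add: dil_diff3_def R_def algebra_simps numeral_3_eq_3 numeral_2_eq_2)
  also have "cmod (dil_diff3 R x) \<le> (16*x)^4/24 + 15 * ((8*x)^4/24) + 70 * ((4*x)^4/24) + 120 * ((2*x)^4/24) + 64 * (x^4/24)"
    unfolding dil_diff3_def by (intro norm_diff_le norm_add_le) (simp_all only: R norm_mult_numeral_le[OF R])
  finally show ?thesis by (simp add: power_mult_distrib)
qed

lemma dil_diff2_ee_bounded: "cmod (dil_diff2 ee x) \<le> 30"
proof -
  have "cmod (dil_diff2 ee x) \<le> 1 + 7 * 1 + 14 * 1 + 8 * 1"
    unfolding dil_diff2_def by (intro norm_diff_le norm_add_le) (auto simp: norm_mult)
  then show ?thesis by simp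
qed

lemma dil_diff3_ee_bounded: "cmod (dil_diff3 ee x) \<le> 270"
proof -
  have "cmod (dil_diff3 ee x) \<le> 1 + 15 * 1 + 70 * 1 + 120 * 1 + 64 * 1"
    unfolding dil_diff3_def by (intro norm_diff_le norm_add_le) (auto simp: norm_mult)
  then show ?thesis by simp
qed

text \<open>Interpolates between the cubic bound for |x| <= 1 and the trivial bound 30 beyond. A
  fractional exponent is wanted because for small a the weight 7/2 + a does not afford a full third
  power of x.\<close>

lemma dil_diff2_ee_le_powr:
  assumes "2 \<le> q" "q \<le> 3"
  shows "cmod (dil_diff2 ee x) \<le> 180 * \<bar>x\<bar> powr q"
proof (cases "\<bar>x\<bar> \<le> 1")
  case True
  then have "\<bar>x\<bar> powr 3 \<le> \<bar>x\<bar> powr q"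
    using assms by (intro powr_mono') auto
  moreover have "\<bar>x\<bar> powr 3 = \<bar>x\<bar> ^ 3" by (cases "x = 0") (simp_all flip: powr_numeral)
  ultimately show ?thesis using dil_diff2_ee_le[of x] by simp
next
  case False
  then have "1 \<le> \<bar>x\<bar> powr q" using assms by (intro ge_one_powr_ge_zero) auto
  then show ?thesis using dil_diff2_ee_bounded[of x] by simp
qed

text \<open>Dilation by c multiplies the quotient by c^p and leaves its limit unchanged, so the
  coefficient is the polynomial (X - 1)(X - 2)(X - 4)(X - 8) evaluated at X = 2^p. Only the leading
  behaviour of f at 0 enters.\<close>

lemma tendsto_dil_diff3_div_powr:
  assumes "((\<lambda>x. f x / of_real (x powr p)) \<longlongrightarrow> l) (at_right 0)"
  shows "((\<lambda>x. dil_diff3 f x / of_real (x powr p)) \<longlongrightarrow>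
    of_real ((2 powr p - 1) * (2 powr p - 2) * (2 powr p - 4) * (2 powr p - 8)) * l) (at_right 0)"
proof -
  define X where "X = 2 powr p"
  define g where "g x = f x / complex_of_real (x powr p)" for x
  have sc: "((\<lambda>x. g (c * x)) \<longlongrightarrow> l) (at_right 0)" if "c > 0" for c
  proof -
    have "filterlim (\<lambda>x. c * x) (at_right 0) (at_right 0)"
      unfolding filterlim_at using that
      by (auto simp: eventually_at_right_less tendsto_mult_right_zero eventually_at intro!: exI[of _ 1] tendsto_eq_intros)
    from filterlim_compose[OF assms[folded g_def] this] show ?thesis .
  qed
  have X: "4 powr p = X^2" "8 powr p = X^3" "16 powr p = X^4"
    using powr_mult[of 2 2 p] powr_mult[of 2 4 p] powr_mult[of 4 4 p]
    by (auto simp: X_def power2_eq_square power3_eq_cube power4_eq_xxxx)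
  have "((\<lambda>x. of_real (X^4) * g (16 * x) - 15 * of_real (X^3) * g (8 * x) + 70 * of_real (X^2) * g (4 * x) - 120 * of_real X * g (2 * x) + 64 * g (1 * x))
      \<longlongrightarrow> of_real (X^4) * l - 15 * of_real (X^3) * l + 70 * of_real (X^2) * l - 120 * of_real X * l + 64 * l) (at_right 0)"
    by (intro tendsto_intros sc) auto
  also have "of_real (X^4) * l - 15 * of_real (X^3) * l + 70 * of_real (X^2) * l - 120 * of_real X * l + 64 * l
    = of_real ((X - 1) * (X - 2) * (X - 4) * (X - 8)) * l"
    by (simp add: algebra_simps power2_eq_square power3_eq_cube power4_eq_xxxx)
  finally show ?thesis
    unfolding X_def[symmetric]
  proof (rule Lim_transform_eventually)
    show "\<forall>\<^sub>F x in at_right 0. of_real (X^4) * g (16 * x) - 15 * of_real (X^3) * g (8 * x) + 70 * of_real (X^2) * g (4 * x) - 120 * of_real X * g (2 * x) + 64 * g (1 * x) = dil_diff3 f x / of_real (x powr p)"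
      using eventually_at_right_less
    proof eventually_elim
      case (elim x)
      have "X > 0" by (simp add: X_def)
      then show ?case using elim
        by (simp add: dil_diff3_def g_def powr_mult X diff_divide_distrib add_divide_distrib X_def[symmetric])
    qed
  qed
qed

section \<open>Fourier inversion in the plane\<close>

lemma integral_lborel_affine:
  fixes f :: "'a::euclidean_space \<Rightarrow> 'b::{banach, second_countable_topology}"
  assumes [measurable]: "f \<in> borel_measurable borel" and c: "c \<noteq> 0"
  shows "(LINT x|lborel. f x) = \<bar>c\<bar> ^ DIM('a) *\<^sub>R (LINT x|lborel. f (t + c *\<^sub>R x))"
  by (subst lborel_affine[OF c, of t]) (simp add: integral_density integral_distr)

lemma integrable_lborel_affine:
  fixes f :: "'a::euclidean_space \<Rightarrow> 'b::{banach, second_countable_topology}"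
  assumes f: "integrable lborel f" and c: "c \<noteq> 0"
  shows "integrable lborel (\<lambda>x. f (t + c *\<^sub>R x))"
proof -
  have [measurable]: "f \<in> borel_measurable borel" using f by auto
  have "integrable (density (distr lborel borel (\<lambda>x. t + c *\<^sub>R x)) (\<lambda>_. ennreal (\<bar>c\<bar> ^ DIM('a)))) f"
    using f unfolding lborel_affine[OF c, of t, symmetric] .
  then have "integrable lborel (\<lambda>x. \<bar>c\<bar> ^ DIM('a) *\<^sub>R f (t + c *\<^sub>R x))"
    by (simp add: integrable_density integrable_distr_eq)
  from integrable_scaleR_right[OF this, of "inverse (\<bar>c\<bar> ^ DIM('a))"] show ?thesis
    using c by simp
qed

lemma integrable_mult_tensor:
  fixes f :: "'a::euclidean_space \<Rightarrow> complex" and g :: "'b::euclidean_space \<Rightarrow> complex"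
  assumes f: "integrable lborel f" and g: "integrable lborel g"
  shows "integrable (lborel \<Otimes>\<^sub>M lborel) (\<lambda>(x, y). f x * g y)"
  by (rule lborel_pair.Fubini_integrable) (use f g in \<open>auto simp: norm_mult\<close>)

lemma integrable_unimodular_mult:
  fixes f g :: "'a \<Rightarrow> complex"
  assumes "integrable M f" "g \<in> borel_measurable M" "\<And>x. cmod (g x) \<le> 1"
  shows "integrable M (\<lambda>x. f x * g x)"
  by (rule Bochner_Integration.integrable_bound[OF assms(1)])
    (use assms in \<open>auto simp: norm_mult intro!: mult_left_le\<close>)

lemma fourier2_inner: "fourier2 f q = (LINT p|lborel. complex_of_real (f p) * cis (- (p \<bullet> q)))"
  by (cases q) (simp add: fourier2_def inner_prod_def)

section \<open>Gaussian transforms in one and two variables\<close>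

lemma gauss_fourier_1:
  "integrable lborel (\<lambda>x. complex_of_real (exp (- (x\<^sup>2 / 2))))"
  "(LINT x|lborel. complex_of_real (exp (- (x\<^sup>2 / 2))) * cis (t * x)) = sqrt (2 * pi) * exp (- (t\<^sup>2 / 2))"
proof -
  have e: "exp (- (x\<^sup>2 / 2)) = sqrt (2 * pi) * std_normal_density x" for x :: real
    by (simp add: std_normal_density_def)
  have "integrable lborel (\<lambda>x. sqrt (2 * pi) * std_normal_density x)"
    by simp
  then show "integrable lborel (\<lambda>x. complex_of_real (exp (- (x\<^sup>2 / 2))))"
    unfolding e[symmetric] by simp
  have "(LINT x|lborel. complex_of_real (std_normal_density x) * cis (t * x)) = exp (- (t\<^sup>2 / 2))"
    using fun_cong[OF char_std_normal_distribution, of t]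
    by (simp add: char_def integral_density normal_density_nonneg cis_conv_exp scaleR_conv_of_real)
  then show "(LINT x|lborel. complex_of_real (exp (- (x\<^sup>2 / 2))) * cis (t * x)) = sqrt (2 * pi) * exp (- (t\<^sup>2 / 2))"
    by (simp only: e of_real_mult mult.assoc integral_mult_right_zero)
qed

definition Gauss :: "real \<times> real \<Rightarrow> real" where
  "Gauss z = exp (- (z \<bullet> z) / 2)"

lemma Gauss_prod: "complex_of_real (Gauss z) = complex_of_real (exp (- ((fst z)\<^sup>2 / 2))) * complex_of_real (exp (- ((snd z)\<^sup>2 / 2)))"
  by (simp add: Gauss_def inner_prod_def power2_eq_square exp_add[symmetric] add_divide_distrib
      flip: of_real_mult)

lemma Gauss_measurable [measurable]: "Gauss \<in> borel_measurable borel"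
  unfolding Gauss_def by measurable

lemma Gauss_le_1: "Gauss z \<le> 1" and Gauss_pos: "Gauss z > 0"
  by (auto simp: Gauss_def)

lemma integrable_Gauss: "integrable lborel (\<lambda>z. complex_of_real (Gauss z))"
  unfolding Gauss_prod by (intro integrable_tensor gauss_fourier_1)

lemma integrable_Gauss_real: "integrable lborel Gauss"
  using integrable_Gauss by (subst (asm) complex_of_real_integrable_eq)

lemma integrable_box_const: "integrable lborel (\<lambda>p. indicator (box a b) p *\<^sub>R (c::real))"
  for a b :: "'a::euclidean_space"
  by (intro integrable_scaleR_left integrable_real_indicator) (auto simp: emeasure_lborel_box_finite[unfolded infinity_ennreal_def])

lemma Gauss_fourier: "(LINT z|lborel. complex_of_real (Gauss z) * cis (v \<bullet> z)) = 2 * pi * Gauss v"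
proof -
  have "(LINT z|lborel. complex_of_real (Gauss z) * cis (v \<bullet> z))
    = (LINT z|lborel. (complex_of_real (exp (- ((fst z)\<^sup>2 / 2))) * cis (fst v * fst z))
        * (complex_of_real (exp (- ((snd z)\<^sup>2 / 2))) * cis (snd v * snd z)))"
    unfolding Gauss_prod by (intro Bochner_Integration.integral_cong) (auto simp: inner_prod_def cis_mult[symmetric])
  also have "\<dots> = (sqrt (2 * pi) * exp (- ((fst v)\<^sup>2 / 2))) * (sqrt (2 * pi) * exp (- ((snd v)\<^sup>2 / 2)))"
    by (subst integral_tensor)
      (auto intro!: integrable_unimodular_mult gauss_fourier_1 simp: gauss_fourier_1(2) simp del: of_real_exp)
  also have "\<dots> = complex_of_real (2 * pi) * Gauss v"
    unfolding Gauss_prod by (simp flip: of_real_mult)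
  finally show ?thesis by simp
qed

lemma integral_Gauss: "(LINT z|lborel. complex_of_real (Gauss z)) = 2 * pi"
  using Gauss_fourier[of 0] by (simp add: Gauss_def)

lemma Gauss_fourier_scaled:
  assumes "e > 0"
  shows "e\<^sup>2 * (LINT q|lborel. complex_of_real (Gauss (e *\<^sub>R q)) * cis (v \<bullet> q)) = 2 * pi * Gauss (v /\<^sub>R e)"
  unfolding Gauss_fourier[symmetric]
  by (subst (2) integral_lborel_affine[where c = e and t = 0])
    (use assms in \<open>auto simp: scaleR_conv_of_real power2_eq_square simp flip: mult.assoc\<close>)

lemma integrable_Gauss_scaled:
  assumes "e > 0"
  shows "integrable lborel (\<lambda>q. complex_of_real (Gauss (e *\<^sub>R q)))"
  using integrable_lborel_affine[OF integrable_Gauss, of e 0] assms by simp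

section \<open>Inversion for a function that is integrable together with its transform\<close>

context
  fixes f :: "real \<times> real \<Rightarrow> real"
  assumes f: "integrable lborel f" and fh: "integrable lborel (fourier2 f)"
begin

lemma f_measurable [measurable]: "f \<in> borel_measurable borel"
  using f by auto

lemma fh_measurable [measurable]: "fourier2 f \<in> borel_measurable borel"
  using fh by auto

lemma fc: "integrable lborel (\<lambda>p. complex_of_real (f p))"
  using f by simp

text \<open>The Gaussian damping makes the double integral in frequency and space absolutely
  convergent. Fubini and the self-duality of the Gaussian then turn the inverse transform into an
  average of f over translates of size e.\<close>

lemma gauss_regularised:
  assumes e: "e > 0"
  shows "(LINT q|lborel. fourier2 f q * (complex_of_real (Gauss (e *\<^sub>R q)) * cis (p \<bullet> q)))
    = 2 * pi * (LINT z|lborel. f (p - e *\<^sub>R z) * Gauss z)"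
proof -
  have int: "integrable (lborel \<Otimes>\<^sub>M lborel)
      (\<lambda>(q, p'). complex_of_real (Gauss (e *\<^sub>R q)) * complex_of_real (f p') * cis ((p - p') \<bullet> q))"
    using integrable_unimodular_mult[OF integrable_mult_tensor[OF integrable_Gauss_scaled[OF e] fc],
        of "\<lambda>(q, p'). cis ((p - p') \<bullet> q)"]
    by (simp add: case_prod_beta')
  have "(LINT q|lborel. fourier2 f q * (complex_of_real (Gauss (e *\<^sub>R q)) * cis (p \<bullet> q)))
    = (LINT q|lborel. LINT p'|lborel. complex_of_real (Gauss (e *\<^sub>R q)) * complex_of_real (f p') * cis ((p - p') \<bullet> q))"
    unfolding fourier2_inner
  proof (intro Bochner_Integration.integral_cong refl, subst integral_mult_left_zero[symmetric],
      intro Bochner_Integration.integral_cong refl)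
    fix q p' :: "real \<times> real"
    have "cis ((p - p') \<bullet> q) = cis (- (p' \<bullet> q)) * cis (p \<bullet> q)"
      by (simp add: cis_mult inner_diff_left)
    then show "complex_of_real (f p') * cis (- (p' \<bullet> q)) * (complex_of_real (Gauss (e *\<^sub>R q)) * cis (p \<bullet> q))
      = complex_of_real (Gauss (e *\<^sub>R q)) * complex_of_real (f p') * cis ((p - p') \<bullet> q)"
      by simp
  qed
  also have "\<dots> = (LINT p'|lborel. LINT q|lborel. complex_of_real (Gauss (e *\<^sub>R q)) * complex_of_real (f p') * cis ((p - p') \<bullet> q))"
    using lborel_pair.Fubini_integral[OF int] by simp
  also have "\<dots> = (LINT p'|lborel. complex_of_real (f p' * (2 * pi / e\<^sup>2 * Gauss ((p - p') /\<^sub>R e))))"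
  proof (intro Bochner_Integration.integral_cong refl)
    fix p' :: "real \<times> real"
    have "(LINT q|lborel. complex_of_real (Gauss (e *\<^sub>R q)) * complex_of_real (f p') * cis ((p - p') \<bullet> q))
      = f p' * (LINT q|lborel. complex_of_real (Gauss (e *\<^sub>R q)) * cis ((p - p') \<bullet> q))"
      by (simp flip: integral_mult_right_zero add: mult_ac)
    also have "(LINT q|lborel. complex_of_real (Gauss (e *\<^sub>R q)) * cis ((p - p') \<bullet> q)) = 2 * pi / e\<^sup>2 * Gauss ((p - p') /\<^sub>R e)"
      using Gauss_fourier_scaled[OF e, of "p - p'"] e by (simp add: field_simps)
    finally show "(LINT q|lborel. complex_of_real (Gauss (e *\<^sub>R q)) * complex_of_real (f p') * cis ((p - p') \<bullet> q))
      = complex_of_real (f p' * (2 * pi / e\<^sup>2 * Gauss ((p - p') /\<^sub>R e)))" by simp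
  qed
  also have "\<dots> = complex_of_real (LINT p'|lborel. f p' * (2 * pi / e\<^sup>2 * Gauss ((p - p') /\<^sub>R e)))"
    by (rule integral_complex_of_real)
  \<comment> \<open>Substitution p' = p - e z; its Jacobian e^2 in the plane cancels the factor 1 /
    e^2.\<close>
  also have "(LINT p'|lborel. f p' * (2 * pi / e\<^sup>2 * Gauss ((p - p') /\<^sub>R e)))
     = 2 * pi * (LINT z|lborel. f (p - e *\<^sub>R z) * Gauss z)"
  proof (subst integral_lborel_affine[where c = "- e" and t = p])
    have "(LINT z|lborel. f (p + (- e) *\<^sub>R z) * (2 * pi / e\<^sup>2 * Gauss ((p - (p + (- e) *\<^sub>R z)) /\<^sub>R e)))
      = (LINT z|lborel. 2 * pi / e\<^sup>2 * (f (p - e *\<^sub>R z) * Gauss z))"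
      using e by (intro Bochner_Integration.integral_cong) auto
    also have "\<dots> = 2 * pi / e\<^sup>2 * (LINT z|lborel. f (p - e *\<^sub>R z) * Gauss z)"
      by (rule integral_mult_right_zero)
    finally show "\<bar>- e\<bar> ^ DIM(real \<times> real) *\<^sub>R (LINT z|lborel. f (p + (- e) *\<^sub>R z) * (2 * pi / e\<^sup>2 * Gauss ((p - (p + (- e) *\<^sub>R z)) /\<^sub>R e)))
      = 2 * pi * (LINT z|lborel. f (p - e *\<^sub>R z) * Gauss z)"
      using e by (simp add: power2_eq_square)
  qed (use e in auto)
  finally show ?thesis by simp
qed

definition inv_fourier2 :: "real \<times> real \<Rightarrow> complex" where
  "inv_fourier2 p = (LINT q|lborel. fourier2 f q * cis (p \<bullet> q))"

text \<open>Translation invariance moves the shift by e z from f onto the indicator. The limit e to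
  0 then concerns an indicator instead of translates of a merely integrable f.\<close>

lemma indicator_gauss_regularised:
  assumes e: "e > 0" and [measurable]: "B \<in> sets borel"
  shows "(LINT p|lborel. indicator B p *\<^sub>R (LINT q|lborel. fourier2 f q * (complex_of_real (Gauss (e *\<^sub>R q)) * cis (p \<bullet> q))))
    = 2 * pi * (LINT z|lborel. Gauss z * (LINT p|lborel. indicator B (p + e *\<^sub>R z) * f p))"
proof -
  have "integrable (lborel \<Otimes>\<^sub>M lborel) (\<lambda>(z, p). Gauss z * f (p - e *\<^sub>R z))"
  proof (rule lborel_pair.Fubini_integrable)
    have sh: "integrable lborel (\<lambda>p. f (p - e *\<^sub>R z))" "(LINT p|lborel. \<bar>f (p - e *\<^sub>R z)\<bar>) = (LINT p|lborel. \<bar>f p\<bar>)" for z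
      using integrable_lborel_affine[OF f, of 1 "- e *\<^sub>R z"]
        integral_lborel_affine[of "\<lambda>p. \<bar>f p\<bar>" 1 "- e *\<^sub>R z"] by simp_all
    show "AE z in lborel. integrable lborel (\<lambda>p. case (z, p) of (z, p) \<Rightarrow> Gauss z * f (p - e *\<^sub>R z))"
      using sh(1) by simp
    show "integrable lborel (\<lambda>z. LINT p|lborel. norm (case (z, p) of (z, p) \<Rightarrow> Gauss z * f (p - e *\<^sub>R z)))"
      using integrable_Gauss_real by (simp add: abs_mult sh(2) abs_of_pos[OF Gauss_pos])
  qed simp
  then have "integrable (lborel \<Otimes>\<^sub>M lborel) (\<lambda>zp. indicator B (snd zp) *\<^sub>R (case zp of (z, p) \<Rightarrow> Gauss z * f (p - e *\<^sub>R z)))"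
    by (rule Bochner_Integration.integrable_bound) (auto simp: indicator_def)
  then have int: "integrable (lborel \<Otimes>\<^sub>M lborel) (\<lambda>(z, p). indicator B p * (Gauss z * f (p - e *\<^sub>R z)))"
    by (simp add: case_prod_beta')
  have "(LINT p|lborel. indicator B p *\<^sub>R (LINT q|lborel. fourier2 f q * (complex_of_real (Gauss (e *\<^sub>R q)) * cis (p \<bullet> q))))
    = (LINT p|lborel. complex_of_real (2 * pi * (LINT z|lborel. indicator B p * (Gauss z * f (p - e *\<^sub>R z)))))"
    unfolding gauss_regularised[OF e] integral_mult_right_zero
    by (intro Bochner_Integration.integral_cong refl) (simp add: scaleR_conv_of_real mult_ac)
  also have "\<dots> = complex_of_real (LINT p|lborel. 2 * pi * (LINT z|lborel. indicator B p * (Gauss z * f (p - e *\<^sub>R z))))"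
    by (rule integral_complex_of_real)
  also have "(LINT p|lborel. 2 * pi * (LINT z|lborel. indicator B p * (Gauss z * f (p - e *\<^sub>R z))))
    = 2 * pi * (LINT p|lborel. LINT z|lborel. indicator B p * (Gauss z * f (p - e *\<^sub>R z)))"
    by (rule integral_mult_right_zero)
  also have "(LINT p|lborel. LINT z|lborel. indicator B p * (Gauss z * f (p - e *\<^sub>R z)))
    = (LINT z|lborel. LINT p|lborel. indicator B p * (Gauss z * f (p - e *\<^sub>R z)))"
    using lborel_pair.Fubini_integral[OF int] by simp
  also have "\<dots> = (LINT z|lborel. Gauss z * (LINT p|lborel. indicator B (p + e *\<^sub>R z) * f p))"
  proof (intro Bochner_Integration.integral_cong refl)
    fix z
    show "(LINT p|lborel. indicator B p * (Gauss z * f (p - e *\<^sub>R z))) = Gauss z * (LINT p|lborel. indicator B (p + e *\<^sub>R z) * f p)"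
      by (subst integral_lborel_affine[where c = 1 and t = "e *\<^sub>R z"])
        (simp_all add: add.commute mult_ac flip: integral_mult_right_zero)
  qed
  finally show ?thesis .
qed

lemma inv_fourier2_measurable [measurable]: "inv_fourier2 \<in> borel_measurable borel"
  unfolding inv_fourier2_def by measurable

lemma norm_inv_fourier2_le: "norm (inv_fourier2 p) \<le> (LINT q|lborel. norm (fourier2 f q))"
  unfolding inv_fourier2_def by (rule order_trans[OF integral_norm_bound]) (simp add: norm_mult)

text \<open>Dominated convergence on both sides of the regularised identity. The shifted indicator
  converges off the frontier of the box, which is a null set; this is the reason to begin with
  boxes. One factor 2 pi comes from the transform of the Gaussian, the other from its total
  mass.\<close>

lemma inversion_box:
  "(LINT p|lborel. indicator (box a b) p *\<^sub>R inv_fourier2 p) = (LINT p|lborel. indicator (box a b) p *\<^sub>R ((2 * pi)\<^sup>2 * complex_of_real (f p)))"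
proof -
  define B where "B = box a b"
  define e where "e n = 1 / real (Suc n)" for n
  have e: "e n > 0" for n by (simp add: e_def)
  have e0: "e \<longlonglongrightarrow> 0" unfolding e_def by (rule lim_inverse_n'[THEN LIMSEQ_Suc])
  have [measurable]: "B \<in> sets borel" by (simp add: B_def)
  define g where "g n p = (LINT q|lborel. fourier2 f q * (complex_of_real (Gauss (e n *\<^sub>R q)) * cis (p \<bullet> q)))" for n p
  have Gl: "(\<lambda>n. Gauss (e n *\<^sub>R q)) \<longlonglongrightarrow> 1" for q
  proof -
    have "(\<lambda>n. Gauss (e n *\<^sub>R q)) \<longlonglongrightarrow> exp (- ((0 *\<^sub>R q) \<bullet> (0 *\<^sub>R q)) / 2)"
      unfolding Gauss_def by (intro tendsto_intros e0) simp
    then show ?thesis by simp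
  qed
  have g_lim: "(\<lambda>n. g n p) \<longlonglongrightarrow> inv_fourier2 p" for p
    unfolding g_def inv_fourier2_def
  proof (rule integral_dominated_convergence[where w = "\<lambda>q. norm (fourier2 f q)"])
    have "(\<lambda>n. fourier2 f q * (complex_of_real (Gauss (e n *\<^sub>R q)) * cis (p \<bullet> q))) \<longlonglongrightarrow> fourier2 f q * (of_real 1 * cis (p \<bullet> q))" for q
      by (intro tendsto_intros Gl)
    then show "AE q in lborel. (\<lambda>n. fourier2 f q * (complex_of_real (Gauss (e n *\<^sub>R q)) * cis (p \<bullet> q))) \<longlonglongrightarrow> fourier2 f q * cis (p \<bullet> q)"
      by simp
    show "AE q in lborel. norm (fourier2 f q * (complex_of_real (Gauss (e n *\<^sub>R q)) * cis (p \<bullet> q))) \<le> norm (fourier2 f q)" for n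
      by (auto simp: norm_mult abs_of_pos[OF Gauss_pos] intro!: mult_left_le Gauss_le_1)
  qed (use fh in auto)
  have g_bound: "norm (g n p) \<le> (LINT q|lborel. norm (fourier2 f q))" for n p
    unfolding g_def
  proof (rule order_trans[OF integral_norm_bound], rule integral_mono_AE')
    show "AE q in lborel. norm (fourier2 f q * (complex_of_real (Gauss (e n *\<^sub>R q)) * cis (p \<bullet> q))) \<le> norm (fourier2 f q)"
      by (auto simp: norm_mult abs_of_pos[OF Gauss_pos] intro!: mult_left_le Gauss_le_1)
  qed (use fh in auto)
  have [measurable]: "g n \<in> borel_measurable borel" for n
    unfolding g_def by measurable
  have "(\<lambda>n. LINT p|lborel. indicator B p *\<^sub>R g n p) \<longlonglongrightarrow> (LINT p|lborel. indicator B p *\<^sub>R inv_fourier2 p)"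
  proof (rule integral_dominated_convergence[where w = "\<lambda>p. indicator B p *\<^sub>R (LINT q|lborel. norm (fourier2 f q))"])
    show "integrable lborel (\<lambda>p. indicator B p *\<^sub>R (LINT q|lborel. norm (fourier2 f q)))"
      unfolding B_def by (rule integrable_box_const)
    show "AE p in lborel. (\<lambda>n. indicator B p *\<^sub>R g n p) \<longlonglongrightarrow> indicator B p *\<^sub>R inv_fourier2 p"
      by (auto intro!: tendsto_intros g_lim)
    show "AE p in lborel. norm (indicator B p *\<^sub>R g n p) \<le> indicator B p *\<^sub>R (LINT q|lborel. norm (fourier2 f q))" for n
      using g_bound by (auto simp: indicator_def)
  qed auto
  moreover have "(\<lambda>n. LINT p|lborel. indicator B p *\<^sub>R g n p) \<longlonglongrightarrow> complex_of_real (2 * pi * (LINT z|lborel. Gauss z * (LINT p|lborel. indicator B p * f p)))"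
    unfolding g_def indicator_gauss_regularised[OF e \<open>B \<in> sets borel\<close>]
  proof (intro tendsto_intros integral_dominated_convergence[where w = "\<lambda>z. Gauss z * (LINT p|lborel. \<bar>f p\<bar>)"])
    show "integrable lborel (\<lambda>z. Gauss z * (LINT p|lborel. \<bar>f p\<bar>))"
      using integrable_Gauss_real by simp
    have fr: "AE p in lborel. p \<notin> frontier B"
    proof -
      have "negligible (frontier B)"
        unfolding B_def by (intro negligible_convex_frontier convex_box)
      moreover have "frontier B \<in> sets borel" by (auto intro: borel_closed)
      ultimately show ?thesis
        by (auto simp: negligible_iff_null_sets null_sets_completion_iff intro: AE_not_in)
    qed
    have ind: "(\<lambda>n. indicator B (p + e n *\<^sub>R z)) \<longlonglongrightarrow> (indicator B p :: real)" if p: "p \<notin> frontier B" for p z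
    proof -
      have l: "(\<lambda>n. p + e n *\<^sub>R z) \<longlonglongrightarrow> p"
        using tendsto_add[OF tendsto_const tendsto_scaleR[OF e0 tendsto_const], of p z] by simp
      have "interior B = B" by (simp add: B_def interior_open open_box)
      then consider "p \<in> B" | "p \<in> - closure B"
        using p by (auto simp: frontier_def)
      then show ?thesis
      proof cases
        case 1
        then have "\<forall>\<^sub>F n in sequentially. p + e n *\<^sub>R z \<in> B"
          using topological_tendstoD[OF l, of B] by (simp add: B_def open_box)
        then show ?thesis
          using 1 by (intro tendsto_eventually) (auto elim: eventually_mono)
      next
        case 2
        then have "\<forall>\<^sub>F n in sequentially. p + e n *\<^sub>R z \<in> - closure B"
          using topological_tendstoD[OF l, of "- closure B"] by (simp add: open_Compl)
        then show ?thesis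
          using 2 closure_subset[of B] by (intro tendsto_eventually) (auto elim!: eventually_mono simp: indicator_def)
      qed
    qed
    have "(\<lambda>n. LINT p|lborel. indicator B (p + e n *\<^sub>R z) * f p) \<longlonglongrightarrow> (LINT p|lborel. indicator B p * f p)" for z
    proof (rule integral_dominated_convergence[where w = "\<lambda>p. \<bar>f p\<bar>"])
      show "AE p in lborel. (\<lambda>n. indicator B (p + e n *\<^sub>R z) * f p) \<longlonglongrightarrow> indicator B p * f p"
        using fr by eventually_elim (intro tendsto_intros ind)
    qed (use f in \<open>auto simp: indicator_def\<close>)
    then show "AE z in lborel. (\<lambda>n. Gauss z * (LINT p|lborel. indicator B (p + e n *\<^sub>R z) * f p)) \<longlonglongrightarrow> Gauss z * (LINT p|lborel. indicator B p * f p)"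
      by (auto intro!: tendsto_intros)
    have "\<bar>LINT p|lborel. indicator B (p + e n *\<^sub>R z) * f p\<bar> \<le> (LINT p|lborel. \<bar>f p\<bar>)" for n z
      by (rule order_trans[OF integral_abs_bound], rule integral_mono_AE') (use f in \<open>auto simp: indicator_def\<close>)
    then show "AE z in lborel. norm (Gauss z * (LINT p|lborel. indicator B (p + e n *\<^sub>R z) * f p)) \<le> Gauss z * (LINT p|lborel. \<bar>f p\<bar>)" for n
      by (auto simp: abs_mult abs_of_pos[OF Gauss_pos] intro!: mult_left_mono less_imp_le[OF Gauss_pos])
  qed auto
  ultimately have "(LINT p|lborel. indicator B p *\<^sub>R inv_fourier2 p) = complex_of_real (2 * pi * (LINT z|lborel. Gauss z * (LINT p|lborel. indicator B p * f p)))"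
    by (rule LIMSEQ_unique)
  also have "(LINT z|lborel. Gauss z * (LINT p|lborel. indicator B p * f p)) = 2 * pi * (LINT p|lborel. indicator B p * f p)"
  proof -
    have "complex_of_real (LINT z|lborel. Gauss z) = complex_of_real (2 * pi)"
      using integral_Gauss by simp
    then show ?thesis by (simp only: of_real_eq_iff integral_mult_left_zero)
  qed
  also have "2 * pi * \<dots> = (2 * pi)\<^sup>2 * (LINT p|lborel. indicator B p * f p)"
    by (simp add: power2_eq_square)
  also have "\<dots> = (LINT p|lborel. (2 * pi)\<^sup>2 * (indicator B p * f p))"
    by (rule integral_mult_right_zero[symmetric])
  also have "complex_of_real \<dots> = (LINT p|lborel. complex_of_real ((2 * pi)\<^sup>2 * (indicator B p * f p)))"
    by (rule integral_complex_of_real[symmetric])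
  also have "\<dots> = (LINT p|lborel. indicator B p *\<^sub>R ((2 * pi)\<^sup>2 * complex_of_real (f p)))"
    by (intro Bochner_Integration.integral_cong refl) (simp add: scaleR_conv_of_real)
  finally show ?thesis unfolding B_def .
qed

text \<open>Boxes are stable under intersection and generate the Borel sets, so the identity extends
  by induction over the generated sigma-algebra. The extra factor \<open>indicator (box a b)\<close>
  keeps the left integrand integrable: \<open>inv_fourier2\<close> is bounded, but its integrability
  over the plane is not known at this stage.\<close>

lemma inversion_borel:
  assumes A: "A \<in> sets borel"
  shows "(LINT p|lborel. indicator A p *\<^sub>R (indicator (box a b) p *\<^sub>R inv_fourier2 p)) = (LINT p|lborel. indicator A p *\<^sub>R (indicator (box a b) p *\<^sub>R ((2 * pi)\<^sup>2 * complex_of_real (f p))))"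
proof -
  let ?h = "\<lambda>p. indicator (box a b) p *\<^sub>R inv_fourier2 p" and ?f = "\<lambda>p. indicator (box a b) p *\<^sub>R ((2 * pi)\<^sup>2 * complex_of_real (f p))"
  have h: "integrable lborel ?h"
  proof (rule Bochner_Integration.integrable_bound)
    show "integrable lborel (\<lambda>p. indicator (box a b) p *\<^sub>R (LINT q|lborel. norm (fourier2 f q)))"
      by (rule integrable_box_const)
  qed (use norm_inv_fourier2_le in \<open>auto simp: indicator_def intro: order_trans\<close>)
  have ff: "integrable lborel ?f"
    by (intro integrable_mult_indicator) (use f in auto)
  have seth: "set_integrable lborel S ?h" and setf: "set_integrable lborel S ?f" if "S \<in> sets borel" for S
    unfolding set_integrable_def by (intro integrable_mult_indicator h ff; use that in simp)+
  have "Int_stable (range (\<lambda>(a, b). box a b :: (real \<times> real) set))"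
    by (auto simp: Int_stable_def box_Int_box)
  moreover have "range (\<lambda>(a, b). box a b :: (real \<times> real) set) \<subseteq> Pow UNIV" by simp
  moreover have "A \<in> sigma_sets UNIV (range (\<lambda>(a, b). box a b :: (real \<times> real) set))"
    using A by (simp add: borel_eq_box)
  ultimately show ?thesis
  proof (induction rule: sigma_sets_induct_disjoint)
    case (basic A)
    then obtain c d where A: "A = box c d" by auto
    obtain l u where lu: "box c d \<inter> box a b = box l u" using box_Int_box[of c d a b] by auto
    have "indicator A p *\<^sub>R (indicator (box a b) p *\<^sub>R x) = indicator (box l u) p *\<^sub>R x" for p and x :: complex
      unfolding A lu[symmetric] by (auto simp: indicator_def)
    then show ?case by (simp only: inversion_box)
  next
    case (compl A)
    then have [measurable]: "A \<in> sets borel" by (simp add: borel_eq_box)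
    have i: "indicator (UNIV - A) p *\<^sub>R x = x - indicator A p *\<^sub>R x" for p and x :: complex
      by (auto simp: indicator_def)
    have "integrable lborel (\<lambda>p. indicator A p *\<^sub>R ?h p)" "integrable lborel (\<lambda>p. indicator A p *\<^sub>R ?f p)"
      by (intro integrable_mult_indicator h ff; simp)+
    then show ?case
      using compl h ff inversion_box[of a b] unfolding i by (simp add: Bochner_Integration.integral_diff)
  next
    case (union A)
    then have [measurable]: "A i \<in> sets borel" for i by (auto simp: borel_eq_box)
    have "(LINT p:(\<Union>i. A i)|lborel. ?h p) = (\<Sum>i. (LINT p:A i|lborel. ?h p))"
      by (rule lebesgue_integral_countable_add)
        (use union seth in \<open>auto simp: disjoint_family_on_def\<close>)
    moreover have "(LINT p:(\<Union>i. A i)|lborel. ?f p) = (\<Sum>i. (LINT p:A i|lborel. ?f p))"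
      by (rule lebesgue_integral_countable_add)
        (use union setf in \<open>auto simp: disjoint_family_on_def\<close>)
    ultimately show ?case using union by (simp add: set_lebesgue_integral_def)
  qed simp
qed

text \<open>Integrable functions with equal integrals over all Borel sets agree almost everywhere.
  This is applied on the squares of side 2 n, and the countably many exceptional sets are discarded
  together.\<close>

lemma fourier_inversion: "AE p in lborel. complex_of_real (f p) = (LINT q|lborel. fourier2 f q * cis (p \<bullet> q)) / (2 * pi)\<^sup>2"
proof -
  have "AE p in lborel. indicator (box a b) p *\<^sub>R inv_fourier2 p = indicator (box a b) p *\<^sub>R ((2 * pi)\<^sup>2 * complex_of_real (f p))" for a b
  proof (rule sigma_finite_measure.density_unique_banach[OF lborel.sigma_finite_measure_axioms])
    show "integrable lborel (\<lambda>p. indicator (box a b) p *\<^sub>R inv_fourier2 p)"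
    proof (rule Bochner_Integration.integrable_bound)
      show "integrable lborel (\<lambda>p. indicator (box a b) p *\<^sub>R (LINT q|lborel. norm (fourier2 f q)))"
        by (rule integrable_box_const)
    qed (use norm_inv_fourier2_le in \<open>auto simp: indicator_def intro: order_trans\<close>)
    show "integrable lborel (\<lambda>p. indicator (box a b) p *\<^sub>R ((2 * pi)\<^sup>2 * complex_of_real (f p)))"
      by (intro integrable_mult_indicator) (use f in auto)
  qed (simp only: set_lebesgue_integral_def inversion_borel sets_lborel)
  then have "AE p in lborel. \<forall>n::nat. indicator (box (- (real n *\<^sub>R One)) (real n *\<^sub>R One)) p *\<^sub>R inv_fourier2 p
      = indicator (box (- (real n *\<^sub>R One)) (real n *\<^sub>R One)) p *\<^sub>R ((2 * pi)\<^sup>2 * complex_of_real (f p))"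
    by (simp only: AE_all_countable) blast
  then show ?thesis
  proof eventually_elim
    case (elim p)
    have "p \<in> (\<Union>n::nat. box (- (real n *\<^sub>R One)) (real n *\<^sub>R One))"
      unfolding UN_box_eq_UNIV by simp
    then obtain n :: nat where "p \<in> box (- (real n *\<^sub>R One)) (real n *\<^sub>R One)" by blast
    with elim[rule_format, of n] have "inv_fourier2 p = (2 * pi)\<^sup>2 * complex_of_real (f p)" by simp
    then show ?case by (simp add: inv_fourier2_def)
  qed
qed

end

section \<open>Weighted estimates\<close>

text \<open>Cauchy-Schwarz in the form that results from integrating the pointwise bound 2 A B <=
  A^2 / m + m B^2 and only then choosing m = sqrt (E / R). The degenerate cases E = 0 and R = 0 are
  the limits m to 0 and m to infinity.\<close>

lemma le_sqrt_of_AMGM: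
  fixes x E R :: real
  assumes E: "E \<ge> 0" and R: "R \<ge> 0" and le: "\<And>m. m > 0 \<Longrightarrow> x \<le> (E / m + m * R) / 2"
  shows "x \<le> sqrt (E * R)"
proof -
  consider "E = 0" | "R = 0" | "E > 0" "R > 0" using E R by linarith
  then show ?thesis
  proof cases
    case 1
    have "((\<lambda>m. (E / m + m * R) / 2) \<longlongrightarrow> (0 + 0 * R) / 2) (at_right 0)"
      unfolding 1 by (intro tendsto_intros) auto
    then have "x \<le> 0"
      by (intro tendsto_lowerbound[of _ _ "at_right 0"]) (use le in \<open>auto simp: eventually_at_right_less eventually_at intro!: exI[of _ 1]\<close>)
    then show ?thesis using 1 by simp
  next
    case 2
    have "((\<lambda>m. (E / m + m * R) / 2) \<longlongrightarrow> (0 + 0) / 2) at_top"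
      unfolding 2 by (intro tendsto_intros tendsto_divide_0[OF tendsto_const] filterlim_at_top_imp_at_infinity filterlim_ident) auto
    then have "x \<le> 0"
      by (intro tendsto_lowerbound[of _ _ "at_top::real filter"]) (use le in \<open>auto intro: eventually_mono[OF eventually_gt_at_top[of 0]]\<close>)
    then show ?thesis using 2 by simp
  next
    case 3
    have "x \<le> (E / sqrt (E / R) + sqrt (E / R) * R) / 2"
      using 3 by (intro le) auto
    also have "E / sqrt (E / R) = sqrt (E * R)"
      using 3 by (simp add: real_sqrt_divide real_sqrt_mult field_simps)
    also have "sqrt (E / R) * R = sqrt (E * R)"
      using 3 by (simp add: real_sqrt_divide real_sqrt_mult field_simps)
    finally show ?thesis by simp
  qed
qed

lemma power_le_one_plus_powr:
  fixes x :: real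
  assumes "real n \<le> r"
  shows "\<bar>x\<bar> ^ n \<le> 1 + \<bar>x\<bar> powr r"
proof (cases "\<bar>x\<bar> \<le> 1")
  case True
  then have "\<bar>x\<bar> ^ n \<le> 1" by (simp add: power_le_one)
  then show ?thesis by (smt (verit) powr_ge_zero)
next
  case False
  then have "\<bar>x\<bar> powr real n \<le> \<bar>x\<bar> powr r" using assms by (intro powr_mono) auto
  then show ?thesis using False by (simp add: powr_realpow)
qed

lemma powr_le_one_plus_powr:
  fixes x q r :: real
  assumes "0 \<le> q" "q \<le> r"
  shows "\<bar>x\<bar> powr q \<le> 1 + \<bar>x\<bar> powr r"
proof (cases "\<bar>x\<bar> \<le> 1")
  case True
  then have "\<bar>x\<bar> powr q \<le> 1" using assms by (simp add: powr_le1)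
  then show ?thesis by (smt (verit) powr_ge_zero)
next
  case False
  then have "\<bar>x\<bar> powr q \<le> \<bar>x\<bar> powr r" using assms by (intro powr_mono) auto
  then show ?thesis by simp
qed

section \<open>Comparison of the weight with polynomials and with the density\<close>

lemma weight_ge_1: "1 \<le> weight r1 r2 p"
  by (simp add: weight_def case_prod_beta' add_nonneg_nonneg)

lemma weight_pos: "0 < weight r1 r2 p"
  using weight_ge_1[of r1 r2 p] by linarith

lemma fst_borel [measurable]: "(fst :: real \<times> real \<Rightarrow> real) \<in> borel_measurable borel"
  and snd_borel [measurable]: "(snd :: real \<times> real \<Rightarrow> real) \<in> borel_measurable borel"
  by (intro borel_measurable_continuous_onI continuous_intros)+

lemma weight_measurable [measurable]: "weight r1 r2 \<in> borel_measurable borel"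
  unfolding weight_def case_prod_beta' by measurable

text \<open>Here r1 > 3 enters, as 2 r1 > 6: a kernel of growth 1 + x^2 has a square of growth (1 +
  x^2)^2, and one more factor 1 + x^2 pays for integrability in x. The first two bounds serve the
  quadratic terms.\<close>

lemma weight_cube:
  assumes "r1 > 3"
  shows "\<bar>fst p\<bar> ^ 3 \<le> weight r1 r2 p" "(fst p)\<^sup>2 \<le> weight r1 r2 p" "(1 + (fst p)\<^sup>2) ^ 3 \<le> 8 * weight r1 r2 p"
proof -
  obtain x y where p: "p = (x, y)" by (cases p)
  have w: "weight r1 r2 p \<ge> 1 + \<bar>x\<bar> powr (2 * r1)"
    by (simp add: weight_def p)
  show "\<bar>fst p\<bar> ^ 3 \<le> weight r1 r2 p"
    using power_le_one_plus_powr[of 3 "2 * r1" x] assms w p by simp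
  show "(fst p)\<^sup>2 \<le> weight r1 r2 p"
    using power_le_one_plus_powr[of 2 "2 * r1" x] assms w p by simp
  have 6: "\<bar>x\<bar> ^ 6 \<le> 1 + \<bar>x\<bar> powr (2 * r1)"
    using power_le_one_plus_powr[of 6 "2 * r1" x] assms by simp
  have "(1 + z) ^ 3 \<le> 4 * (1 + z ^ 3)" if "z \<ge> 0" for z :: real
  proof -
    have "0 \<le> 3 * ((z + 1) * (z - 1)\<^sup>2)" using that by simp
    then show ?thesis by (simp add: power2_eq_square power3_eq_cube algebra_simps)
  qed
  from this[of "x\<^sup>2"] have "(1 + x\<^sup>2) ^ 3 \<le> 4 * (1 + x ^ 6)" by (simp flip: power_mult)
  with 6 w weight_ge_1[of r1 r2 p] show "(1 + (fst p)\<^sup>2) ^ 3 \<le> 8 * weight r1 r2 p"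
    by (simp add: p)
qed

text \<open>Makes bounded kernels such as \<open>cis\<close> admissible, with constant 2 = sqrt 4;
  in effect the weighted L^2 space embeds in L^1.\<close>

lemma weight_rho:
  assumes "r1 > 3" "r2 > 3"
  shows "1 \<le> 4 * (weight r1 r2 p * rho p)"
proof -
  obtain x y where p: "p = (x, y)" by (cases p)
  have x: "x ^ 4 \<le> 1 + \<bar>x\<bar> powr (2 * r1)" and y: "y ^ 4 \<le> 1 + \<bar>y\<bar> powr (2 * r2)"
    using power_le_one_plus_powr[of 4 "2 * r1" x] power_le_one_plus_powr[of 4 "2 * r2" y] assms by simp_all
  have "0 \<le> (x\<^sup>2 - y\<^sup>2)\<^sup>2" "0 \<le> (x\<^sup>2 - 1)\<^sup>2" "0 \<le> (y\<^sup>2 - 1)\<^sup>2" by simp_all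
  then have "(1 + x\<^sup>2) * (1 + y\<^sup>2) \<le> (1 + x ^ 4) + (1 + y ^ 4)"
    by (simp add: power2_eq_square power4_eq_xxxx algebra_simps)
  also have "\<dots> \<le> 4 * weight r1 r2 p"
    unfolding weight_def p prod.case
    using x y powr_ge_zero[of "\<bar>x\<bar>" "2 * r1"] powr_ge_zero[of "\<bar>y\<bar>" "2 * r2"] by argo
  finally show ?thesis
    by (simp add: rho_def p field_simps add_pos_nonneg)
qed

definition rho_mass :: real where "rho_mass = (LINT p|lborel. rho p)"

lemma rho_mass_nonneg: "rho_mass \<ge> 0"
  unfolding rho_mass_def by (intro Bochner_Integration.integral_nonneg less_imp_le[OF rho_pos])

section \<open>Linear and quadratic integrals controlled by the weighted norm\<close>

definition energy :: "real \<Rightarrow> real \<Rightarrow> (real \<times> real \<Rightarrow> real) \<Rightarrow> real" where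
  "energy r1 r2 f = (LINT p|lborel. weight r1 r2 p * (f p)\<^sup>2)"

lemma energy_nonneg: "energy r1 r2 f \<ge> 0"
  unfolding energy_def by (intro Bochner_Integration.integral_nonneg mult_nonneg_nonneg less_imp_le[OF weight_pos]) simp

lemma weighted_measurable: "weighted_L2 r1 r2 f \<Longrightarrow> f \<in> borel_measurable borel"
  by (simp add: weighted_L2_def)

text \<open>Cauchy-Schwarz between sqrt (weight) |f| and sqrt (rho). The bound depends on f only
  through \<open>energy\<close>, so for differences u(t) - u(t0) it yields continuity in time for
  every admissible kernel at once.\<close>

lemma weighted_lin:
  fixes k :: "real \<times> real \<Rightarrow> complex"
  assumes f: "weighted_L2 r1 r2 f" and k [measurable]: "k \<in> borel_measurable borel" and A: "A \<ge> 0"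
    and le: "\<And>p. (cmod (k p))\<^sup>2 \<le> A\<^sup>2 * (weight r1 r2 p * rho p)"
  shows "integrable lborel (\<lambda>p. complex_of_real (f p) * k p)"
    and "cmod (LINT p|lborel. complex_of_real (f p) * k p) \<le> A * sqrt (energy r1 r2 f * rho_mass)"
proof -
  note [measurable] = weighted_measurable[OF f]
  have intW: "integrable lborel (\<lambda>p. weight r1 r2 p * (f p)\<^sup>2)"
    using f by (simp add: weighted_L2_def)
  have pt: "cmod (complex_of_real (f p) * k p) \<le> A * (((weight r1 r2 p * (f p)\<^sup>2) / m + m * rho p) / 2)" if "m > 0" for m p
  proof -
    define w where "w = sqrt (weight r1 r2 p)"
    define h where "h = sqrt (rho p)"
    have w: "w\<^sup>2 = weight r1 r2 p" and h: "h\<^sup>2 = rho p" and "w \<ge> 0" "h \<ge> 0"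
      using weight_pos[of r1 r2 p] rho_pos[of p] by (auto simp: w_def h_def)
    have "(cmod (k p))\<^sup>2 \<le> (A * (w * h))\<^sup>2"
      using le[of p] by (simp add: power_mult_distrib w h)
    then have kp: "cmod (k p) \<le> A * (w * h)"
      by (rule power2_le_imp_le) (use A \<open>w \<ge> 0\<close> \<open>h \<ge> 0\<close> in simp)
    have "0 \<le> (w * \<bar>f p\<bar> / sqrt m - sqrt m * h)\<^sup>2" by simp
    also have "\<dots> = w\<^sup>2 * (f p)\<^sup>2 / m + m * h\<^sup>2 - 2 * (w * \<bar>f p\<bar> * h)"
      using that by (simp add: power2_diff power_mult_distrib power_divide)
    finally have "w * \<bar>f p\<bar> * h \<le> (w\<^sup>2 * (f p)\<^sup>2 / m + m * h\<^sup>2) / 2" by simp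
    then have "A * (w * \<bar>f p\<bar> * h) \<le> A * ((w\<^sup>2 * (f p)\<^sup>2 / m + m * h\<^sup>2) / 2)"
      using A by (rule mult_left_mono)
    moreover have "cmod (complex_of_real (f p) * k p) \<le> \<bar>f p\<bar> * (A * (w * h))"
      by (simp add: norm_mult mult_left_mono[OF kp])
    ultimately show ?thesis by (simp add: w h mult_ac)
  qed
  have ib: "integrable lborel (\<lambda>p. A * (((weight r1 r2 p * (f p)\<^sup>2) / m + m * rho p) / 2))" for m
    using intW integrable_rho by simp
  show int: "integrable lborel (\<lambda>p. complex_of_real (f p) * k p)"
  proof (rule Bochner_Integration.integrable_bound[OF ib[of 1]])
    show "AE p in lborel. norm (complex_of_real (f p) * k p) \<le> norm (A * (((weight r1 r2 p * (f p)\<^sup>2) / 1 + 1 * rho p) / 2))"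
      unfolding real_norm_def by (intro AE_I2 order_trans[OF pt[OF zero_less_one] abs_ge_self])
  qed simp
  have bd: "cmod (LINT p|lborel. complex_of_real (f p) * k p) \<le> A * ((energy r1 r2 f / m + m * rho_mass) / 2)" if "m > 0" for m
  proof -
    have "cmod (LINT p|lborel. complex_of_real (f p) * k p) \<le> (LINT p|lborel. cmod (complex_of_real (f p) * k p))"
      by (rule integral_norm_bound)
    also have "\<dots> \<le> (LINT p|lborel. A * (((weight r1 r2 p * (f p)\<^sup>2) / m + m * rho p) / 2))"
      by (intro integral_mono integrable_norm int ib pt that)
    also have "\<dots> = A * ((energy r1 r2 f / m + m * rho_mass) / 2)"
      using intW integrable_rho by (simp add: energy_def rho_mass_def)
    finally show ?thesis .
  qed
  show "cmod (LINT p|lborel. complex_of_real (f p) * k p) \<le> A * sqrt (energy r1 r2 f * rho_mass)"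
  proof (cases "A = 0")
    case True
    then show ?thesis using bd[of 1] by simp
  next
    case False
    with A have "A > 0" by simp
    have "cmod (LINT p|lborel. complex_of_real (f p) * k p) / A \<le> sqrt (energy r1 r2 f * rho_mass)"
      by (rule le_sqrt_of_AMGM) (use bd \<open>A > 0\<close> in \<open>auto simp: energy_nonneg rho_mass_nonneg pos_divide_le_eq mult.commute\<close>)
    then show ?thesis using \<open>A > 0\<close> by (simp add: pos_divide_le_eq mult.commute)
  qed
qed

text \<open>The weight is shared by the two factors, so the kernel itself, and not its square, may
  grow like the weight, and no integrability in x has to be paid for. This is why the transform of
  u^2 is smoother at xi = 0 than that of u.\<close>

lemma weighted_quad:
  fixes k :: "real \<times> real \<Rightarrow> complex"
  assumes f: "weighted_L2 r1 r2 f" and g: "weighted_L2 r1 r2 g" and k [measurable]: "k \<in> borel_measurable borel"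
    and A: "A \<ge> 0" and le: "\<And>p. cmod (k p) \<le> A * weight r1 r2 p"
  shows "integrable lborel (\<lambda>p. complex_of_real (f p * g p) * k p)"
    and "cmod (LINT p|lborel. complex_of_real (f p * g p) * k p) \<le> A * sqrt (energy r1 r2 f * energy r1 r2 g)"
proof -
  note [measurable] = weighted_measurable[OF f] weighted_measurable[OF g]
  have intf: "integrable lborel (\<lambda>p. weight r1 r2 p * (f p)\<^sup>2)" and intg: "integrable lborel (\<lambda>p. weight r1 r2 p * (g p)\<^sup>2)"
    using f g by (simp_all add: weighted_L2_def)
  have pt: "cmod (complex_of_real (f p * g p) * k p) \<le> A * (((weight r1 r2 p * (f p)\<^sup>2) / m + m * (weight r1 r2 p * (g p)\<^sup>2)) / 2)" if "m > 0" for m p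
  proof -
    have "0 \<le> (\<bar>f p\<bar> / sqrt m - sqrt m * \<bar>g p\<bar>)\<^sup>2" by simp
    also have "\<dots> = (f p)\<^sup>2 / m + m * (g p)\<^sup>2 - 2 * (\<bar>f p\<bar> * \<bar>g p\<bar>)"
      using that by (simp add: power2_diff power_mult_distrib power_divide)
    finally have "\<bar>f p\<bar> * \<bar>g p\<bar> \<le> ((f p)\<^sup>2 / m + m * (g p)\<^sup>2) / 2" by simp
    then have "A * weight r1 r2 p * (\<bar>f p\<bar> * \<bar>g p\<bar>) \<le> A * weight r1 r2 p * (((f p)\<^sup>2 / m + m * (g p)\<^sup>2) / 2)"
      using A weight_pos[of r1 r2 p] by (intro mult_left_mono) auto
    moreover have "cmod (complex_of_real (f p * g p) * k p) \<le> (\<bar>f p\<bar> * \<bar>g p\<bar>) * (A * weight r1 r2 p)"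
      unfolding norm_mult norm_of_real abs_mult by (intro mult_left_mono le) simp
    ultimately show ?thesis by (simp add: field_simps)
  qed
  have ib: "integrable lborel (\<lambda>p. A * (((weight r1 r2 p * (f p)\<^sup>2) / m + m * (weight r1 r2 p * (g p)\<^sup>2)) / 2))" for m
    using intf intg by simp
  show int: "integrable lborel (\<lambda>p. complex_of_real (f p * g p) * k p)"
  proof (rule Bochner_Integration.integrable_bound[OF ib[of 1]])
    show "AE p in lborel. norm (complex_of_real (f p * g p) * k p) \<le> norm (A * (((weight r1 r2 p * (f p)\<^sup>2) / 1 + 1 * (weight r1 r2 p * (g p)\<^sup>2)) / 2))"
      unfolding real_norm_def by (intro AE_I2 order_trans[OF pt[OF zero_less_one] abs_ge_self])
  qed simp
  have bd: "cmod (LINT p|lborel. complex_of_real (f p * g p) * k p) \<le> A * ((energy r1 r2 f / m + m * energy r1 r2 g) / 2)" if "m > 0" for m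
  proof -
    have "cmod (LINT p|lborel. complex_of_real (f p * g p) * k p) \<le> (LINT p|lborel. cmod (complex_of_real (f p * g p) * k p))"
      by (rule integral_norm_bound)
    also have "\<dots> \<le> (LINT p|lborel. A * (((weight r1 r2 p * (f p)\<^sup>2) / m + m * (weight r1 r2 p * (g p)\<^sup>2)) / 2))"
      by (intro integral_mono integrable_norm int ib pt that)
    also have "\<dots> = A * ((energy r1 r2 f / m + m * energy r1 r2 g) / 2)"
      using intf intg by (simp add: energy_def)
    finally show ?thesis .
  qed
  show "cmod (LINT p|lborel. complex_of_real (f p * g p) * k p) \<le> A * sqrt (energy r1 r2 f * energy r1 r2 g)"
  proof (cases "A = 0")
    case True
    then show ?thesis using bd[of 1] by simp
  next
    case False
    with A have "A > 0" by simp
    have "cmod (LINT p|lborel. complex_of_real (f p * g p) * k p) / A \<le> sqrt (energy r1 r2 f * energy r1 r2 g)"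
      by (rule le_sqrt_of_AMGM) (use bd \<open>A > 0\<close> in \<open>auto simp: energy_nonneg pos_divide_le_eq mult.commute\<close>)
    then show ?thesis using \<open>A > 0\<close> by (simp add: pos_divide_le_eq mult.commute)
  qed
qed

text \<open>From (A + B)^2 <= 2 A^2 + 2 B^2. It serves for differences of two functions and, with h
  = f + (h - f), for bounds that are uniform in time.\<close>

lemma integrable_square_diff:
  fixes f g :: "'a \<Rightarrow> real" and w :: "'a \<Rightarrow> real"
  assumes "\<And>p. w p \<ge> 0" "integrable M (\<lambda>p. w p * (f p)\<^sup>2)" "integrable M (\<lambda>p. w p * (g p)\<^sup>2)"
    "h \<in> borel_measurable M" "w \<in> borel_measurable M" "\<And>p. \<bar>h p\<bar> \<le> \<bar>f p\<bar> + \<bar>g p\<bar>"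
  shows "integrable M (\<lambda>p. w p * (h p)\<^sup>2)"
    and "(LINT p|M. w p * (h p)\<^sup>2) \<le> 2 * (LINT p|M. w p * (f p)\<^sup>2) + 2 * (LINT p|M. w p * (g p)\<^sup>2)"
proof -
  have le: "w p * (h p)\<^sup>2 \<le> 2 * (w p * (f p)\<^sup>2) + 2 * (w p * (g p)\<^sup>2)" for p
  proof -
    have "(h p)\<^sup>2 \<le> (\<bar>f p\<bar> + \<bar>g p\<bar>)\<^sup>2"
      using power_mono[OF assms(6)[of p], of 2] by simp
    also have "\<dots> \<le> 2 * (f p)\<^sup>2 + 2 * (g p)\<^sup>2"
      using sum_squares_ge_zero[of "\<bar>f p\<bar> - \<bar>g p\<bar>" 0] by (simp add: power2_eq_square algebra_simps)
    finally have "w p * (h p)\<^sup>2 \<le> w p * (2 * (f p)\<^sup>2 + 2 * (g p)\<^sup>2)"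
      using assms(1) by (rule mult_left_mono)
    then show ?thesis by (simp add: algebra_simps)
  qed
  have i: "integrable M (\<lambda>p. 2 * (w p * (f p)\<^sup>2) + 2 * (w p * (g p)\<^sup>2))"
    using assms by simp
  show h: "integrable M (\<lambda>p. w p * (h p)\<^sup>2)"
    using assms le by (intro Bochner_Integration.integrable_bound[OF i]) (auto intro!: AE_I2 order_trans[OF _ abs_ge_self])
  have "(LINT p|M. w p * (h p)\<^sup>2) \<le> (LINT p|M. 2 * (w p * (f p)\<^sup>2) + 2 * (w p * (g p)\<^sup>2))"
    by (intro integral_mono h i le)
  then show "(LINT p|M. w p * (h p)\<^sup>2) \<le> 2 * (LINT p|M. w p * (f p)\<^sup>2) + 2 * (LINT p|M. w p * (g p)\<^sup>2)"
    using assms by simp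
qed

lemma weighted_diff:
  assumes "weighted_L2 r1 r2 f" "weighted_L2 r1 r2 g"
  shows "weighted_L2 r1 r2 (\<lambda>p. f p - g p)"
  using assms integrable_square_diff(1)[of "weight r1 r2" lborel f g "\<lambda>p. f p - g p"] less_imp_le[OF weight_pos]
  by (auto simp: weighted_L2_def)

text \<open>Bisection: boundedness on a subinterval passes to the union of adjacent intervals and
  holds near each point. The filter leaves out the point t itself, hence the maximum with
  \<open>g t\<close>.\<close>

lemma locally_bounded_imp_bounded_on_interval:
  fixes g :: "real \<Rightarrow> real"
  assumes "\<And>t. t \<in> {a..b} \<Longrightarrow> \<exists>C. \<forall>\<^sub>F x in at t within {a..b}. g x \<le> C"
  shows "\<exists>C. \<forall>x\<in>{a..b}. g x \<le> C"
proof (cases "a \<le> b")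
  case True
  define P where "P c d \<longleftrightarrow> (\<exists>C. \<forall>x\<in>{c..d} \<inter> {a..b}. g x \<le> C)" for c d
  have "P a b"
  proof (rule Bolzano[OF True])
    fix c d e assume "P c d" "P d e" "c \<le> d" "d \<le> e"
    then obtain C C' where C: "\<forall>x\<in>{c..d} \<inter> {a..b}. g x \<le> C" "\<forall>x\<in>{d..e} \<inter> {a..b}. g x \<le> C'"
      unfolding P_def by blast
    have "g x \<le> max C C'" if "x \<in> {c..e} \<inter> {a..b}" for x
      using C that by (cases "x \<le> d") (auto intro: le_max_iff_disj[THEN iffD2])
    then show "P c e" unfolding P_def by blast
  next
    fix t assume t: "a \<le> t" "t \<le> b"
    then obtain C where "\<forall>\<^sub>F x in at t within {a..b}. g x \<le> C" using assms by auto
    then obtain d where d: "d > 0" "\<And>x. x \<in> {a..b} \<Longrightarrow> x \<noteq> t \<Longrightarrow> dist x t < d \<Longrightarrow> g x \<le> C"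
      unfolding eventually_at by blast
    have "g x \<le> max C (g t)" if "x \<in> {a..b}" "dist x t < d" for x
      using d(2)[of x] that by (cases "x = t") (auto intro: le_max_iff_disj[THEN iffD2])
    then have "P c e" if "c \<le> t \<and> t \<le> e \<and> e - c < d" for c e
      unfolding P_def using that by (intro exI[of _ "max C (g t)"]) (auto simp: dist_real_def)
    then show "\<exists>d>0. \<forall>c e. c \<le> t \<and> t \<le> e \<and> e - c < d \<longrightarrow> P c e"
      using d(1) by blast
  qed
  then show ?thesis unfolding P_def by auto
qed auto

section \<open>Partial transforms and their behaviour at the origin\<close>

definition ptrans :: "nat \<Rightarrow> (real \<times> real \<Rightarrow> real) \<Rightarrow> real \<Rightarrow> complex" where
  "ptrans k f xi = (LINT p|lborel. complex_of_real (f p) * (ee (fst p * xi) * laplace_ker k (snd p)))"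

text \<open>The xi-derivative of \<open>ptrans 0 f\<close> at 0, but written as an integral, so that
  continuity in time is an instance of the general statement for admissible kernels.\<close>

definition first_moment :: "(real \<times> real \<Rightarrow> real) \<Rightarrow> complex" where
  "first_moment f = (LINT p|lborel. complex_of_real (f p) * (- \<i> * complex_of_real (fst p) * laplace_ker 0 (snd p)))"

lemma dil_diff1_ee_measurable [measurable]: "dil_diff1 ee \<in> borel_measurable borel"
  and dil_diff2_ee_measurable [measurable]: "dil_diff2 ee \<in> borel_measurable borel"
  and dil_diff3_ee_measurable [measurable]: "dil_diff3 ee \<in> borel_measurable borel"
  unfolding dil_diff1_def dil_diff2_def dil_diff3_def by measurable

lemma sq_mult_divide_sqrt:
  fixes X Y B F :: real
  assumes "X > 0" "Y > 0"
  shows "(B * X * (F / sqrt Y))\<^sup>2 = (B * F)\<^sup>2 * (X ^ 3 * (1 / (X * Y)))"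
  using assms by (simp add: power_mult_distrib power_divide field_simps power3_eq_cube power2_eq_square)

lemma sq_mult_divide_sqrt':
  fixes X Y C u v F :: real
  assumes "X > 0" "Y > 0"
  shows "(C * (u * v) * (F / sqrt Y))\<^sup>2 = (C * v * F)\<^sup>2 * ((u\<^sup>2 * X) * (1 / (X * Y)))"
  using assms by (simp add: power_mult_distrib power_divide)

text \<open>The square of the kernel is of size (1 + x^2)^2 / (1 + y^2), which is (1 + x^2)^3 times
  \<open>rho\<close> and is absorbed by \<open>weight_cube\<close>. The factor 8 found there is
  enlarged to the perfect square 9, which accounts for the 3 in front.\<close>

lemma kernel_sq_le:
  assumes r1: "r1 > 3" and B: "B \<ge> 0" and le: "cmod c \<le> B * (1 + (fst p)\<^sup>2)"
  shows "(cmod (c * laplace_ker k (snd p)))\<^sup>2 \<le> (3 * B * fact k)\<^sup>2 * (weight r1 r2 p * rho p)"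
proof -
  have x: "0 < 1 + (fst p)\<^sup>2" and y: "0 < 1 + (snd p)\<^sup>2" by (auto intro: add_pos_nonneg)
  have "cmod (c * laplace_ker k (snd p)) \<le> (B * (1 + (fst p)\<^sup>2)) * (fact k / sqrt (1 + (snd p)\<^sup>2))"
    unfolding norm_mult using le cmod_laplace_ker_le B x by (intro mult_mono) auto
  then have "(cmod (c * laplace_ker k (snd p)))\<^sup>2 \<le> ((B * (1 + (fst p)\<^sup>2)) * (fact k / sqrt (1 + (snd p)\<^sup>2)))\<^sup>2"
    by (rule power_mono) simp
  also have "\<dots> = (B * fact k)\<^sup>2 * ((1 + (fst p)\<^sup>2) ^ 3 * rho p)"
    unfolding rho_def by (rule sq_mult_divide_sqrt[OF x y])
  also have "\<dots> \<le> (B * fact k)\<^sup>2 * (8 * weight r1 r2 p * rho p)"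
    by (intro mult_left_mono mult_right_mono weight_cube(3)[OF r1] less_imp_le[OF rho_pos]) simp
  also have "\<dots> \<le> (B * fact k)\<^sup>2 * (9 * weight r1 r2 p * rho p)"
    by (intro mult_left_mono mult_right_mono less_imp_le[OF rho_pos] less_imp_le[OF weight_pos]) auto
  finally show ?thesis by (simp add: power_mult_distrib)
qed

lemma weighted_kernel:
  fixes c :: "real \<Rightarrow> complex"
  assumes f: "weighted_L2 r1 r2 f" and r1: "r1 > 3" and B: "B \<ge> 0"
    and c [measurable]: "c \<in> borel_measurable borel" and le: "\<And>x. cmod (c x) \<le> B * (1 + x\<^sup>2)"
  shows "integrable lborel (\<lambda>p. complex_of_real (f p) * (c (fst p) * laplace_ker k (snd p)))"
    and "cmod (LINT p|lborel. complex_of_real (f p) * (c (fst p) * laplace_ker k (snd p))) \<le> 3 * B * fact k * sqrt (energy r1 r2 f * rho_mass)"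
proof -
  have A: "0 \<le> 3 * B * fact k" using B by simp
  note 1 = kernel_sq_le[OF r1 B le, of _ k r2]
  show "integrable lborel (\<lambda>p. complex_of_real (f p) * (c (fst p) * laplace_ker k (snd p)))"
    by (rule weighted_lin(1)[OF f _ A 1]) measurable
  show "cmod (LINT p|lborel. complex_of_real (f p) * (c (fst p) * laplace_ker k (snd p))) \<le> 3 * B * fact k * sqrt (energy r1 r2 f * rho_mass)"
    by (rule weighted_lin(2)[OF f _ A 1]) measurable
qed

lemma quad_kernel:
  fixes c :: "real \<Rightarrow> complex"
  assumes f: "weighted_L2 r1 r2 f" and B: "B \<ge> 0"
    and c [measurable]: "c \<in> borel_measurable borel" and le: "\<And>p. cmod (c (fst p)) \<le> B * weight r1 r2 p"
  shows "integrable lborel (\<lambda>p. complex_of_real ((f p)\<^sup>2) * (c (fst p) * laplace_ker k (snd p)))"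
    and "cmod (LINT p|lborel. complex_of_real ((f p)\<^sup>2) * (c (fst p) * laplace_ker k (snd p))) \<le> B * fact k * energy r1 r2 f"
proof -
  have le': "cmod (c (fst p) * laplace_ker k (snd p)) \<le> (B * fact k) * weight r1 r2 p" for p
  proof -
    have "cmod (c (fst p) * laplace_ker k (snd p)) \<le> (B * weight r1 r2 p) * fact k"
      unfolding norm_mult using B by (intro mult_mono le cmod_laplace_ker_le_fact) (auto intro!: mult_nonneg_nonneg less_imp_le[OF weight_pos])
    then show ?thesis by (simp add: mult_ac)
  qed
  have A: "0 \<le> B * fact k" using B by simp
  have e: "sqrt (energy r1 r2 f * energy r1 r2 f) = energy r1 r2 f"
    using energy_nonneg[of r1 r2 f] by simp
  show "integrable lborel (\<lambda>p. complex_of_real ((f p)\<^sup>2) * (c (fst p) * laplace_ker k (snd p)))"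
    unfolding power2_eq_square by (rule weighted_quad(1)[OF f f _ A le']) measurable
  show "cmod (LINT p|lborel. complex_of_real ((f p)\<^sup>2) * (c (fst p) * laplace_ker k (snd p))) \<le> B * fact k * energy r1 r2 f"
    unfolding power2_eq_square by (rule weighted_quad(2)[OF f f _ A le', unfolded e]) measurable
qed

lemma ptrans_integrable:
  assumes "weighted_L2 r1 r2 f" "r1 > 3"
  shows "integrable lborel (\<lambda>p. complex_of_real (f p) * (ee (fst p * xi) * laplace_ker k (snd p)))"
  by (rule weighted_kernel(1)[OF assms, of 1 "\<lambda>x. ee (x * xi)"]) auto

lemma ptrans_sq_integrable:
  assumes "weighted_L2 r1 r2 f"
  shows "integrable lborel (\<lambda>p. complex_of_real ((f p)\<^sup>2) * (ee (fst p * xi) * laplace_ker k (snd p)))"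
  by (rule quad_kernel(1)[OF assms, of 1 "\<lambda>x. ee (x * xi)"]) (use weight_ge_1 in auto)

section \<open>Dilation differences under the integral sign\<close>

context
  fixes g :: "real \<times> real \<Rightarrow> real" and k
  assumes g: "\<And>xi. integrable lborel (\<lambda>p. complex_of_real (g p) * (ee (fst p * xi) * laplace_ker k (snd p)))"
begin

lemma dil_diff1_ptrans: "dil_diff1 (ptrans k g) xi = (LINT p|lborel. complex_of_real (g p) * (dil_diff1 ee (fst p * xi) * laplace_ker k (snd p)))"
proof -
  have "dil_diff1 (ptrans k g) xi = (LINT p|lborel. complex_of_real (g p) * (ee (fst p * (4 * xi)) * laplace_ker k (snd p))
      - 3 * (complex_of_real (g p) * (ee (fst p * (2 * xi)) * laplace_ker k (snd p)))
      + 2 * (complex_of_real (g p) * (ee (fst p * xi) * laplace_ker k (snd p))))"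
    unfolding dil_diff1_def ptrans_def using g by simp
  also have "\<dots> = (LINT p|lborel. complex_of_real (g p) * (dil_diff1 ee (fst p * xi) * laplace_ker k (snd p)))"
    by (intro Bochner_Integration.integral_cong refl) (simp add: dil_diff1_def algebra_simps)
  finally show ?thesis .
qed

lemma dil_diff2_ptrans: "dil_diff2 (ptrans k g) xi = (LINT p|lborel. complex_of_real (g p) * (dil_diff2 ee (fst p * xi) * laplace_ker k (snd p)))"
proof -
  have "dil_diff2 (ptrans k g) xi = (LINT p|lborel. complex_of_real (g p) * (ee (fst p * (8 * xi)) * laplace_ker k (snd p))
      - 7 * (complex_of_real (g p) * (ee (fst p * (4 * xi)) * laplace_ker k (snd p)))
      + 14 * (complex_of_real (g p) * (ee (fst p * (2 * xi)) * laplace_ker k (snd p)))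
      - 8 * (complex_of_real (g p) * (ee (fst p * xi) * laplace_ker k (snd p))))"
    unfolding dil_diff2_def ptrans_def using g by simp
  also have "\<dots> = (LINT p|lborel. complex_of_real (g p) * (dil_diff2 ee (fst p * xi) * laplace_ker k (snd p)))"
    by (intro Bochner_Integration.integral_cong refl) (simp add: dil_diff2_def algebra_simps)
  finally show ?thesis .
qed

lemma dil_diff3_ptrans: "dil_diff3 (ptrans k g) xi = (LINT p|lborel. complex_of_real (g p) * (dil_diff3 ee (fst p * xi) * laplace_ker k (snd p)))"
proof -
  have "dil_diff3 (ptrans k g) xi = (LINT p|lborel. complex_of_real (g p) * (ee (fst p * (16 * xi)) * laplace_ker k (snd p))
      - 15 * (complex_of_real (g p) * (ee (fst p * (8 * xi)) * laplace_ker k (snd p)))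
      + 70 * (complex_of_real (g p) * (ee (fst p * (4 * xi)) * laplace_ker k (snd p)))
      - 120 * (complex_of_real (g p) * (ee (fst p * (2 * xi)) * laplace_ker k (snd p)))
      + 64 * (complex_of_real (g p) * (ee (fst p * xi) * laplace_ker k (snd p))))"
    unfolding dil_diff3_def ptrans_def using g by simp
  also have "\<dots> = (LINT p|lborel. complex_of_real (g p) * (dil_diff3 ee (fst p * xi) * laplace_ker k (snd p)))"
    by (intro Bochner_Integration.integral_cong refl) (simp add: dil_diff3_def algebra_simps)
  finally show ?thesis .
qed

lemma ptrans_diff0: "ptrans k g xi - ptrans k g 0 = (LINT p|lborel. complex_of_real (g p) * ((ee (fst p * xi) - 1) * laplace_ker k (snd p)))"
proof -
  have "ptrans k g xi - ptrans k g 0 = (LINT p|lborel. complex_of_real (g p) * (ee (fst p * xi) * laplace_ker k (snd p))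
      - complex_of_real (g p) * (ee (fst p * 0) * laplace_ker k (snd p)))"
    unfolding ptrans_def by (intro Bochner_Integration.integral_diff[symmetric] g)
  then show ?thesis by (simp add: algebra_simps)
qed

end

lemma cmod_ee_minus_1: "cmod (ee x - 1) \<le> \<bar>x\<bar>"
  using cis_minus_approx[of x 0] by simp

lemma abs_le_one_plus_sq: "\<bar>x\<bar> \<le> 1 + x\<^sup>2" for x :: real
proof -
  have "0 \<le> (\<bar>x\<bar> - 1)\<^sup>2" by simp
  then show ?thesis by (simp add: power2_diff)
qed

section \<open>Expansions at xi = 0 available at every time\<close>

lemma dil_diff1_ptrans_le:
  assumes f: "weighted_L2 r1 r2 f" and r1: "r1 > 3"
  shows "cmod (dil_diff1 (ptrans k f) xi) \<le> 45 * fact k * sqrt (energy r1 r2 f * rho_mass) * xi\<^sup>2"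
proof -
  have "cmod (dil_diff1 ee (x * xi)) \<le> 15 * xi\<^sup>2 * (1 + x\<^sup>2)" for x
  proof -
    have "15 * (x * xi)\<^sup>2 \<le> 15 * xi\<^sup>2 * (1 + x\<^sup>2)"
      by (simp add: power_mult_distrib algebra_simps)
    then show ?thesis using dil_diff1_ee_le[of "x * xi"] by linarith
  qed
  from weighted_kernel(2)[OF f r1 _ _ this, of k] show ?thesis
    unfolding dil_diff1_ptrans[OF ptrans_integrable[OF f r1]] by (simp add: mult_ac)
qed

lemma ptrans_diff_le:
  assumes f: "weighted_L2 r1 r2 f" and r1: "r1 > 3"
  shows "cmod (ptrans k f xi - ptrans k f 0) \<le> 3 * fact k * sqrt (energy r1 r2 f * rho_mass) * \<bar>xi\<bar>"
proof -
  have "cmod (ee (x * xi) - 1) \<le> \<bar>xi\<bar> * (1 + x\<^sup>2)" for x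
  proof -
    have "\<bar>x\<bar> * \<bar>xi\<bar> \<le> (1 + x\<^sup>2) * \<bar>xi\<bar>" by (intro mult_right_mono abs_le_one_plus_sq) simp
    then show ?thesis using cmod_ee_minus_1[of "x * xi"] by (simp add: abs_mult mult.commute)
  qed
  from weighted_kernel(2)[OF f r1 _ _ this, of k] show ?thesis
    unfolding ptrans_diff0[OF ptrans_integrable[OF f r1]] by (simp add: mult_ac)
qed

lemma first_moment_integrable:
  assumes f: "weighted_L2 r1 r2 f" and r1: "r1 > 3"
  shows "integrable lborel (\<lambda>p. complex_of_real (f p) * (- \<i> * complex_of_real (fst p) * laplace_ker 0 (snd p)))"
  by (rule weighted_kernel(1)[OF f r1, of 1 "\<lambda>x. - \<i> * complex_of_real x"])
    (auto simp: norm_mult abs_le_one_plus_sq)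

lemma ptrans_Taylor_le:
  assumes f: "weighted_L2 r1 r2 f" and r1: "r1 > 3"
  shows "cmod (ptrans 0 f xi - ptrans 0 f 0 - xi * first_moment f) \<le> 3 * sqrt (energy r1 r2 f * rho_mass) * xi\<^sup>2"
proof -
  let ?c = "\<lambda>x. ee (x * xi) - 1 + \<i> * complex_of_real (x * xi)"
  have i0: "integrable lborel (\<lambda>p. complex_of_real (f p) * ((ee (fst p * xi) - 1) * laplace_ker 0 (snd p)))"
    by (rule weighted_kernel(1)[OF f r1, of 2 "\<lambda>x. ee (x * xi) - 1"])
      (use norm_triangle_ineq4[of "ee _" 1] in \<open>auto intro: order_trans add_nonneg_nonneg simp: zero_le_mult_iff algebra_simps intro!: order_trans[OF norm_triangle_ineq4]\<close>)
  have "ptrans 0 f xi - ptrans 0 f 0 - xi * first_moment f = (LINT p|lborel. complex_of_real (f p) * ((ee (fst p * xi) - 1) * laplace_ker 0 (snd p))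
     - xi * (complex_of_real (f p) * (- \<i> * complex_of_real (fst p) * laplace_ker 0 (snd p))))"
    unfolding ptrans_diff0[OF ptrans_integrable[OF f r1]] first_moment_def using first_moment_integrable[OF f r1] i0 by simp
  also have "\<dots> = (LINT p|lborel. complex_of_real (f p) * (?c (fst p) * laplace_ker 0 (snd p)))"
    by (intro Bochner_Integration.integral_cong refl) (simp add: algebra_simps)
  finally have e: "ptrans 0 f xi - ptrans 0 f 0 - xi * first_moment f = (LINT p|lborel. complex_of_real (f p) * (?c (fst p) * laplace_ker 0 (snd p)))" .
  have "cmod (?c x) \<le> xi\<^sup>2 * (1 + x\<^sup>2)" for x
  proof -
    have "cmod (?c x) \<le> (x * xi)\<^sup>2 / 2"
      using cis_minus_approx[of "x * xi" 1] by (simp add: numeral_2_eq_2 algebra_simps)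
    also have "\<dots> \<le> xi\<^sup>2 * (1 + x\<^sup>2)"
      using zero_le_mult_iff[of "x\<^sup>2" "xi\<^sup>2"] by (simp add: power_mult_distrib algebra_simps)
    finally show ?thesis .
  qed
  from weighted_kernel(2)[OF f r1 _ _ this, of 0] show ?thesis
    unfolding e by (simp add: mult_ac)
qed

abbreviation ptrans_sq :: "nat \<Rightarrow> (real \<times> real \<Rightarrow> real) \<Rightarrow> real \<Rightarrow> complex" where
  "ptrans_sq k f \<equiv> ptrans k (\<lambda>p. (f p)\<^sup>2)"

text \<open>For the square the full weight is at hand, and |x|^3 <= weight already for r1 > 3. So
  the second difference is cubic here, one order better than what is used for the linear
  transform.\<close>

lemma dil_diff2_ptrans_sq_le:
  assumes f: "weighted_L2 r1 r2 f" and r1: "r1 > 3"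
  shows "cmod (dil_diff2 (ptrans_sq k f) xi) \<le> 180 * fact k * energy r1 r2 f * \<bar>xi\<bar> ^ 3"
proof -
  have "cmod (dil_diff2 ee (fst p * xi)) \<le> 180 * \<bar>xi\<bar> ^ 3 * weight r1 r2 p" for p
  proof -
    have "\<bar>fst p\<bar> ^ 3 * \<bar>xi\<bar> ^ 3 \<le> weight r1 r2 p * \<bar>xi\<bar> ^ 3"
      by (intro mult_right_mono weight_cube r1) simp
    then show ?thesis
      using dil_diff2_ee_le[of "fst p * xi"] by (simp add: power_mult_distrib abs_mult algebra_simps)
  qed
  from quad_kernel(2)[OF f _ _ this, of k] show ?thesis
    unfolding dil_diff2_ptrans[OF ptrans_sq_integrable[OF f]] by (simp add: mult_ac)
qed

lemma dil_diff1_ptrans_sq_le: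
  assumes f: "weighted_L2 r1 r2 f" and r1: "r1 > 3"
  shows "cmod (dil_diff1 (ptrans_sq k f) xi) \<le> 15 * fact k * energy r1 r2 f * xi\<^sup>2"
proof -
  have "cmod (dil_diff1 ee (fst p * xi)) \<le> 15 * xi\<^sup>2 * weight r1 r2 p" for p
  proof -
    have "(fst p)\<^sup>2 * xi\<^sup>2 \<le> weight r1 r2 p * xi\<^sup>2"
      by (intro mult_right_mono weight_cube r1) simp
    then show ?thesis
      using dil_diff1_ee_le[of "fst p * xi"] by (simp add: power_mult_distrib algebra_simps)
  qed
  from quad_kernel(2)[OF f _ _ this, of k] show ?thesis
    unfolding dil_diff1_ptrans[OF ptrans_sq_integrable[OF f]] by (simp add: mult_ac)
qed

lemma ptrans_sq_diff_le:
  assumes f: "weighted_L2 r1 r2 f" and r1: "r1 > 3"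
  shows "cmod (ptrans_sq k f xi - ptrans_sq k f 0) \<le> 2 * fact k * energy r1 r2 f * \<bar>xi\<bar>"
proof -
  have "cmod (ee (fst p * xi) - 1) \<le> 2 * \<bar>xi\<bar> * weight r1 r2 p" for p
  proof -
    have "\<bar>fst p\<bar> * \<bar>xi\<bar> \<le> (2 * weight r1 r2 p) * \<bar>xi\<bar>"
      using abs_le_one_plus_sq[of "fst p"] weight_cube(2)[OF r1, of p r2] weight_ge_1[of r1 r2 p]
      by (intro mult_right_mono) auto
    then show ?thesis
      using cmod_ee_minus_1[of "fst p * xi"] by (simp add: abs_mult algebra_simps)
  qed
  from quad_kernel(2)[OF f _ _ this, of k] show ?thesis
    unfolding ptrans_diff0[OF ptrans_sq_integrable[OF f]] by (simp add: mult_ac)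
qed

text \<open>The exponent q = 2 + (1 + a) / 2 is a choice. After Cauchy-Schwarz it costs |x|^{2 q} (1
  + x^2), of degree 7 + a, which the weight of degree 7 + 2 a covers; q <= 3 stays within the
  interpolated kernel bound; and q > 2 + a, the gain needed against xi^{3+a}, holds because a <
  1.\<close>

lemma dil_diff2_ptrans_powr_le:
  assumes f: "weighted_L2 (7/2 + a) r2 f" and a: "0 < a" "a < 1"
  shows "cmod (dil_diff2 (ptrans k f) xi) \<le> 360 * fact k * sqrt (energy (7/2 + a) r2 f * rho_mass) * \<bar>xi\<bar> powr (2 + (1 + a) / 2)"
proof -
  define q where "q = 2 + (1 + a) / 2"
  have r1: "7/2 + a > 3" using a by simp
  have "(cmod (dil_diff2 ee (fst p * xi) * laplace_ker k (snd p)))\<^sup>2 \<le> (360 * \<bar>xi\<bar> powr q * fact k)\<^sup>2 * (weight (7/2 + a) r2 p * rho p)" for p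
  proof -
    define x where "x = fst p"
    have y: "0 < 1 + (snd p)\<^sup>2" and x: "0 < 1 + x\<^sup>2" by (auto intro: add_pos_nonneg)
    have xq: "(\<bar>x\<bar> powr q)\<^sup>2 * (1 + x\<^sup>2) \<le> 4 * weight (7/2 + a) r2 p"
    proof -
      have 1: "(\<bar>x\<bar> powr q)\<^sup>2 = \<bar>x\<bar> powr (5 + a)"
        by (simp add: power2_eq_square q_def flip: powr_add)
      have "x\<^sup>2 = \<bar>x\<bar> powr 2" by (cases "x = 0") (auto simp: powr_numeral)
      then have 2: "\<bar>x\<bar> powr (5 + a) * x\<^sup>2 = \<bar>x\<bar> powr (7 + a)"
        using powr_add[of "\<bar>x\<bar>" "5 + a" 2] by simp
      have "\<bar>x\<bar> powr (5 + a) \<le> 1 + \<bar>x\<bar> powr (7 + 2 * a)" "\<bar>x\<bar> powr (7 + a) \<le> 1 + \<bar>x\<bar> powr (7 + 2 * a)"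
        using a by (intro powr_le_one_plus_powr; simp)+
      moreover have "1 + \<bar>x\<bar> powr (7 + 2 * a) \<le> weight (7/2 + a) r2 p"
        by (simp add: weight_def case_prod_beta' x_def algebra_simps)
      ultimately show ?thesis
        using weight_ge_1[of "7/2 + a" r2 p] unfolding 1 distrib_left 2 by simp
    qed
    have "cmod (dil_diff2 ee (x * xi) * laplace_ker k (snd p)) \<le> (180 * (\<bar>x\<bar> powr q * \<bar>xi\<bar> powr q)) * (fact k / sqrt (1 + (snd p)\<^sup>2))"
      unfolding norm_mult using dil_diff2_ee_le_powr[of q "x * xi"] a
      by (intro mult_mono cmod_laplace_ker_le) (auto simp: q_def abs_mult powr_mult)
    then have "(cmod (dil_diff2 ee (x * xi) * laplace_ker k (snd p)))\<^sup>2 \<le> ((180 * (\<bar>x\<bar> powr q * \<bar>xi\<bar> powr q)) * (fact k / sqrt (1 + (snd p)\<^sup>2)))\<^sup>2"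
      by (rule power_mono) simp
    also have "\<dots> = (180 * \<bar>xi\<bar> powr q * fact k)\<^sup>2 * (((\<bar>x\<bar> powr q)\<^sup>2 * (1 + x\<^sup>2)) * rho p)"
      unfolding rho_def x_def[symmetric] by (rule sq_mult_divide_sqrt'[OF x y])
    also have "\<dots> \<le> (180 * \<bar>xi\<bar> powr q * fact k)\<^sup>2 * ((4 * weight (7/2 + a) r2 p) * rho p)"
      by (intro mult_left_mono mult_right_mono xq less_imp_le[OF rho_pos]) simp
    finally show ?thesis by (simp add: power_mult_distrib x_def)
  qed
  from weighted_lin(2)[OF f _ _ this] show ?thesis
    unfolding dil_diff2_ptrans[OF ptrans_integrable[OF f r1]] q_def by (simp add: mult_ac)
qed

lemma integrable_powr_at_0:
  fixes a :: real
  assumes "a < 1"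
  shows "integrable lborel (\<lambda>x::real. indicator {-1..1} x * \<bar>x\<bar> powr (- a))"
proof -
  define g where "g x = indicator {0<..1} x *\<^sub>R x powr (- a)" for x :: real
  have "(\<lambda>x. x powr (- a)) absolutely_integrable_on {0<..1::real}"
    by (intro nonnegative_absolutely_integrable_1 integrable_on_powr_from_0') (use assms in auto)
  then have g: "integrable lborel g"
    unfolding g_def set_integrable_def by (subst (asm) integrable_completion) auto
  then have g': "integrable lborel (\<lambda>x. g (- x))"
    using integrable_lborel_affine[OF g, of "- 1" 0] by simp
  show ?thesis
  proof (rule Bochner_Integration.integrable_bound)
    show "integrable lborel (\<lambda>x. g x + g (- x))" using g g' by simp
    show "AE x in lborel. norm (indicator {-1..1} x * \<bar>x\<bar> powr (- a)) \<le> norm (g x + g (- x))"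
      by (intro AE_I2) (auto simp: g_def indicator_def)
  qed simp
qed

text \<open>Shaped for a little-o estimate: |t|^{7+2a} will be paid by the weight, the integrable
  \<open>J\<close> by a change of variables, and min 1 |t|^{1-a} is bounded and tends to 0 with t.
  For |t| <= 1 the exponents add up to 8, twice the order of vanishing 4; for |t| > 1 boundedness of
  the kernel suffices.\<close>

lemma dil_diff3_ee_sq_le:
  assumes a: "0 < a" "a < 1"
  defines "J \<equiv> \<lambda>t::real. indicator {-1..1} t * \<bar>t\<bar> powr (- a) + 2 * (1 / (1 + t\<^sup>2))"
  shows "(cmod (dil_diff3 ee t))\<^sup>2 \<le> 6120\<^sup>2 * (min 1 (\<bar>t\<bar> powr (1 - a)) * \<bar>t\<bar> powr (7 + 2 * a) * J t)"
proof (cases "t = 0")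
  case True
  then show ?thesis using dil_diff3_ee_le[of t] by (simp add: J_def)
next
  case t: False
  show ?thesis
  proof (cases "\<bar>t\<bar> \<le> 1")
    case True
    have "min 1 (\<bar>t\<bar> powr (1 - a)) = \<bar>t\<bar> powr (1 - a)"
      using True a by (intro min_absorb2 powr_le1) auto
    moreover have "\<bar>t\<bar> powr (1 - a) * \<bar>t\<bar> powr (7 + 2 * a) * \<bar>t\<bar> powr (- a) = t ^ 8"
      using t powr_numeral[of "\<bar>t\<bar>" "num.Bit0 (num.Bit0 (num.Bit0 num.One))"] by (simp flip: powr_add)
    moreover have "\<bar>t\<bar> powr (- a) \<le> J t"
      using True by (simp add: J_def indicator_def abs_le_iff)
    ultimately have "t ^ 8 \<le> min 1 (\<bar>t\<bar> powr (1 - a)) * \<bar>t\<bar> powr (7 + 2 * a) * J t"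
      by (metis mult_left_mono mult_nonneg_nonneg powr_ge_zero)
    moreover have "(cmod (dil_diff3 ee t))\<^sup>2 \<le> (6120 * t ^ 4)\<^sup>2"
      by (intro power_mono dil_diff3_ee_le) simp
    ultimately show ?thesis by (simp add: power_mult_distrib flip: power_mult)
  next
    case False
    then have m: "min 1 (\<bar>t\<bar> powr (1 - a)) = 1"
      using a by (intro min_absorb1 ge_one_powr_ge_zero) auto
    have "\<bar>t\<bar> powr 2 \<le> \<bar>t\<bar> powr (7 + 2 * a)"
      using False a by (intro powr_mono) auto
    then have 2: "t\<^sup>2 \<le> \<bar>t\<bar> powr (7 + 2 * a)" using t by (simp add: powr_numeral)
    have "1 \<le> t\<^sup>2" using False power_mono[of 1 "\<bar>t\<bar>" 2] by simp
    then have "1 \<le> t\<^sup>2 * (2 * (1 / (1 + t\<^sup>2)))" by (simp add: field_simps add_pos_nonneg)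
    also have "\<dots> \<le> \<bar>t\<bar> powr (7 + 2 * a) * J t"
      by (intro mult_mono 2) (auto simp: J_def)
    finally have "1 \<le> \<bar>t\<bar> powr (7 + 2 * a) * J t" .
    moreover have "(cmod (dil_diff3 ee t))\<^sup>2 \<le> 270\<^sup>2"
      by (intro power_mono dil_diff3_ee_bounded) simp
    ultimately show ?thesis unfolding m by simp
  qed
qed

text \<open>With t = x xi, Cauchy-Schwarz yields xi^{7/2+a} from the weight and xi^{-1/2} from
  integrating J(x xi) in x, together xi^{3+a}. The remaining factor G(xi) tends to 0 by dominated
  convergence, which is what rules out a term of exact order xi^{3+a}.\<close>

lemma tendsto_dil_diff3_ptrans:
  assumes f: "weighted_L2 (7/2 + a) r2 f" and a: "0 < a" "a < 1"
  shows "((\<lambda>xi. dil_diff3 (ptrans k f) xi / of_real (xi powr (3 + a))) \<longlongrightarrow> 0) (at_right 0)"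
proof -
  define c where "c = 3 + a"
  define al where "al = 7 + 2 * a"
  define J where "J = (\<lambda>t::real. indicator {-1..1} t * \<bar>t\<bar> powr (- a) + 2 * (1 / (1 + t\<^sup>2)))"
  define m where "m t = min 1 (\<bar>t\<bar> powr (1 - a))" for t :: real
  define h where "h p = \<bar>fst p\<bar> powr al * (f p)\<^sup>2" for p
  define G where "G xi = (LINT p|lborel. m (fst p * xi) * h p)" for xi
  define R where "R = (LINT p|lborel. J (fst p) * (1 / (1 + (snd p)\<^sup>2)))"
  have [measurable]: "f \<in> borel_measurable borel" using f by (rule weighted_measurable)
  have J_meas [measurable]: "J \<in> borel_measurable borel" unfolding J_def by measurable
  have m_meas [measurable]: "m \<in> borel_measurable borel" unfolding m_def by measurable
  have h_meas [measurable]: "h \<in> borel_measurable borel" unfolding h_def by measurable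
  have J0: "J t \<ge> 0" for t by (simp add: J_def)
  have m0: "0 \<le> m t" "m t \<le> 1" for t by (simp_all add: m_def)
  have h0: "h p \<ge> 0" for p by (simp add: h_def)
  have intJ: "integrable lborel J"
    unfolding J_def using a integrable_inverse_1_plus_square_lborel integrable_powr_at_0[of a]
    by (intro Bochner_Integration.integrable_add integrable_mult_right) auto
  have inth: "integrable lborel h"
  proof (rule Bochner_Integration.integrable_bound)
    show "integrable lborel (\<lambda>p. weight (7/2 + a) r2 p * (f p)\<^sup>2)" using f by (simp add: weighted_L2_def)
    show "AE p in lborel. norm (h p) \<le> norm (weight (7/2 + a) r2 p * (f p)\<^sup>2)"
      by (intro AE_I2) (auto simp: h_def weight_def al_def abs_mult algebra_simps intro!: mult_right_mono add_nonneg_nonneg)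
  qed simp
  have intmh: "integrable lborel (\<lambda>p. m (fst p * xi) * h p)" for xi
    by (rule Bochner_Integration.integrable_bound[OF inth])
      (auto intro!: AE_I2 mult_left_le_one_le simp: abs_mult m0 h0)
  have G0: "G xi \<ge> 0" for xi unfolding G_def by (intro Bochner_Integration.integral_nonneg mult_nonneg_nonneg m0 h0)
  have R0: "R \<ge> 0" unfolding R_def by (intro Bochner_Integration.integral_nonneg mult_nonneg_nonneg J0) simp
  \<comment> \<open>The factor xi normalises the dilation of J, so the integral R does not depend on
    xi.\<close>
  have scale: "integrable lborel (\<lambda>p. xi * J (fst p * xi) * (1 / (1 + (snd p)\<^sup>2)))"
    "(LINT p|lborel. xi * J (fst p * xi) * (1 / (1 + (snd p)\<^sup>2))) = R" if xi: "xi > 0" for xi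
  proof -
    have i: "integrable lborel (\<lambda>x. xi * J (x * xi))"
      using integrable_lborel_affine[OF intJ, of xi 0] xi by (simp add: mult.commute)
    show "integrable lborel (\<lambda>p. xi * J (fst p * xi) * (1 / (1 + (snd p)\<^sup>2)))"
      by (rule integrable_tensor[OF i integrable_inverse_1_plus_square_lborel])
    have "(LINT x|lborel. J x) = (LINT x|lborel. xi * J (x * xi))"
      using integral_lborel_affine[OF J_meas, of xi 0] xi by (simp add: mult.commute)
    then show "(LINT p|lborel. xi * J (fst p * xi) * (1 / (1 + (snd p)\<^sup>2))) = R"
      unfolding R_def integral_tensor[OF i integrable_inverse_1_plus_square_lborel]
        integral_tensor[OF intJ integrable_inverse_1_plus_square_lborel] by simp
  qed
  have pt: "cmod (complex_of_real (f p) * (dil_diff3 ee (fst p * xi) * laplace_ker k (snd p)))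
      \<le> (6120 * fact k * xi powr c) * ((m (fst p * xi) * h p / mu + mu * (xi * J (fst p * xi) * (1 / (1 + (snd p)\<^sup>2)))) / 2)"
    if xi: "xi > 0" and mu: "mu > 0" for p xi mu
  proof -
    define x where "x = fst p"
    define Y where "Y = 1 + (snd p)\<^sup>2"
    have Y: "Y > 0" by (auto simp: Y_def intro: add_pos_nonneg)
    define A where "A = sqrt (m (x * xi) * h p)"
    define B where "B = sqrt (xi * J (x * xi) * (1 / Y))"
    have A: "A\<^sup>2 = m (x * xi) * h p" "A \<ge> 0" and B: "B\<^sup>2 = xi * J (x * xi) * (1 / Y)" "B \<ge> 0"
      using m0 h0 J0 xi Y by (simp_all add: A_def B_def)
    have "(cmod (complex_of_real (f p) * (dil_diff3 ee (x * xi) * laplace_ker k (snd p))))\<^sup>2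
      \<le> (\<bar>f p\<bar> * (cmod (dil_diff3 ee (x * xi)) * (fact k / sqrt Y)))\<^sup>2"
      unfolding norm_mult norm_of_real Y_def by (intro power_mono mult_left_mono cmod_laplace_ker_le) auto
    also have "\<dots> = (cmod (dil_diff3 ee (x * xi)))\<^sup>2 * ((f p)\<^sup>2 * ((fact k)\<^sup>2 * (1 / Y)))"
      using Y by (simp add: power_mult_distrib power_divide)
    also have "\<dots> \<le> (6120\<^sup>2 * (m (x * xi) * \<bar>x * xi\<bar> powr al * J (x * xi))) * ((f p)\<^sup>2 * ((fact k)\<^sup>2 * (1 / Y)))"
      using dil_diff3_ee_sq_le[OF a, of "x * xi"] Y unfolding m_def al_def J_def by (intro mult_right_mono) auto
    \<comment> \<open>7 + 2 a = 2 (3 + a) + 1: one power of xi is split off for the normalised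
      J.\<close>
    also have "\<bar>x * xi\<bar> powr al = \<bar>x\<bar> powr al * ((xi powr c)\<^sup>2 * xi)"
    proof -
      have "(xi powr c)\<^sup>2 * xi = xi powr (c + c + 1)"
        using powr_add[of xi "c + c" 1] powr_add[of xi c c] xi by (simp add: power2_eq_square)
      then show ?thesis using xi by (simp add: abs_mult powr_mult c_def al_def)
    qed
    also have "(6120\<^sup>2 * (m (x * xi) * (\<bar>x\<bar> powr al * ((xi powr c)\<^sup>2 * xi)) * J (x * xi))) * ((f p)\<^sup>2 * ((fact k)\<^sup>2 * (1 / Y)))
      = (6120 * fact k * xi powr c)\<^sup>2 * (A\<^sup>2 * B\<^sup>2)"
      unfolding A B h_def x_def by (simp add: power_mult_distrib)
    finally have "(cmod (complex_of_real (f p) * (dil_diff3 ee (x * xi) * laplace_ker k (snd p))))\<^sup>2 \<le> ((6120 * fact k * xi powr c) * (A * B))\<^sup>2"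
      by (simp add: power_mult_distrib)
    then have 1: "cmod (complex_of_real (f p) * (dil_diff3 ee (x * xi) * laplace_ker k (snd p))) \<le> (6120 * fact k * xi powr c) * (A * B)"
      by (rule power2_le_imp_le) (use A(2) B(2) in simp)
    have "0 \<le> (A / sqrt mu - sqrt mu * B)\<^sup>2" by simp
    also have "\<dots> = A\<^sup>2 / mu + mu * B\<^sup>2 - 2 * (A * B)"
      using mu by (simp add: power2_diff power_mult_distrib power_divide)
    finally have "A * B \<le> (A\<^sup>2 / mu + mu * B\<^sup>2) / 2" by simp
    then have "(6120 * fact k * xi powr c) * (A * B) \<le> (6120 * fact k * xi powr c) * ((A\<^sup>2 / mu + mu * B\<^sup>2) / 2)"
      by (intro mult_left_mono mult_nonneg_nonneg) auto
    with 1 show ?thesis unfolding A B x_def Y_def by (rule order_trans)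
  qed
  have bd: "cmod (dil_diff3 (ptrans k f) xi / of_real (xi powr c)) \<le> 6120 * fact k * sqrt (G xi * R)" if xi: "xi > 0" for xi
  proof -
    have r1: "7/2 + a > 3" using a by simp
    have main: "cmod (dil_diff3 (ptrans k f) xi) \<le> (6120 * fact k * xi powr c) * ((G xi / mu + mu * R) / 2)" if mu: "mu > 0" for mu
    proof -
      let ?K = "\<lambda>p. complex_of_real (f p) * (dil_diff3 ee (fst p * xi) * laplace_ker k (snd p))"
      let ?U = "\<lambda>p. (6120 * fact k * xi powr c) * ((m (fst p * xi) * h p / mu + mu * (xi * J (fst p * xi) * (1 / (1 + (snd p)\<^sup>2)))) / 2)"
      have comb: "integrable lborel (\<lambda>p. C * ((g1 p / mu + mu * g2 p) / 2))"
        "(LINT p|lborel. C * ((g1 p / mu + mu * g2 p) / 2)) = C * (((LINT p|lborel. g1 p) / mu + mu * (LINT p|lborel. g2 p)) / 2)"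
        if "integrable lborel g1" "integrable lborel g2" for C and g1 g2 :: "real \<times> real \<Rightarrow> real"
        using that by simp_all
      have iU: "integrable lborel ?U" by (rule comb(1)[OF intmh scale(1)[OF xi]])
      have iK: "integrable lborel ?K"
      proof (rule Bochner_Integration.integrable_bound[OF iU])
        show "AE p in lborel. norm (?K p) \<le> norm (?U p)"
          unfolding real_norm_def by (intro AE_I2 order_trans[OF pt[OF xi mu] abs_ge_self])
      qed simp
      have "cmod (dil_diff3 (ptrans k f) xi) \<le> (LINT p|lborel. cmod (?K p))"
        unfolding dil_diff3_ptrans[OF ptrans_integrable[OF f r1]] by (rule integral_norm_bound)
      also have "\<dots> \<le> (LINT p|lborel. ?U p)"
        by (intro integral_mono integrable_norm iK iU pt xi mu)
      also have "\<dots> = (6120 * fact k * xi powr c) * ((G xi / mu + mu * R) / 2)"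
        unfolding comb(2)[OF intmh scale(1)[OF xi]] scale(2)[OF xi] G_def ..
      finally show ?thesis .
    qed
    have K: "0 < 6120 * fact k * xi powr c" using xi by simp
    have "cmod (dil_diff3 (ptrans k f) xi) / (6120 * fact k * xi powr c) \<le> (G xi / mu + mu * R) / 2" if "mu > 0" for mu
      using main[OF that] unfolding pos_divide_le_eq[OF K] by (metis mult.commute)
    then have "cmod (dil_diff3 (ptrans k f) xi) / (6120 * fact k * xi powr c) \<le> sqrt (G xi * R)"
      by (intro le_sqrt_of_AMGM G0 R0)
    with xi show ?thesis by (simp add: norm_divide field_simps)
  qed
  have Glim: "(G \<longlongrightarrow> 0) (at_right 0)"
  proof -
    \<comment> \<open>Dominated convergence is used at infinity, hence the passage from xi to its
      inverse.\<close>
    have "((\<lambda>xi. LINT p|lborel. m (fst p * inverse xi) * h p) \<longlongrightarrow> integral\<^sup>L (lborel :: (real \<times> real) measure) (\<lambda>_. 0::real)) at_top"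
    proof (rule integral_dominated_convergence_at_top[where w = h])
      show "\<forall>\<^sub>F xi in at_top. AE p in lborel. norm (m (fst p * inverse xi) * h p) \<le> h p"
        by (auto intro!: always_eventually AE_I2 mult_left_le_one_le simp: abs_mult m0 h0)
      have "((\<lambda>xi. m (x * inverse xi) * y) \<longlongrightarrow> min 1 (\<bar>x * 0\<bar> powr (1 - a)) * y) at_top" for x y :: real
        unfolding m_def using a
        by (intro tendsto_mult tendsto_const tendsto_min tendsto_powr' tendsto_rabs tendsto_inverse_0_at_top filterlim_ident) auto
      then show "AE p in lborel. ((\<lambda>xi. m (fst p * inverse xi) * h p) \<longlongrightarrow> 0) at_top"
        using a by simp
    qed (use inth in auto)
    then have "((\<lambda>xi. G (inverse xi)) \<longlongrightarrow> 0) at_top" by (simp add: G_def)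
    then show ?thesis
      by (simp add: filterlim_at_right_to_top)
  qed
  have "((\<lambda>xi. 6120 * fact k * sqrt (G xi * R)) \<longlongrightarrow> 6120 * fact k * sqrt (0 * R)) (at_right 0)"
    by (intro tendsto_intros Glim)
  then have "((\<lambda>xi. 6120 * fact k * sqrt (G xi * R)) \<longlongrightarrow> 0) (at_right 0)" by simp
  then show ?thesis
    unfolding c_def[symmetric]
    by (rule Lim_null_comparison[rotated]) (use bd in \<open>auto simp: eventually_at intro!: exI[of _ 1]\<close>)
qed

section \<open>Continuity in time of the transforms\<close>

lemma cis_adm:
  assumes "r1 > 3" "r2 > 3" "cmod c \<le> 1"
  shows "(cmod c)\<^sup>2 \<le> 2\<^sup>2 * (weight r1 r2 p * rho p)"
proof -
  have "(cmod c)\<^sup>2 \<le> 1" using assms by (simp add: power_le_one)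
  then show ?thesis using weight_rho[OF assms(1,2), of p] by simp
qed

lemma weighted_integrable:
  assumes "weighted_L2 r1 r2 f" "r1 > 3" "r2 > 3"
  shows "integrable lborel f"
proof -
  have "integrable lborel (\<lambda>p. complex_of_real (f p) * 1)"
    by (rule weighted_lin(1)[OF assms(1) _ _ cis_adm[OF assms(2,3)], of "\<lambda>_. 1"]) auto
  then have "integrable lborel (\<lambda>p. complex_of_real (f p))" by simp
  then show ?thesis unfolding complex_of_real_integrable_eq .
qed

lemma weighted_sq_integrable:
  assumes "weighted_L2 r1 r2 f"
  shows "integrable lborel (\<lambda>p. (f p)\<^sup>2)"
proof -
  have "integrable lborel (\<lambda>p. complex_of_real (f p * f p) * 1)"
    by (rule weighted_quad(1)[OF assms assms, of "\<lambda>_. 1" 1]) (auto simp: weight_ge_1)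
  then have "integrable lborel (\<lambda>p. complex_of_real (f p * f p))" by simp
  then show ?thesis unfolding complex_of_real_integrable_eq power2_eq_square .
qed

lemma fourier2_diff:
  assumes "integrable lborel f" "integrable lborel g"
  shows "fourier2 (\<lambda>p. f p - g p) q = fourier2 f q - fourier2 g q"
proof -
  have i: "integrable lborel (\<lambda>p. complex_of_real (h p) * cis (- (p \<bullet> q)))" if "integrable lborel h" for h
    using that by (intro integrable_unimodular_mult) auto
  have "fourier2 (\<lambda>p. f p - g p) q = (LINT p|lborel. complex_of_real (f p) * cis (- (p \<bullet> q)) - complex_of_real (g p) * cis (- (p \<bullet> q)))"
    unfolding fourier2_inner by (intro Bochner_Integration.integral_cong refl) (simp add: left_diff_distrib)
  also have "\<dots> = fourier2 f q - fourier2 g q"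
    unfolding fourier2_inner by (intro Bochner_Integration.integral_diff i assms)
  finally show ?thesis .
qed

lemma isCont_fourier2_seq:
  assumes f: "integrable lborel f" and Q: "Q \<longlonglongrightarrow> q"
  shows "(\<lambda>n. fourier2 f (Q n)) \<longlonglongrightarrow> fourier2 f q"
  unfolding fourier2_inner
proof (rule integral_dominated_convergence[where w = "\<lambda>p. \<bar>f p\<bar>"])
  have [measurable]: "f \<in> borel_measurable borel" using f by auto
  show "(\<lambda>p. complex_of_real (f p) * cis (- (p \<bullet> q))) \<in> borel_measurable lborel"
    "\<And>n. (\<lambda>p. complex_of_real (f p) * cis (- (p \<bullet> Q n))) \<in> borel_measurable lborel" by measurable
  have "isCont (\<lambda>q. complex_of_real (f p) * cis (- (p \<bullet> q))) q" for p
    unfolding cis_conv_exp by (intro continuous_intros)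
  then show "AE p in lborel. (\<lambda>n. complex_of_real (f p) * cis (- (p \<bullet> Q n))) \<longlonglongrightarrow> complex_of_real (f p) * cis (- (p \<bullet> q))"
    by (intro AE_I2 isCont_tendsto_compose[OF _ Q])
qed (use f in \<open>auto simp: norm_mult\<close>)

lemma continuous_on_fourier2: "integrable lborel f \<Longrightarrow> continuous_on UNIV (fourier2 f)"
  unfolding continuous_on_sequentially o_def by (blast intro: isCont_fourier2_seq)

lemma fourier2_measurable: "integrable lborel f \<Longrightarrow> fourier2 f \<in> borel_measurable borel"
  by (intro borel_measurable_continuous_onI continuous_on_fourier2)

text \<open>Fubini for an absolutely convergent integral. The form in (x, y) suits the weights; the
  form in eta suits the equation, which is given frequency by frequency.\<close>

lemma ptrans_eq_gamma_ker_fourier2: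
  assumes f: "integrable lborel f"
  shows "ptrans k f xi = (LINT eta|lborel. complex_of_real (gamma_ker k eta) * fourier2 f (xi, eta))"
proof -
  have [measurable]: "f \<in> borel_measurable borel" using f by auto
  have fc: "integrable lborel (\<lambda>p. complex_of_real (f p))" using f by simp
  have gc: "integrable lborel (\<lambda>x. complex_of_real (gamma_ker k x))" using integrable_gamma_ker by simp
  have int: "integrable (lborel \<Otimes>\<^sub>M lborel) (\<lambda>(eta, p). complex_of_real (gamma_ker k eta) * complex_of_real (f p) * cis (- (p \<bullet> (xi, eta))))"
    using integrable_unimodular_mult[OF integrable_mult_tensor[OF gc fc], of "\<lambda>(eta, p). cis (- (p \<bullet> (xi, eta)))"]
    by (simp add: case_prod_beta')
  have "(LINT eta|lborel. complex_of_real (gamma_ker k eta) * fourier2 f (xi, eta))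
    = (LINT eta|lborel. LINT p|lborel. complex_of_real (gamma_ker k eta) * complex_of_real (f p) * cis (- (p \<bullet> (xi, eta))))"
    unfolding fourier2_inner by (intro Bochner_Integration.integral_cong refl) (simp only: integral_mult_right_zero mult.assoc)
  also have "\<dots> = (LINT p|lborel. LINT eta|lborel. complex_of_real (gamma_ker k eta) * complex_of_real (f p) * cis (- (p \<bullet> (xi, eta))))"
    using lborel_pair.Fubini_integral[OF int] by simp
  also have "\<dots> = (LINT p|lborel. (complex_of_real (f p) * ee (fst p * xi)) * (LINT eta|lborel. complex_of_real (gamma_ker k eta) * cis (- (snd p * eta))))"
  proof (intro Bochner_Integration.integral_cong refl, subst integral_mult_right_zero[symmetric],
      intro Bochner_Integration.integral_cong refl)
    fix p :: "real \<times> real" and eta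
    have "cis (- (p \<bullet> (xi, eta))) = ee (fst p * xi) * ee (snd p * eta)"
      by (simp add: inner_prod_def cis_mult)
    then show "complex_of_real (gamma_ker k eta) * complex_of_real (f p) * cis (- (p \<bullet> (xi, eta)))
      = complex_of_real (f p) * ee (fst p * xi) * (complex_of_real (gamma_ker k eta) * cis (- (snd p * eta)))" by simp
  qed
  also have "\<dots> = ptrans k f xi"
    unfolding gamma_ker_fourier ptrans_def by (simp add: mult.assoc)
  finally show ?thesis ..
qed

lemma Znorm_parts_nonneg: "0 \<le> (LINT q|lborel. (1 + (g q)\<^sup>2) powr e * (cmod (F q))\<^sup>2)"
  by (intro Bochner_Integration.integral_nonneg) simp

lemma energy_le_Znorm_sq: "energy r1 r2 f \<le> Znorm_sq a s r1 r2 f"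
  unfolding Znorm_sq_def energy_def
  using Znorm_parts_nonneg[of fst "(1 + a) * s" "fourier2 f"] Znorm_parts_nonneg[of snd "2 * s" "fourier2 f"] by simp

section \<open>The solution and the continuity of its transforms\<close>

locale zk_solution =
  fixes a s r1 r2 T :: real and phi :: "real \<times> real \<Rightarrow> real" and u :: "real \<Rightarrow> real \<times> real \<Rightarrow> real"
  assumes a0: "0 < a" and a1: "a < 1" and s4: "s \<ge> 4" and r1: "r1 > 3" and r2: "r2 > 3"
    and cont: "cont_Z a s r1 r2 T u" and sol: "solves_IVP a T phi u"
begin

abbreviation u_hat :: "real \<Rightarrow> real \<times> real \<Rightarrow> complex" where "u_hat t \<equiv> fourier2 (u t)"
abbreviation usq_hat :: "real \<Rightarrow> real \<times> real \<Rightarrow> complex" where "usq_hat t \<equiv> fourier2 (\<lambda>p. (u t p)\<^sup>2)"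

lemma Z_u: "t \<in> {0..T} \<Longrightarrow> Zspace a s r1 r2 (u t)"
  using cont by (simp add: cont_Z_def)

lemma w_u: "t \<in> {0..T} \<Longrightarrow> weighted_L2 r1 r2 (u t)"
  using Z_u by (simp add: Zspace_def)

lemma u_integrable: "t \<in> {0..T} \<Longrightarrow> integrable lborel (u t)"
  by (rule weighted_integrable[OF w_u r1 r2])

lemma u_sq_integrable: "t \<in> {0..T} \<Longrightarrow> integrable lborel (\<lambda>p. (u t p)\<^sup>2)"
  by (rule weighted_sq_integrable[OF w_u])

lemma u_measurable: "t \<in> {0..T} \<Longrightarrow> u t \<in> borel_measurable borel"
  by (rule weighted_measurable[OF w_u])

lemma Ed_tendsto:
  assumes "t0 \<in> {0..T}"
  shows "((\<lambda>t. energy r1 r2 (\<lambda>p. u t p - u t0 p)) \<longlongrightarrow> 0) (at t0 within {0..T})"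
proof (rule tendsto_sandwich[of "\<lambda>_. 0"])
  show "((\<lambda>t. Znorm_sq a s r1 r2 (\<lambda>p. u t p - u t0 p)) \<longlongrightarrow> 0) (at t0 within {0..T})"
    using cont assms by (simp add: cont_Z_def)
qed (auto simp: energy_nonneg energy_le_Znorm_sq)

lemma Ed_seq:
  assumes "\<And>n. X n \<in> {0..T}" "X \<longlonglongrightarrow> t0"
  shows "(\<lambda>n. energy r1 r2 (\<lambda>p. u (X n) p - u t0 p)) \<longlonglongrightarrow> 0"
proof -
  have t0: "t0 \<in> {0..T}"
    using assms by (metis closed_real_atLeastAtMost closed_sequentially)
  have "continuous (at t0 within {0..T}) (\<lambda>t. energy r1 r2 (\<lambda>p. u t p - u t0 p))"
    using Ed_tendsto[OF t0] by (simp add: continuous_within energy_def)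
  from continuous_within_tendsto_compose'[OF this assms] show ?thesis by (simp add: energy_def)
qed

text \<open>The kernels may vary with n under one uniform bound, so that time and frequency can move
  together. As u(X n) - u(t0) tends to 0 in energy, only the limit with u(t0) frozen has to be
  supplied.\<close>

lemma lin_seq:
  fixes kn :: "nat \<Rightarrow> real \<times> real \<Rightarrow> complex"
  assumes X: "\<And>n. X n \<in> {0..T}" "X \<longlonglongrightarrow> t0" and t0: "t0 \<in> {0..T}"
    and k: "\<And>n. kn n \<in> borel_measurable borel" "A \<ge> 0" "\<And>n p. (cmod (kn n p))\<^sup>2 \<le> A\<^sup>2 * (weight r1 r2 p * rho p)"
    and L: "(\<lambda>n. LINT p|lborel. complex_of_real (u t0 p) * kn n p) \<longlonglongrightarrow> L"
  shows "(\<lambda>n. LINT p|lborel. complex_of_real (u (X n) p) * kn n p) \<longlonglongrightarrow> L"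
proof -
  let ?d = "\<lambda>n p. u (X n) p - u t0 p"
  have "(\<lambda>n. LINT p|lborel. complex_of_real (?d n p) * kn n p) \<longlonglongrightarrow> 0"
  proof (rule Lim_null_comparison)
    show "\<forall>\<^sub>F n in sequentially. norm (LINT p|lborel. complex_of_real (?d n p) * kn n p) \<le> A * sqrt (energy r1 r2 (?d n) * rho_mass)"
      by (intro always_eventually allI weighted_lin(2) weighted_diff w_u X t0 k)
    have "(\<lambda>n. A * sqrt (energy r1 r2 (?d n) * rho_mass)) \<longlonglongrightarrow> A * sqrt (0 * rho_mass)"
      by (intro tendsto_intros Ed_seq X)
    then show "(\<lambda>n. A * sqrt (energy r1 r2 (?d n) * rho_mass)) \<longlonglongrightarrow> 0" by simp
  qed
  moreover have "(LINT p|lborel. complex_of_real (?d n p) * kn n p) = (LINT p|lborel. complex_of_real (u (X n) p) * kn n p) - (LINT p|lborel. complex_of_real (u t0 p) * kn n p)" for n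
    unfolding of_real_diff left_diff_distrib
    by (intro Bochner_Integration.integral_diff weighted_lin(1)[OF w_u _ k(2,3)] X t0 k)
  ultimately have "(\<lambda>n. (LINT p|lborel. complex_of_real (u (X n) p) * kn n p) - (LINT p|lborel. complex_of_real (u t0 p) * kn n p)) \<longlonglongrightarrow> 0" by simp
  from tendsto_add[OF this L] show ?thesis by simp
qed

text \<open>With d = u(X n) - u(t0), the square is d^2 + 2 d u(t0) + u(t0)^2, and
  \<open>weighted_quad\<close> sends the first two terms to 0.\<close>

lemma quad_seq:
  fixes kn :: "nat \<Rightarrow> real \<times> real \<Rightarrow> complex"
  assumes X: "\<And>n. X n \<in> {0..T}" "X \<longlonglongrightarrow> t0" and t0: "t0 \<in> {0..T}"
    and k: "\<And>n. kn n \<in> borel_measurable borel" "A \<ge> 0" "\<And>n p. cmod (kn n p) \<le> A * weight r1 r2 p"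
    and L: "(\<lambda>n. LINT p|lborel. complex_of_real ((u t0 p)\<^sup>2) * kn n p) \<longlonglongrightarrow> L"
  shows "(\<lambda>n. LINT p|lborel. complex_of_real ((u (X n) p)\<^sup>2) * kn n p) \<longlonglongrightarrow> L"
proof -
  let ?d = "\<lambda>n p. u (X n) p - u t0 p"
  have d: "weighted_L2 r1 r2 (?d n)" for n by (intro weighted_diff w_u X t0)
  let ?I = "\<lambda>f g n. LINT p|lborel. complex_of_real (f p * g p) * kn n p"
  have lim1: "(\<lambda>n. ?I (?d n) (?d n) n) \<longlonglongrightarrow> 0"
  proof (rule Lim_null_comparison)
    show "\<forall>\<^sub>F n in sequentially. norm (?I (?d n) (?d n) n) \<le> A * sqrt (energy r1 r2 (?d n) * energy r1 r2 (?d n))"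
      by (intro always_eventually allI weighted_quad(2) d k)
    have "(\<lambda>n. A * sqrt (energy r1 r2 (?d n) * energy r1 r2 (?d n))) \<longlonglongrightarrow> A * sqrt (0 * 0)"
      by (intro tendsto_intros Ed_seq X)
    then show "(\<lambda>n. A * sqrt (energy r1 r2 (?d n) * energy r1 r2 (?d n))) \<longlonglongrightarrow> 0" by simp
  qed
  have lim2: "(\<lambda>n. ?I (?d n) (u t0) n) \<longlonglongrightarrow> 0"
  proof (rule Lim_null_comparison)
    show "\<forall>\<^sub>F n in sequentially. norm (?I (?d n) (u t0) n) \<le> A * sqrt (energy r1 r2 (?d n) * energy r1 r2 (u t0))"
      by (intro always_eventually allI weighted_quad(2) d k w_u t0)
    have "(\<lambda>n. A * sqrt (energy r1 r2 (?d n) * energy r1 r2 (u t0))) \<longlonglongrightarrow> A * sqrt (0 * energy r1 r2 (u t0))"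
      by (intro tendsto_intros Ed_seq X)
    then show "(\<lambda>n. A * sqrt (energy r1 r2 (?d n) * energy r1 r2 (u t0))) \<longlonglongrightarrow> 0" by simp
  qed
  have "(LINT p|lborel. complex_of_real ((u (X n) p)\<^sup>2) * kn n p)
    = ?I (?d n) (?d n) n + 2 * ?I (?d n) (u t0) n + (LINT p|lborel. complex_of_real ((u t0 p)\<^sup>2) * kn n p)" for n
  proof -
    have i1: "integrable lborel (\<lambda>p. complex_of_real (?d n p * ?d n p) * kn n p)"
      and i2: "integrable lborel (\<lambda>p. complex_of_real (?d n p * u t0 p) * kn n p)"
      and i3: "integrable lborel (\<lambda>p. complex_of_real (u t0 p * u t0 p) * kn n p)"
      by (intro weighted_quad(1)[OF _ _ _ k(2,3)] d w_u t0 k)+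
    have "(LINT p|lborel. complex_of_real ((u (X n) p)\<^sup>2) * kn n p)
      = (LINT p|lborel. complex_of_real (?d n p * ?d n p) * kn n p + 2 * (complex_of_real (?d n p * u t0 p) * kn n p) + complex_of_real (u t0 p * u t0 p) * kn n p)"
      by (intro Bochner_Integration.integral_cong refl) (simp add: power2_eq_square algebra_simps)
    also have "\<dots> = (LINT p|lborel. complex_of_real (?d n p * ?d n p) * kn n p) + 2 * (LINT p|lborel. complex_of_real (?d n p * u t0 p) * kn n p) + (LINT p|lborel. complex_of_real (u t0 p * u t0 p) * kn n p)"
      using i1 i2 i3 by (simp only: Bochner_Integration.integral_add Bochner_Integration.integrable_add integrable_mult_right integral_mult_right_zero)
    finally show ?thesis by (simp only: power2_eq_square)
  qed
  moreover have "(\<lambda>n. ?I (?d n) (?d n) n + 2 * ?I (?d n) (u t0) n + (LINT p|lborel. complex_of_real ((u t0 p)\<^sup>2) * kn n p)) \<longlonglongrightarrow> 0 + 2 * 0 + L"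
    by (intro tendsto_intros lim1 lim2 L)
  ultimately show ?thesis by simp
qed

lemma continuous_on_lin:
  fixes k :: "real \<times> real \<Rightarrow> complex"
  assumes "k \<in> borel_measurable borel" "A \<ge> 0" "\<And>p. (cmod (k p))\<^sup>2 \<le> A\<^sup>2 * (weight r1 r2 p * rho p)"
  shows "continuous_on {0..T} (\<lambda>t. LINT p|lborel. complex_of_real (u t p) * k p)"
  unfolding continuous_on_sequentially o_def
proof (intro allI ballI impI)
  fix X :: "nat \<Rightarrow> real" and t0 assume "t0 \<in> {0..T}" and "(\<forall>n. X n \<in> {0..T}) \<and> X \<longlonglongrightarrow> t0"
  then show "(\<lambda>n. LINT p|lborel. complex_of_real (u (X n) p) * k p) \<longlonglongrightarrow> (LINT p|lborel. complex_of_real (u t0 p) * k p)"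
    by (intro lin_seq[where A = A, OF _ _ _ assms tendsto_const]) auto
qed

lemma continuous_on_quad:
  fixes k :: "real \<times> real \<Rightarrow> complex"
  assumes "k \<in> borel_measurable borel" "A \<ge> 0" "\<And>p. cmod (k p) \<le> A * weight r1 r2 p"
  shows "continuous_on {0..T} (\<lambda>t. LINT p|lborel. complex_of_real ((u t p)\<^sup>2) * k p)"
  unfolding continuous_on_sequentially o_def
proof (intro allI ballI impI)
  fix X :: "nat \<Rightarrow> real" and t0 assume "t0 \<in> {0..T}" and "(\<forall>n. X n \<in> {0..T}) \<and> X \<longlonglongrightarrow> t0"
  then show "(\<lambda>n. LINT p|lborel. complex_of_real ((u (X n) p)\<^sup>2) * k p) \<longlonglongrightarrow> (LINT p|lborel. complex_of_real ((u t0 p)\<^sup>2) * k p)"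
    by (intro quad_seq[where A = A, OF _ _ _ assms tendsto_const]) auto
qed

text \<open>Continuity is needed jointly in time and frequency: it provides the measurability in
  (eta, tau) for the Fubini step on the tested equation.\<close>

lemma continuous_on_u_hat: "continuous_on ({0..T} \<times> UNIV) (\<lambda>z. u_hat (fst z) (snd z))"
  unfolding continuous_on_sequentially o_def
proof (intro allI ballI impI)
  fix x :: "nat \<Rightarrow> real \<times> real \<times> real" and z
  assume z: "z \<in> {0..T} \<times> UNIV" and x: "(\<forall>n. x n \<in> {0..T} \<times> UNIV) \<and> x \<longlonglongrightarrow> z"
  show "(\<lambda>n. u_hat (fst (x n)) (snd (x n))) \<longlonglongrightarrow> u_hat (fst z) (snd z)"
    unfolding fourier2_inner
  proof (rule lin_seq[where A = 2])
    show "(\<lambda>n. LINT p|lborel. complex_of_real (u (fst z) p) * cis (- (p \<bullet> snd (x n)))) \<longlonglongrightarrow> (LINT p|lborel. complex_of_real (u (fst z) p) * cis (- (p \<bullet> snd z)))"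
      unfolding fourier2_inner[symmetric]
      by (rule isCont_fourier2_seq[OF u_integrable]) (use z x in \<open>auto intro: tendsto_snd\<close>)
    show "(\<lambda>n. fst (x n)) \<longlonglongrightarrow> fst z" using x by (auto intro: tendsto_fst)
    show "fst (x n) \<in> {0..T}" for n using x by (auto simp: mem_Times_iff)
    show "fst z \<in> {0..T}" using z by auto
    show "(cmod (cis (- (p \<bullet> snd (x n)))))\<^sup>2 \<le> 2\<^sup>2 * (weight r1 r2 p * rho p)" for n p
      by (rule cis_adm[OF r1 r2]) simp
  qed auto
qed

lemma continuous_on_usq_hat: "continuous_on ({0..T} \<times> UNIV) (\<lambda>z. usq_hat (fst z) (snd z))"
  unfolding continuous_on_sequentially o_def
proof (intro allI ballI impI)
  fix x :: "nat \<Rightarrow> real \<times> real \<times> real" and z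
  assume z: "z \<in> {0..T} \<times> UNIV" and x: "(\<forall>n. x n \<in> {0..T} \<times> UNIV) \<and> x \<longlonglongrightarrow> z"
  show "(\<lambda>n. usq_hat (fst (x n)) (snd (x n))) \<longlonglongrightarrow> usq_hat (fst z) (snd z)"
    unfolding fourier2_inner
  proof (rule quad_seq[where A = 1])
    show "(\<lambda>n. LINT p|lborel. complex_of_real ((u (fst z) p)\<^sup>2) * cis (- (p \<bullet> snd (x n)))) \<longlonglongrightarrow> (LINT p|lborel. complex_of_real ((u (fst z) p)\<^sup>2) * cis (- (p \<bullet> snd z)))"
      unfolding fourier2_inner[symmetric]
      by (rule isCont_fourier2_seq[OF u_sq_integrable]) (use z x in \<open>auto intro: tendsto_snd\<close>)
    show "(\<lambda>n. fst (x n)) \<longlonglongrightarrow> fst z" using x by (auto intro: tendsto_fst)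
    show "fst (x n) \<in> {0..T}" for n using x by (auto simp: mem_Times_iff)
    show "fst z \<in> {0..T}" using z by auto
  qed (use weight_ge_1 in auto)
qed

lemma continuous_on_ptrans: "continuous_on {0..T} (\<lambda>t. ptrans k (u t) xi)"
  unfolding ptrans_def
proof (rule continuous_on_lin[where A = "3 * 1 * fact k"])
  show "(cmod (ee (fst p * xi) * laplace_ker k (snd p)))\<^sup>2 \<le> (3 * 1 * fact k)\<^sup>2 * (weight r1 r2 p * rho p)" for p
    by (rule kernel_sq_le[OF r1]) auto
qed auto

lemma continuous_on_ptrans_sq: "continuous_on {0..T} (\<lambda>t. ptrans_sq k (u t) xi)"
proof -
  have "cmod (ee (fst p * xi) * laplace_ker k (snd p)) \<le> fact k * weight r1 r2 p" for p
    using mult_mono[of "cmod (laplace_ker k (snd p))" "fact k" 1 "weight r1 r2 p"] weight_ge_1[of r1 r2 p] cmod_laplace_ker_le_fact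
    by (simp add: norm_mult)
  then show ?thesis
    unfolding ptrans_def by (intro continuous_on_quad[where A = "fact k"]) auto
qed

lemma continuous_on_first_moment: "continuous_on {0..T} (\<lambda>t. first_moment (u t))"
  unfolding first_moment_def
proof (rule continuous_on_lin[where A = "3 * 1 * fact 0"])
  show "(cmod (- \<i> * complex_of_real (fst p) * laplace_ker 0 (snd p)))\<^sup>2 \<le> (3 * 1 * fact 0)\<^sup>2 * (weight r1 r2 p * rho p)" for p
    by (rule kernel_sq_le[OF r1]) (auto simp: norm_mult abs_le_one_plus_sq)
qed auto

text \<open>\<open>Znorm_sq\<close> is a squared norm, so in each of its three parts the triangle
  inequality is replaced by |u(t)|^2 <= 2 |u(t0)|^2 + 2 |u(t) - u(t0)|^2. By continuity the last
  term is at most 2 near t0, and the local bounds are patched together.\<close>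

lemma Znorm_sq_bounded: "\<exists>C. \<forall>t\<in>{0..T}. Znorm_sq a s r1 r2 (u t) \<le> C"
proof (rule locally_bounded_imp_bounded_on_interval)
  fix t0 assume t0: "t0 \<in> {0..T}"
  have "\<forall>\<^sub>F t in at t0 within {0..T}. Znorm_sq a s r1 r2 (\<lambda>p. u t p - u t0 p) < 1"
    using cont t0 by (intro order_tendstoD(2)[where y = 0]) (auto simp: cont_Z_def)
  moreover have "\<forall>\<^sub>F t in at t0 within {0..T}. t \<in> {0..T}"
    by (simp add: eventually_at_topological) (use open_UNIV in blast)
  ultimately have "\<forall>\<^sub>F t in at t0 within {0..T}. Znorm_sq a s r1 r2 (u t) \<le> 2 * Znorm_sq a s r1 r2 (u t0) + 2"
  proof eventually_elim
    case (elim t)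
    let ?d = "\<lambda>p. u t p - u t0 p"
    have fd: "fourier2 ?d q = u_hat t q - u_hat t0 q" for q
      by (rule fourier2_diff) (use elim t0 u_integrable in auto)
    have Z: "Zspace a s r1 r2 (u t)" "Zspace a s r1 r2 (u t0)" using Z_u elim t0 by auto
    have [measurable]: "u_hat t \<in> borel_measurable borel" "u_hat t0 \<in> borel_measurable borel"
      using fourier2_measurable[OF u_integrable] elim t0 by auto
    have [measurable]: "u t \<in> borel_measurable borel" "u t0 \<in> borel_measurable borel"
      using u_measurable elim t0 by auto
    have H: "(LINT q|lborel. (1 + (g q)\<^sup>2) powr e * (cmod (u_hat t q))\<^sup>2)
      \<le> 2 * (LINT q|lborel. (1 + (g q)\<^sup>2) powr e * (cmod (u_hat t0 q))\<^sup>2) + 2 * (LINT q|lborel. (1 + (g q)\<^sup>2) powr e * (cmod (fourier2 ?d q))\<^sup>2)"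
      if g [measurable]: "g \<in> borel_measurable borel" and i: "integrable lborel (\<lambda>q. (1 + (g q)\<^sup>2) powr e * (cmod (u_hat t q))\<^sup>2)"
        "integrable lborel (\<lambda>q. (1 + (g q)\<^sup>2) powr e * (cmod (u_hat t0 q))\<^sup>2)" for g :: "real \<times> real \<Rightarrow> real" and e
    proof (rule integrable_square_diff(2))
      show "integrable lborel (\<lambda>q. (1 + (g q)\<^sup>2) powr e * (cmod (fourier2 ?d q))\<^sup>2)"
        unfolding fd
        by (rule integrable_square_diff(1)[OF _ i]) (auto intro: order_trans[OF norm_triangle_ineq4])
      show "\<bar>cmod (u_hat t q)\<bar> \<le> \<bar>cmod (u_hat t0 q)\<bar> + \<bar>cmod (fourier2 ?d q)\<bar>" for q
        unfolding fd using norm_triangle_ineq[of "u_hat t0 q" "u_hat t q - u_hat t0 q"] by simp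
    qed (use i in auto)
    have "(LINT p|lborel. weight r1 r2 p * (u t p)\<^sup>2) \<le> 2 * (LINT p|lborel. weight r1 r2 p * (u t0 p)\<^sup>2) + 2 * (LINT p|lborel. weight r1 r2 p * (?d p)\<^sup>2)"
    proof (rule integrable_square_diff(2))
      show "integrable lborel (\<lambda>p. weight r1 r2 p * (?d p)\<^sup>2)"
        using weighted_diff[OF w_u w_u] elim t0 by (auto simp: weighted_L2_def)
    qed (use Z less_imp_le[OF weight_pos] in \<open>auto simp: Zspace_def weighted_L2_def\<close>)
    moreover have "(LINT q|lborel. (1 + (fst q)\<^sup>2) powr ((1 + a) * s) * (cmod (u_hat t q))\<^sup>2)
      \<le> 2 * (LINT q|lborel. (1 + (fst q)\<^sup>2) powr ((1 + a) * s) * (cmod (u_hat t0 q))\<^sup>2) + 2 * (LINT q|lborel. (1 + (fst q)\<^sup>2) powr ((1 + a) * s) * (cmod (fourier2 ?d q))\<^sup>2)"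
      by (rule H) (use Z in \<open>auto simp: Zspace_def aniso_H_def case_prod_beta'\<close>)
    moreover have "(LINT q|lborel. (1 + (snd q)\<^sup>2) powr (2 * s) * (cmod (u_hat t q))\<^sup>2)
      \<le> 2 * (LINT q|lborel. (1 + (snd q)\<^sup>2) powr (2 * s) * (cmod (u_hat t0 q))\<^sup>2) + 2 * (LINT q|lborel. (1 + (snd q)\<^sup>2) powr (2 * s) * (cmod (fourier2 ?d q))\<^sup>2)"
      by (rule H) (use Z in \<open>auto simp: Zspace_def aniso_H_def case_prod_beta'\<close>)
    ultimately have "Znorm_sq a s r1 r2 (u t) \<le> 2 * Znorm_sq a s r1 r2 (u t0) + 2 * Znorm_sq a s r1 r2 ?d"
      unfolding Znorm_sq_def by argo
    with elim show ?case by linarith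
  qed
  then show "\<exists>C. \<forall>\<^sub>F t in at t0 within {0..T}. Znorm_sq a s r1 r2 (u t) \<le> C" by blast
qed

lemma u_hat_measurable: "t \<in> {0..T} \<Longrightarrow> u_hat t \<in> borel_measurable borel"
  by (intro fourier2_measurable u_integrable)

text \<open>One constant shared by all later estimates. Its sign is known only when the time
  interval is nonempty, hence the premise on t in the nonnegativity lemmas.\<close>

definition Znorm_bound :: real where "Znorm_bound = (SOME C. \<forall>t\<in>{0..T}. Znorm_sq a s r1 r2 (u t) \<le> C)"

lemma Znorm_bound: "t \<in> {0..T} \<Longrightarrow> Znorm_sq a s r1 r2 (u t) \<le> Znorm_bound"
  using someI_ex[OF Znorm_sq_bounded] unfolding Znorm_bound_def by blast

lemma energy_u_le: "t \<in> {0..T} \<Longrightarrow> energy r1 r2 (u t) \<le> Znorm_bound"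
  using Znorm_bound energy_le_Znorm_sq order_trans by blast

definition energy_bound :: real where "energy_bound = sqrt (Znorm_bound * rho_mass)"

lemma energy_bound: "t \<in> {0..T} \<Longrightarrow> sqrt (energy r1 r2 (u t) * rho_mass) \<le> energy_bound"
  unfolding energy_bound_def using energy_u_le rho_mass_nonneg by (intro real_sqrt_le_mono mult_right_mono) auto

lemma energy_bound_nonneg: "t \<in> {0..T} \<Longrightarrow> 0 \<le> energy_bound"
  using energy_bound order_trans[of 0] energy_nonneg rho_mass_nonneg by (meson mult_nonneg_nonneg real_sqrt_ge_zero)

lemma Znorm_bound_nonneg: "t \<in> {0..T} \<Longrightarrow> 0 \<le> Znorm_bound"
  using energy_u_le energy_nonneg order_trans by blast

lemma norm_u_hat_le: "t \<in> {0..T} \<Longrightarrow> cmod (u_hat t q) \<le> 2 * energy_bound"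
proof -
  assume t: "t \<in> {0..T}"
  have "cmod (u_hat t q) \<le> 2 * sqrt (energy r1 r2 (u t) * rho_mass)"
    unfolding fourier2_inner
  proof (rule weighted_lin(2)[OF w_u[OF t]])
    show "(cmod (cis (- (p \<bullet> q))))\<^sup>2 \<le> 2\<^sup>2 * (weight r1 r2 p * rho p)" for p
      by (rule cis_adm[OF r1 r2]) simp
  qed auto
  then show ?thesis using energy_bound[OF t] by simp
qed

lemma norm_usq_hat_le: "t \<in> {0..T} \<Longrightarrow> cmod (usq_hat t q) \<le> Znorm_bound"
proof -
  assume t: "t \<in> {0..T}"
  have "cmod (usq_hat t q) \<le> 1 * sqrt (energy r1 r2 (u t) * energy r1 r2 (u t))"
    unfolding fourier2_inner power2_eq_square
    by (rule weighted_quad(2)[OF w_u[OF t] w_u[OF t]]) (use weight_ge_1 in auto)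
  then show ?thesis using energy_u_le[OF t] energy_nonneg[of r1 r2 "u t"] by simp
qed

end

section \<open>The equation tested in the second frequency\<close>

context zk_solution
begin

definition rhs :: "real \<Rightarrow> real \<times> real \<Rightarrow> complex" where
  "rhs t q = - \<i> * complex_of_real (fst q * \<bar>fst q\<bar> powr (a + 1)) * u_hat t q
    + \<i> * complex_of_real (fst q * (snd q)\<^sup>2) * u_hat t q - \<i> * complex_of_real (fst q / 2) * usq_hat t q"

lemma continuous_on_rhs: "continuous_on ({0..T} \<times> UNIV) (\<lambda>z. rhs (fst z) (snd z))"
proof -
  have "continuous_on UNIV (\<lambda>x::real. x * \<bar>x\<bar> powr (a + 1))"
    by (intro continuous_on_mult continuous_on_powr' continuous_on_rabs continuous_on_id continuous_on_const) (use a0 in auto)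
  then have 1: "continuous_on ({0..T} \<times> UNIV) (\<lambda>z :: real \<times> real \<times> real. fst (snd z) * \<bar>fst (snd z)\<bar> powr (a + 1))"
    by (rule continuous_on_compose2) (auto intro!: continuous_on_fst continuous_on_snd continuous_on_id)
  show ?thesis
    unfolding rhs_def
    by (intro continuous_on_add continuous_on_diff continuous_on_mult continuous_on_const continuous_on_of_real
        continuous_on_divide continuous_on_power continuous_on_fst continuous_on_snd continuous_on_id
        continuous_on_u_hat continuous_on_usq_hat 1) auto
qed

lemma continuous_on_rhs_time: "S \<subseteq> {0..T} \<Longrightarrow> continuous_on S (\<lambda>t. rhs t q)"
  using continuous_on_compose2[OF continuous_on_rhs, of S "\<lambda>t. (t, q)"]
    continuous_on_Pair[OF continuous_on_id continuous_on_const, of S q] by auto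

lemma u_hat_diff:
  assumes "0 \<le> t'" "t' \<le> t" "t \<le> T"
  shows "u_hat t q - u_hat t' q = integral {t'..t} (\<lambda>\<tau>. rhs \<tau> q)"
proof -
  have sol': "((\<lambda>\<tau>. rhs \<tau> q) has_integral (u_hat t q - u_hat 0 q)) {0..t}" if "t \<in> {0..T}" for t
    using sol that unfolding solves_IVP_def by (cases q) (auto simp: rhs_def)
  have "integral {0..t'} (\<lambda>\<tau>. rhs \<tau> q) + integral {t'..t} (\<lambda>\<tau>. rhs \<tau> q) = integral {0..t} (\<lambda>\<tau>. rhs \<tau> q)"
    using assms by (intro Henstock_Kurzweil_Integration.integral_combine integrable_continuous_real continuous_on_rhs_time) auto
  moreover have "integral {0..t'} (\<lambda>\<tau>. rhs \<tau> q) = u_hat t' q - u_hat 0 q"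
    using assms by (intro integral_unique sol') auto
  moreover have "integral {0..t} (\<lambda>\<tau>. rhs \<tau> q) = u_hat t q - u_hat 0 q"
    using assms by (intro integral_unique sol') auto
  ultimately show ?thesis by (simp add: algebra_simps)
qed

lemma set_integral_Icc_continuous:
  fixes f :: "real \<Rightarrow> complex"
  assumes "continuous_on {c..d} f"
  shows "integral {c..d} f = (LINT x|lborel. indicator {c..d} x *\<^sub>R f x)"
  using set_borel_integral_eq_integral(2)[OF borel_integrable_atLeastAtMost'[OF assms]]
  by (simp add: set_lebesgue_integral_def)

text \<open>The growth in eta comes only from the symbol xi eta^2. The bound is arranged as a
  constant plus a multiple of eta^2, ready to be integrated against
  \<open>gamma_ker k\<close>.\<close>

lemma norm_rhs_le:
  assumes t: "t \<in> {0..T}"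
  shows "cmod (rhs t (xi, eta)) \<le> ((\<bar>xi\<bar> * \<bar>xi\<bar> powr (a + 1)) * (2 * energy_bound) + \<bar>xi\<bar> / 2 * Znorm_bound) + \<bar>xi\<bar> * (2 * energy_bound) * eta\<^sup>2"
proof -
  have "cmod (rhs t (xi, eta)) \<le> cmod (- \<i> * complex_of_real (xi * \<bar>xi\<bar> powr (a + 1)) * u_hat t (xi, eta))
    + cmod (\<i> * complex_of_real (xi * eta\<^sup>2) * u_hat t (xi, eta)) + cmod (\<i> * complex_of_real (xi / 2) * usq_hat t (xi, eta))"
    unfolding rhs_def fst_conv snd_conv by (intro norm_diff_le norm_add_le order_refl)
  also have "\<dots> = (\<bar>xi\<bar> * \<bar>xi\<bar> powr (a + 1)) * cmod (u_hat t (xi, eta)) + (\<bar>xi\<bar> * eta\<^sup>2) * cmod (u_hat t (xi, eta)) + (\<bar>xi\<bar> / 2) * cmod (usq_hat t (xi, eta))"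
    by (simp add: norm_mult norm_divide abs_mult norm_power)
  also have "\<dots> \<le> (\<bar>xi\<bar> * \<bar>xi\<bar> powr (a + 1)) * (2 * energy_bound) + (\<bar>xi\<bar> * eta\<^sup>2) * (2 * energy_bound) + (\<bar>xi\<bar> / 2) * Znorm_bound"
    by (intro add_mono mult_left_mono norm_u_hat_le norm_usq_hat_le t) auto
  finally show ?thesis by (simp add: algebra_simps)
qed

text \<open>The factor eta^2 of the mixed derivative is absorbed into the kernel and raises k to k +
  2, while xi remains a parameter; the kernels are chosen to form a family stable under this
  multiplication.\<close>

lemma gamma_ker_rhs_integral:
  assumes t: "t \<in> {0..T}"
  shows "(LINT eta|lborel. complex_of_real (gamma_ker k eta) * rhs t (xi, eta))
    = - \<i> * complex_of_real (xi * \<bar>xi\<bar> powr (a + 1)) * ptrans k (u t) xi + \<i> * xi * ptrans (k + 2) (u t) xi - \<i> * complex_of_real (xi / 2) * ptrans_sq k (u t) xi"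
proof -
  have [measurable]: "u_hat t \<in> borel_measurable borel" "usq_hat t \<in> borel_measurable borel"
    by (intro fourier2_measurable u_integrable u_sq_integrable t)+
  have gb: "integrable lborel (\<lambda>eta. complex_of_real (gamma_ker k eta) * h (xi, eta))"
    if [measurable]: "h \<in> borel_measurable borel" and b: "\<And>q. cmod (h q) \<le> B" for h k B
  proof (rule Bochner_Integration.integrable_bound[OF integrable_mult_left[of B, OF integrable_gamma_ker[of k]]])
    have "0 \<le> B" using b[of 0] norm_ge_zero order_trans by blast
    then show "AE x in lborel. norm (complex_of_real (gamma_ker k x) * h (xi, x)) \<le> norm (gamma_ker k x * B)"
      using b by (auto simp: norm_mult abs_mult intro!: AE_I2 mult_left_mono)
    have "(\<lambda>x::real. h (xi, x)) \<in> borel_measurable borel"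
      by (intro measurable_compose[OF _ that(1)] borel_measurable_continuous_onI continuous_intros)
    then show "(\<lambda>eta. complex_of_real (gamma_ker k eta) * h (xi, eta)) \<in> borel_measurable lborel" by simp
  qed
  have gc: "complex_of_real (gamma_ker (k + 2) eta) = complex_of_real (gamma_ker k eta) * complex_of_real eta ^ 2" for eta
    by (simp only: gamma_ker_mult[symmetric] of_real_mult of_real_power)
  have i1: "integrable lborel (\<lambda>eta. complex_of_real (gamma_ker k eta) * u_hat t (xi, eta))" for k
    by (rule gb) (use norm_u_hat_le[OF t] in auto)
  have i2: "integrable lborel (\<lambda>eta. complex_of_real (gamma_ker k eta) * usq_hat t (xi, eta))" for k
    by (rule gb) (use norm_usq_hat_le[OF t] in auto)
  have "(LINT eta|lborel. complex_of_real (gamma_ker k eta) * rhs t (xi, eta))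
    = (LINT eta|lborel. - \<i> * complex_of_real (xi * \<bar>xi\<bar> powr (a + 1)) * (complex_of_real (gamma_ker k eta) * u_hat t (xi, eta))
      + \<i> * xi * (complex_of_real (gamma_ker (k + 2) eta) * u_hat t (xi, eta)) - \<i> * complex_of_real (xi / 2) * (complex_of_real (gamma_ker k eta) * usq_hat t (xi, eta)))"
    unfolding gc by (intro Bochner_Integration.integral_cong refl) (simp add: rhs_def algebra_simps)
  also have "\<dots> = - \<i> * complex_of_real (xi * \<bar>xi\<bar> powr (a + 1)) * (LINT eta|lborel. complex_of_real (gamma_ker k eta) * u_hat t (xi, eta))
      + \<i> * xi * (LINT eta|lborel. complex_of_real (gamma_ker (k + 2) eta) * u_hat t (xi, eta)) - \<i> * complex_of_real (xi / 2) * (LINT eta|lborel. complex_of_real (gamma_ker k eta) * usq_hat t (xi, eta))"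
    by (simp only: Bochner_Integration.integral_add Bochner_Integration.integral_diff Bochner_Integration.integrable_add
        integrable_mult_right i1 i2 integral_mult_right_zero)
  finally show ?thesis
    using t by (simp add: ptrans_eq_gamma_ker_fourier2 u_integrable u_sq_integrable)
qed

text \<open>Fubini exchanges the test in eta with the integral in time; the majorant on the strip
  between the two times is \<open>gamma_ker k\<close> times C1 + C2 eta^2.\<close>

lemma ptrans_diff_integral:
  assumes t: "0 \<le> t'" "t' \<le> t" "t \<le> T"
  shows "ptrans k (u t) xi - ptrans k (u t') xi = integral {t'..t} (\<lambda>\<tau>. - \<i> * complex_of_real (xi * \<bar>xi\<bar> powr (a + 1)) * ptrans k (u \<tau>) xi
    + \<i> * xi * ptrans (k + 2) (u \<tau>) xi - \<i> * complex_of_real (xi / 2) * ptrans_sq k (u \<tau>) xi)"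
proof -
  have ti: "{t'..t} \<subseteq> {0..T}" "t \<in> {0..T}" "t' \<in> {0..T}" using t by auto
  have sq: "(LINT x|lborel. indicator {t'..t} x *\<^sub>R rhs x q) = u_hat t q - u_hat t' q" for q
    using set_integral_Icc_continuous[OF continuous_on_rhs_time[OF ti(1)], of q] u_hat_diff[OF t, of q] by simp
  define P where "P eta x = complex_of_real (gamma_ker k eta) * (indicator {t'..t} x *\<^sub>R rhs x (xi, eta))" for eta x
  define C1 where "C1 = (\<bar>xi\<bar> * \<bar>xi\<bar> powr (a + 1)) * (2 * energy_bound) + \<bar>xi\<bar> / 2 * Znorm_bound"
  define C2 where "C2 = \<bar>xi\<bar> * (2 * energy_bound)"
  \<comment> \<open>Measurability on the product comes from joint continuity on a closed strip,
    extended by zero.\<close>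
  have P_meas: "(\<lambda>(eta, x). P eta x) \<in> borel_measurable (lborel \<Otimes>\<^sub>M lborel)"
  proof -
    have "continuous_on (UNIV \<times> {t'..t}) (\<lambda>z. rhs (snd z) (xi, fst z))"
    proof -
      have 1: "continuous_on (UNIV \<times> {t'..t}) (\<lambda>z :: real \<times> real. (snd z, (xi, fst z)))"
        by (intro continuous_on_Pair continuous_on_snd continuous_on_fst continuous_on_id continuous_on_const)
      have 2: "(snd z, (xi, fst z)) \<in> {0..T} \<times> UNIV" if "z \<in> UNIV \<times> {t'..t}" for z :: "real \<times> real"
        using that ti(1) by (auto simp: subset_iff)
      show ?thesis
        by (rule continuous_on_compose2[OF continuous_on_rhs 1, unfolded fst_conv snd_conv]) (use 2 in blast)
    qed
    then have 1: "(\<lambda>z. indicator (UNIV \<times> {t'..t}) z *\<^sub>R rhs (snd z) (xi, fst z)) \<in> borel_measurable borel"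
      by (rule borel_measurable_continuous_on_indicator[OF borel_closed[OF closed_Times[OF closed_UNIV closed_atLeastAtMost]]])
    have 2: "(\<lambda>z :: real \<times> real. complex_of_real (gamma_ker k (fst z))) \<in> borel_measurable borel"
      by measurable
    have "complex_of_real (gamma_ker k (fst z)) * (indicator (UNIV \<times> {t'..t}) z *\<^sub>R rhs (snd z) (xi, fst z)) = (\<lambda>(eta, x). P eta x) z" for z
      by (cases z) (simp add: P_def indicator_def)
    with borel_measurable_times[OF 2 1] show ?thesis by (simp add: lborel_prod)
  qed
  have int: "integrable (lborel \<Otimes>\<^sub>M lborel) (\<lambda>(eta, x). P eta x)"
  proof (rule Bochner_Integration.integrable_bound[OF _ P_meas])
    have "integrable lborel (\<lambda>p. (gamma_ker k (fst p) * C1 + gamma_ker (k + 2) (fst p) * C2) * indicator {t'..t} (snd p))"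
    proof (rule integrable_tensor)
      show "integrable lborel (\<lambda>x. gamma_ker k x * C1 + gamma_ker (k + 2) x * C2)"
        by (intro Bochner_Integration.integrable_add integrable_mult_left integrable_gamma_ker)
      show "integrable lborel (indicator {t'..t} :: real \<Rightarrow> real)"
        by (intro integrable_real_indicator) (auto simp: emeasure_lborel_Icc_eq)
    qed
    then show "integrable (lborel \<Otimes>\<^sub>M lborel) (\<lambda>p. (gamma_ker k (fst p) * C1 + gamma_ker (k + 2) (fst p) * C2) * indicator {t'..t} (snd p))"
      by (simp add: lborel_prod)
    show "AE p in lborel \<Otimes>\<^sub>M lborel. norm (case p of (eta, x) \<Rightarrow> P eta x) \<le> norm ((gamma_ker k (fst p) * C1 + gamma_ker (k + 2) (fst p) * C2) * indicator {t'..t} (snd p))"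
    proof (intro AE_I2)
      fix p :: "real \<times> real"
      obtain eta x where p: "p = (eta, x)" by (cases p)
      show "norm (case p of (eta, x) \<Rightarrow> P eta x) \<le> norm ((gamma_ker k (fst p) * C1 + gamma_ker (k + 2) (fst p) * C2) * indicator {t'..t} (snd p))"
      proof (cases "x \<in> {t'..t}")
        case True
        then have "gamma_ker k eta * cmod (rhs x (xi, eta)) \<le> gamma_ker k eta * (C1 + C2 * eta\<^sup>2)"
          using ti norm_rhs_le[of x xi eta] by (intro mult_left_mono gamma_ker_nonneg) (auto simp: C1_def C2_def)
        also have "\<dots> = gamma_ker k eta * C1 + gamma_ker (k + 2) eta * C2"
        proof -
          have "gamma_ker (k + 2) eta = gamma_ker k eta * eta\<^sup>2" by (rule gamma_ker_mult[symmetric])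
          then show ?thesis by (simp only: distrib_left mult_ac)
        qed
        finally show ?thesis
          using True by (simp add: p P_def norm_mult abs_of_nonneg[OF gamma_ker_nonneg])
      qed (simp add: p P_def)
    qed
  qed
  have "ptrans k (u t) xi - ptrans k (u t') xi = (LINT eta|lborel. complex_of_real (gamma_ker k eta) * (u_hat t (xi, eta) - u_hat t' (xi, eta)))"
  proof -
    have "integrable lborel (\<lambda>eta. complex_of_real (gamma_ker k eta) * u_hat t (xi, eta))" if t: "t \<in> {0..T}" for t
    proof (rule Bochner_Integration.integrable_bound[OF integrable_mult_left[of "2 * energy_bound", OF integrable_gamma_ker[of k]]])
      show "AE x in lborel. norm (complex_of_real (gamma_ker k x) * u_hat t (xi, x)) \<le> norm (gamma_ker k x * (2 * energy_bound))"
        using norm_u_hat_le[OF t] energy_bound_nonneg[OF t] by (auto simp: norm_mult abs_mult intro!: AE_I2 mult_left_mono)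
      have "(\<lambda>x::real. u_hat t (xi, x)) \<in> borel_measurable borel"
        by (intro measurable_compose[OF _ u_hat_measurable[OF t]] borel_measurable_continuous_onI continuous_intros)
      then show "(\<lambda>eta. complex_of_real (gamma_ker k eta) * u_hat t (xi, eta)) \<in> borel_measurable lborel" by simp
    qed
    then show ?thesis
      using ti by (simp add: ptrans_eq_gamma_ker_fourier2 u_integrable right_diff_distrib)
  qed
  also have "\<dots> = (LINT eta|lborel. LINT x|lborel. P eta x)"
    by (simp only: P_def integral_mult_right_zero sq)
  also have "\<dots> = (LINT x|lborel. LINT eta|lborel. P eta x)"
    using lborel_pair.Fubini_integral[OF int] by simp
  also have "\<dots> = (LINT x|lborel. indicator {t'..t} x *\<^sub>R (- \<i> * complex_of_real (xi * \<bar>xi\<bar> powr (a + 1)) * ptrans k (u x) xi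
    + \<i> * xi * ptrans (k + 2) (u x) xi - \<i> * complex_of_real (xi / 2) * ptrans_sq k (u x) xi))"
  proof (intro Bochner_Integration.integral_cong refl)
    fix x
    show "(LINT eta|lborel. P eta x) = indicator {t'..t} x *\<^sub>R (- \<i> * complex_of_real (xi * \<bar>xi\<bar> powr (a + 1)) * ptrans k (u x) xi
      + \<i> * xi * ptrans (k + 2) (u x) xi - \<i> * complex_of_real (xi / 2) * ptrans_sq k (u x) xi)"
    proof (cases "x \<in> {t'..t}")
      case True
      then show ?thesis using gamma_ker_rhs_integral[of x k xi] ti by (simp add: P_def subset_iff)
    qed (simp add: P_def)
  qed
  also have "\<dots> = integral {t'..t} (\<lambda>\<tau>. - \<i> * complex_of_real (xi * \<bar>xi\<bar> powr (a + 1)) * ptrans k (u \<tau>) xi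
    + \<i> * xi * ptrans (k + 2) (u \<tau>) xi - \<i> * complex_of_real (xi / 2) * ptrans_sq k (u \<tau>) xi)"
    by (intro set_integral_Icc_continuous[symmetric] continuous_intros continuous_on_subset[OF continuous_on_ptrans ti(1)] continuous_on_subset[OF continuous_on_ptrans_sq ti(1)])
  finally show ?thesis .
qed

section \<open>Time-integrated transforms\<close>

definition int_ptrans :: "nat \<Rightarrow> real \<Rightarrow> real \<Rightarrow> real \<Rightarrow> complex" where
  "int_ptrans k p q xi = integral {p..q} (\<lambda>\<tau>. ptrans k (u \<tau>) xi)"

definition int_ptrans_sq :: "nat \<Rightarrow> real \<Rightarrow> real \<Rightarrow> real \<Rightarrow> complex" where
  "int_ptrans_sq k p q xi = integral {p..q} (\<lambda>\<tau>. ptrans_sq k (u \<tau>) xi)"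

lemma ptrans_integrable_on: "0 \<le> p \<Longrightarrow> q \<le> T \<Longrightarrow> (\<lambda>\<tau>. ptrans k (u \<tau>) xi) integrable_on {p..q}"
  by (intro integrable_continuous_real continuous_on_subset[OF continuous_on_ptrans]) auto

lemma ptrans_sq_integrable_on: "0 \<le> p \<Longrightarrow> q \<le> T \<Longrightarrow> (\<lambda>\<tau>. ptrans_sq k (u \<tau>) xi) integrable_on {p..q}"
  by (intro integrable_continuous_real continuous_on_subset[OF continuous_on_ptrans_sq]) auto

lemma ptrans_diff_eq:
  assumes "0 \<le> p" "p \<le> q" "q \<le> T"
  shows "ptrans k (u q) xi - ptrans k (u p) xi = - \<i> * (complex_of_real (xi * \<bar>xi\<bar> powr (a + 1)) * int_ptrans k p q xi)
    + \<i> * (of_real xi * int_ptrans (k + 2) p q xi) + (- \<i> / 2) * (of_real xi * int_ptrans_sq k p q xi)"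
proof -
  have "((\<lambda>\<tau>. - \<i> * complex_of_real (xi * \<bar>xi\<bar> powr (a + 1)) * ptrans k (u \<tau>) xi
    + \<i> * xi * ptrans (k + 2) (u \<tau>) xi - \<i> * complex_of_real (xi / 2) * ptrans_sq k (u \<tau>) xi) has_integral
    (- \<i> * complex_of_real (xi * \<bar>xi\<bar> powr (a + 1)) * int_ptrans k p q xi + \<i> * xi * int_ptrans (k + 2) p q xi - \<i> * complex_of_real (xi / 2) * int_ptrans_sq k p q xi)) {p..q}"
    unfolding int_ptrans_def int_ptrans_sq_def
    by (intro has_integral_add has_integral_diff has_integral_mult_right integrable_integral ptrans_integrable_on ptrans_sq_integrable_on assms)
  from integral_unique[OF this] show ?thesis
    unfolding ptrans_diff_integral[OF assms] by simp
qed

end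

section \<open>Vanishing of the leading singular coefficients\<close>

lemma dil_diff3_diff: "dil_diff3 (\<lambda>x. f x - g x) x = dil_diff3 f x - dil_diff3 g x"
  by (simp add: dil_diff3_def algebra_simps)
lemma dil_diff2_diff: "dil_diff2 (\<lambda>x. f x - g x) x = dil_diff2 f x - dil_diff2 g x"
  by (simp add: dil_diff2_def algebra_simps)
lemma dil_diff3_lin3: "dil_diff3 (\<lambda>x. c1 * A x + c2 * B x + c3 * C x) x = c1 * dil_diff3 A x + c2 * dil_diff3 B x + c3 * dil_diff3 C x"
  by (simp add: dil_diff3_def algebra_simps)
lemma dil_diff2_lin3: "dil_diff2 (\<lambda>x. c1 * A x + c2 * B x + c3 * C x) x = c1 * dil_diff2 A x + c2 * dil_diff2 B x + c3 * dil_diff2 C x"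
  by (simp add: dil_diff2_def algebra_simps)
lemma lin3_divide: "c1 * (A / z) + c2 * (B / z) + c3 * (C / z) = (c1 * A + c2 * B + c3 * C) / (z :: complex)"
  by (simp add: add_divide_distrib)
lemma dil_diff2_eq_dil_diff1: "dil_diff2 f x = dil_diff1 f (2 * x) - 4 * dil_diff1 f x"
  by (simp add: dil_diff1_def dil_diff2_def algebra_simps)

lemma tendsto_powr_at_right_0: "e > 0 \<Longrightarrow> ((\<lambda>x. C * x powr e) \<longlongrightarrow> (0::real)) (at_right 0)"
proof -
  assume "e > 0"
  have "((\<lambda>x::real. x powr e) \<longlongrightarrow> 0 powr e) (at_right 0)"
    using \<open>e > 0\<close> by (intro tendsto_powr' tendsto_ident_at tendsto_const) (auto simp: eventually_at intro!: exI[of _ 1])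
  from tendsto_mult_left[OF this, of C] show ?thesis by simp
qed

text \<open>By \<open>dil_diff3_shift\<close> the third difference of x f costs only second
  differences of f and gains a factor x, so O(x^r) becomes o(x^p) as soon as r + 1 > p. The bound is
  used at x and at 2 x, hence the range x <= d / 2.\<close>

lemma tendsto_dil_diff3_shift:
  fixes f :: "real \<Rightarrow> complex"
  assumes le: "\<And>x. 0 < x \<Longrightarrow> x \<le> d \<Longrightarrow> cmod (dil_diff2 f x) \<le> C * x powr r" and d: "d > 0" and r: "r + 1 > p"
  shows "((\<lambda>x. dil_diff3 (\<lambda>x. of_real x * f x) x / of_real (x powr p)) \<longlongrightarrow> 0) (at_right 0)"
proof (rule Lim_null_comparison)
  have "0 \<le> C * d powr r" using le[of d] d by (meson norm_ge_zero order_trans order_refl)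
  then have C: "0 \<le> C" using d by (simp add: zero_le_mult_iff)
  define C' where "C' = 8 * (2 * (C * 2 powr r) + C)"
  show "((\<lambda>x. C' * x powr (r + 1 - p)) \<longlongrightarrow> 0) (at_right 0)"
    using r by (intro tendsto_powr_at_right_0) simp
  have "norm (dil_diff3 (\<lambda>x. of_real x * f x) x / of_real (x powr p)) \<le> C' * x powr (r + 1 - p)" if x: "0 < x" "x \<le> d / 2" for x
  proof -
    have "cmod (2 * dil_diff2 f (2 * x) - dil_diff2 f x) \<le> 2 * (C * (2 * x) powr r) + C * x powr r"
      using x by (intro norm_diff_le norm_mult_numeral_le le) auto
    also have "\<dots> = (2 * (C * 2 powr r) + C) * x powr r"
      using x by (simp add: powr_mult algebra_simps)
    finally have "8 * x * cmod (2 * dil_diff2 f (2 * x) - dil_diff2 f x) \<le> 8 * x * ((2 * (C * 2 powr r) + C) * x powr r)"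
      using x by (intro mult_left_mono) auto
    then have "norm (dil_diff3 (\<lambda>x. of_real x * f x) x) \<le> 8 * x * ((2 * (C * 2 powr r) + C) * x powr r)"
      unfolding dil_diff3_shift using x by (simp add: norm_mult)
    also have "\<dots> = C' * x powr (r + 1 - p) * x powr p"
    proof -
      have "x * x powr r = x powr (r + 1 - p) * x powr p"
        using x powr_add[of x "r + 1 - p" p] powr_add[of x r 1] by (simp add: mult_ac)
      moreover have "8 * x * ((2 * (C * 2 powr r) + C) * x powr r) = C' * (x * x powr r)"
        by (simp add: C'_def)
      ultimately show ?thesis by simp
    qed
    finally show ?thesis
      using x by (simp add: norm_divide pos_divide_le_eq)
  qed
  then show "\<forall>\<^sub>F x in at_right 0. norm (dil_diff3 (\<lambda>x. of_real x * f x) x / of_real (x powr p)) \<le> C' * x powr (r + 1 - p)"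
    using d by (auto simp: eventually_at intro!: exI[of _ "d / 2"])
qed

lemma dil_diff2_le_powr:
  fixes f :: "real \<Rightarrow> complex"
  assumes le: "\<And>x. x > 0 \<Longrightarrow> cmod (f x) \<le> C * x powr r" and x: "x > 0"
  shows "cmod (dil_diff2 f x) \<le> (8 powr r + 7 * 4 powr r + 14 * 2 powr r + 8) * C * x powr r"
proof -
  have "cmod (dil_diff2 f x) \<le> C * (8 * x) powr r + 7 * (C * (4 * x) powr r) + 14 * (C * (2 * x) powr r) + 8 * (C * x powr r)"
    unfolding dil_diff2_def using x by (intro norm_diff_le norm_add_le norm_mult_numeral_le le) auto
  also have "\<dots> = (8 powr r + 7 * 4 powr r + 14 * 2 powr r + 8) * C * x powr r"
    using x by (simp add: powr_mult algebra_simps)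
  finally show ?thesis .
qed

context zk_solution
begin

section \<open>Expansions integrated between two times\<close>

context
  fixes p q :: real
  assumes p: "0 \<le> p" and pq: "p \<le> q" and q: "q \<le> T"
begin

lemma sub: "{p..q} \<subseteq> {0..T}" using p q by auto

lemma int_ptrans_has_integral: "((\<lambda>\<tau>. ptrans k (u \<tau>) xi) has_integral int_ptrans k p q xi) {p..q}"
  unfolding int_ptrans_def by (intro integrable_integral ptrans_integrable_on p q)

lemma int_ptrans_sq_has_integral: "((\<lambda>\<tau>. ptrans_sq k (u \<tau>) xi) has_integral int_ptrans_sq k p q xi) {p..q}"
  unfolding int_ptrans_sq_def by (intro integrable_integral ptrans_sq_integrable_on p q)

lemma dil_diff1_int_ptrans: "((\<lambda>\<tau>. dil_diff1 (ptrans k (u \<tau>)) xi) has_integral dil_diff1 (int_ptrans k p q) xi) {p..q}"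
  unfolding dil_diff1_def by (intro has_integral_add has_integral_diff has_integral_mult_right int_ptrans_has_integral)

lemma dil_diff2_int_ptrans: "((\<lambda>\<tau>. dil_diff2 (ptrans k (u \<tau>)) xi) has_integral dil_diff2 (int_ptrans k p q) xi) {p..q}"
  unfolding dil_diff2_def by (intro has_integral_add has_integral_diff has_integral_mult_right int_ptrans_has_integral)

lemma dil_diff1_int_ptrans_sq: "((\<lambda>\<tau>. dil_diff1 (ptrans_sq k (u \<tau>)) xi) has_integral dil_diff1 (int_ptrans_sq k p q) xi) {p..q}"
  unfolding dil_diff1_def by (intro has_integral_add has_integral_diff has_integral_mult_right int_ptrans_sq_has_integral)

lemma dil_diff2_int_ptrans_sq: "((\<lambda>\<tau>. dil_diff2 (ptrans_sq k (u \<tau>)) xi) has_integral dil_diff2 (int_ptrans_sq k p q) xi) {p..q}"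
  unfolding dil_diff2_def by (intro has_integral_add has_integral_diff has_integral_mult_right int_ptrans_sq_has_integral)

lemma has_integral_norm_le:
  assumes "(f has_integral I) {p..q}" "\<And>t. t \<in> {p..q} \<Longrightarrow> norm (f t) \<le> B"
  shows "norm (I :: complex) \<le> B * (q - p)"
proof -
  have "0 \<le> B" using assms(2)[of p] pq by (auto intro: order_trans[OF norm_ge_zero])
  from has_integral_bound_real[OF this finite.emptyI assms(1)] assms(2) pq show ?thesis by auto
qed

lemma CS0: "0 \<le> energy_bound" and CZ0: "0 \<le> Znorm_bound"
  using energy_bound_nonneg[of p] Znorm_bound_nonneg[of p] p pq q by auto

lemma dil_diff1_int_ptrans_le: "cmod (dil_diff1 (int_ptrans k p q) xi) \<le> 45 * fact k * energy_bound * xi\<^sup>2 * (q - p)"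
proof (rule has_integral_norm_le[OF dil_diff1_int_ptrans])
  fix t assume "t \<in> {p..q}"
  then have t: "t \<in> {0..T}" using sub by auto
  have "45 * fact k * sqrt (energy r1 r2 (u t) * rho_mass) * xi\<^sup>2 \<le> 45 * fact k * energy_bound * xi\<^sup>2"
    by (intro mult_right_mono mult_left_mono energy_bound t) auto
  then show "cmod (dil_diff1 (ptrans k (u t)) xi) \<le> 45 * fact k * energy_bound * xi\<^sup>2"
    using dil_diff1_ptrans_le[OF w_u[OF t] r1, of k xi] by linarith
qed

text \<open>Treated as a combination of two first differences, which gains only xi^2: a kernel of
  growth |x|^3 would exceed what r1 > 3 admits for the linear transform. The constant is 360 = 45 *
  (2^2 + 4).\<close>

lemma dil_diff2_int_ptrans_le: "cmod (dil_diff2 (int_ptrans k p q) xi) \<le> 360 * fact k * energy_bound * (q - p) * xi\<^sup>2"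
proof -
  have "cmod (dil_diff2 (int_ptrans k p q) xi) \<le> 45 * fact k * energy_bound * (2 * xi)\<^sup>2 * (q - p) + 4 * (45 * fact k * energy_bound * xi\<^sup>2 * (q - p))"
    unfolding dil_diff2_eq_dil_diff1 by (intro norm_diff_le norm_mult_numeral_le dil_diff1_int_ptrans_le)
  then show ?thesis by (simp add: power_mult_distrib algebra_simps)
qed

lemma dil_diff1_int_ptrans_sq_le: "cmod (dil_diff1 (int_ptrans_sq k p q) xi) \<le> 15 * fact k * Znorm_bound * xi\<^sup>2 * (q - p)"
proof (rule has_integral_norm_le[OF dil_diff1_int_ptrans_sq])
  fix t assume "t \<in> {p..q}"
  then have t: "t \<in> {0..T}" using sub by auto
  have "15 * fact k * energy r1 r2 (u t) * xi\<^sup>2 \<le> 15 * fact k * Znorm_bound * xi\<^sup>2"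
    by (intro mult_right_mono mult_left_mono energy_u_le t) auto
  then show "cmod (dil_diff1 (ptrans_sq k (u t)) xi) \<le> 15 * fact k * Znorm_bound * xi\<^sup>2"
    using dil_diff1_ptrans_sq_le[OF w_u[OF t] r1, of k xi] by linarith
qed

lemma dil_diff2_int_ptrans_sq_le: "cmod (dil_diff2 (int_ptrans_sq k p q) xi) \<le> 180 * fact k * Znorm_bound * \<bar>xi\<bar> ^ 3 * (q - p)"
proof (rule has_integral_norm_le[OF dil_diff2_int_ptrans_sq])
  fix t assume "t \<in> {p..q}"
  then have t: "t \<in> {0..T}" using sub by auto
  have "180 * fact k * energy r1 r2 (u t) * \<bar>xi\<bar> ^ 3 \<le> 180 * fact k * Znorm_bound * \<bar>xi\<bar> ^ 3"
    by (intro mult_right_mono mult_left_mono energy_u_le t) auto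
  then show "cmod (dil_diff2 (ptrans_sq k (u t)) xi) \<le> 180 * fact k * Znorm_bound * \<bar>xi\<bar> ^ 3"
    using dil_diff2_ptrans_sq_le[OF w_u[OF t] r1, of k xi] by linarith
qed

lemma int_ptrans_diff_le: "cmod (int_ptrans k p q xi - int_ptrans k p q 0) \<le> 3 * fact k * energy_bound * \<bar>xi\<bar> * (q - p)"
proof (rule has_integral_norm_le[OF has_integral_diff[OF int_ptrans_has_integral int_ptrans_has_integral]])
  fix t assume "t \<in> {p..q}"
  then have t: "t \<in> {0..T}" using sub by auto
  have "3 * fact k * sqrt (energy r1 r2 (u t) * rho_mass) * \<bar>xi\<bar> \<le> 3 * fact k * energy_bound * \<bar>xi\<bar>"
    by (intro mult_right_mono mult_left_mono energy_bound t) auto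
  then show "cmod (ptrans k (u t) xi - ptrans k (u t) 0) \<le> 3 * fact k * energy_bound * \<bar>xi\<bar>"
    using ptrans_diff_le[OF w_u[OF t] r1, of k xi] by linarith
qed

lemma int_ptrans_sq_diff_le: "cmod (int_ptrans_sq k p q xi - int_ptrans_sq k p q 0) \<le> 2 * fact k * Znorm_bound * \<bar>xi\<bar> * (q - p)"
proof (rule has_integral_norm_le[OF has_integral_diff[OF int_ptrans_sq_has_integral int_ptrans_sq_has_integral]])
  fix t assume "t \<in> {p..q}"
  then have t: "t \<in> {0..T}" using sub by auto
  have "2 * fact k * energy r1 r2 (u t) * \<bar>xi\<bar> \<le> 2 * fact k * Znorm_bound * \<bar>xi\<bar>"
    by (intro mult_right_mono mult_left_mono energy_u_le t) auto
  then show "cmod (ptrans_sq k (u t) xi - ptrans_sq k (u t) 0) \<le> 2 * fact k * Znorm_bound * \<bar>xi\<bar>"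
    using ptrans_sq_diff_le[OF w_u[OF t] r1, of k xi] by linarith
qed

lemma tendsto_abs_at_right_0: "((\<lambda>x::real. C * \<bar>x\<bar> * D) \<longlongrightarrow> 0) (at_right 0)"
  by (auto intro!: tendsto_eq_intros)

lemma tendsto_int_ptrans: "(int_ptrans k p q \<longlongrightarrow> int_ptrans k p q 0) (at_right 0)"
  by (rule LIM_zero_cancel, rule Lim_null_comparison[OF _ tendsto_abs_at_right_0[of "3 * fact k * energy_bound" "q - p"]])
    (intro always_eventually allI int_ptrans_diff_le)

lemma tendsto_int_ptrans_sq: "(int_ptrans_sq k p q \<longlongrightarrow> int_ptrans_sq k p q 0) (at_right 0)"
  by (rule LIM_zero_cancel, rule Lim_null_comparison[OF _ tendsto_abs_at_right_0[of "2 * fact k * Znorm_bound" "q - p"]])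
    (intro always_eventually allI int_ptrans_sq_diff_le)

text \<open>Every term of the tested equation carries a factor xi, so the value at xi = 0 is
  conserved.\<close>

lemma ptrans_0_const: "ptrans k (u q) 0 = ptrans k (u p) 0"
  using ptrans_diff_eq[OF p pq q, of k 0] by simp

lemma ptrans_diff_fun: "(\<lambda>xi. ptrans k (u q) xi - ptrans k (u p) xi) = (\<lambda>xi. - \<i> * (complex_of_real (xi * \<bar>xi\<bar> powr (a + 1)) * int_ptrans k p q xi)
    + \<i> * (of_real xi * int_ptrans (k + 2) p q xi) + (- \<i> / 2) * (of_real xi * int_ptrans_sq k p q xi))"
  by (rule ext) (rule ptrans_diff_eq[OF p pq q])

lemma dil_diff3_ptrans_diff: "dil_diff3 (ptrans k (u q)) xi - dil_diff3 (ptrans k (u p)) xi = - \<i> * dil_diff3 (\<lambda>xi. complex_of_real (xi * \<bar>xi\<bar> powr (a + 1)) * int_ptrans k p q xi) xi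
    + \<i> * dil_diff3 (\<lambda>xi. of_real xi * int_ptrans (k + 2) p q xi) xi + (- \<i> / 2) * dil_diff3 (\<lambda>xi. of_real xi * int_ptrans_sq k p q xi) xi"
  unfolding dil_diff3_diff[symmetric] ptrans_diff_fun dil_diff3_lin3 ..

lemma dil_diff2_ptrans_diff: "dil_diff2 (ptrans k (u q)) xi - dil_diff2 (ptrans k (u p)) xi = - \<i> * dil_diff2 (\<lambda>xi. complex_of_real (xi * \<bar>xi\<bar> powr (a + 1)) * int_ptrans k p q xi) xi
    + \<i> * dil_diff2 (\<lambda>xi. of_real xi * int_ptrans (k + 2) p q xi) xi + (- \<i> / 2) * dil_diff2 (\<lambda>xi. of_real xi * int_ptrans_sq k p q xi) xi"
  unfolding dil_diff2_diff[symmetric] ptrans_diff_fun dil_diff2_lin3 ..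

lemma pos_powr: "xi > 0 \<Longrightarrow> xi * \<bar>xi\<bar> powr (a + 1) = xi powr (2 + a)"
  using powr_add[of xi "a + 1" 1] by (simp add: add.commute mult.commute)

text \<open>The mechanism behind both vanishing results. After \<open>dil_diff3\<close> the left
  side of the equation is o(xi^e) by decay at the two end times, the F_{k+2} term because r + 1 > e,
  and the Q_k term because its second difference is cubic and 4 > e. The dispersive term contributes
  c l with c nonzero, which forces l = 0. The exponent is 2 + a as long as F_k(., 0) is unknown and
  3 + a once it vanishes.\<close>

lemma leading_coefficient_zero:
  assumes wp: "weighted_L2 (7/2 + a) r2 (u p)" and wq: "weighted_L2 (7/2 + a) r2 (u q)"
    and e: "e \<in> {2 + a, 3 + a}"
    and lim: "((\<lambda>xi. complex_of_real (xi * \<bar>xi\<bar> powr (a + 1)) * int_ptrans k p q xi / of_real (xi powr e)) \<longlongrightarrow> l) (at_right 0)"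
    and le: "\<And>x. 0 < x \<Longrightarrow> x \<le> d \<Longrightarrow> cmod (dil_diff2 (int_ptrans (k + 2) p q) x) \<le> C * x powr r" and d: "d > 0" and r: "r + 1 > e"
  shows "l = 0"
proof -
  define X where "X = (2::real) powr e"
  define c where "c = (X - 1) * (X - 2) * (X - 4) * (X - 8)"
  \<comment> \<open>Decay at the end times gives the order 3 + a; the order 2 + a follows after
    multiplication by xi.\<close>
  have small: "((\<lambda>xi. dil_diff3 (ptrans k f) xi / of_real (xi powr e)) \<longlongrightarrow> 0) (at_right 0)" if w: "weighted_L2 (7/2 + a) r2 f" for f
  proof -
    have "((\<lambda>xi. complex_of_real (1 * xi powr 1)) \<longlongrightarrow> of_real 0) (at_right 0)"
      by (intro tendsto_of_real tendsto_powr_at_right_0) simp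
    then have x0: "((\<lambda>xi. complex_of_real xi) \<longlongrightarrow> 0) (at_right 0)"
      by (rule Lim_transform_eventually[THEN iffD1[OF arg_cong[where f = "\<lambda>z. (_ \<longlongrightarrow> z) _", OF of_real_0]]])
        (auto simp: eventually_at intro!: exI[of _ 1])
    have "((\<lambda>xi. dil_diff3 (ptrans k f) xi / of_real (xi powr (3 + a))) \<longlongrightarrow> 0) (at_right 0)"
      by (rule tendsto_dil_diff3_ptrans[OF w a0 a1])
    moreover have "((\<lambda>xi. dil_diff3 (ptrans k f) xi / of_real (xi powr (2 + a))) \<longlongrightarrow> 0) (at_right 0)"
    proof (rule Lim_transform_eventually)
      show "((\<lambda>xi. dil_diff3 (ptrans k f) xi / of_real (xi powr (3 + a)) * of_real xi) \<longlongrightarrow> 0) (at_right 0)"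
        using tendsto_mult[OF calculation x0] by simp
      have "dil_diff3 (ptrans k f) xi / of_real (xi powr (3 + a)) * of_real xi = dil_diff3 (ptrans k f) xi / of_real (xi powr (2 + a))" if "xi > 0" for xi
        using powr_add[of xi "2 + a" 1] that by (simp add: add.commute)
      then show "\<forall>\<^sub>F xi in at_right 0. dil_diff3 (ptrans k f) xi / of_real (xi powr (3 + a)) * of_real xi = dil_diff3 (ptrans k f) xi / of_real (xi powr (2 + a))"
        by (auto simp: eventually_at intro!: exI[of _ 1])
    qed
    ultimately show ?thesis using e by auto
  qed
  have int_ptrans_sq_small: "((\<lambda>xi. dil_diff3 (\<lambda>xi. of_real xi * int_ptrans_sq k p q xi) xi / of_real (xi powr e)) \<longlongrightarrow> 0) (at_right 0)"
  proof (rule tendsto_dil_diff3_shift)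
    show "cmod (dil_diff2 (int_ptrans_sq k p q) x) \<le> (180 * fact k * Znorm_bound * (q - p)) * x powr 3" if "0 < x" "x \<le> 1" for x
      using dil_diff2_int_ptrans_sq_le[of k x] that by (simp add: mult_ac powr_numeral)
    show "3 + 1 > e" using e a1 by auto
  qed simp
  have "((\<lambda>xi. - \<i> * (dil_diff3 (\<lambda>xi. complex_of_real (xi * \<bar>xi\<bar> powr (a + 1)) * int_ptrans k p q xi) xi / of_real (xi powr e))
    + \<i> * (dil_diff3 (\<lambda>xi. of_real xi * int_ptrans (k + 2) p q xi) xi / of_real (xi powr e)) + (- \<i> / 2) * (dil_diff3 (\<lambda>xi. of_real xi * int_ptrans_sq k p q xi) xi / of_real (xi powr e)))
    \<longlongrightarrow> - \<i> * (of_real c * l) + \<i> * 0 + (- \<i> / 2) * 0) (at_right 0)"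
    unfolding c_def X_def
    by (intro tendsto_add tendsto_mult tendsto_const int_ptrans_sq_small tendsto_dil_diff3_shift[OF le d r] tendsto_dil_diff3_div_powr[OF lim])
  moreover have "- \<i> * (dil_diff3 (\<lambda>xi. complex_of_real (xi * \<bar>xi\<bar> powr (a + 1)) * int_ptrans k p q xi) xi / of_real (xi powr e))
    + \<i> * (dil_diff3 (\<lambda>xi. of_real xi * int_ptrans (k + 2) p q xi) xi / of_real (xi powr e)) + (- \<i> / 2) * (dil_diff3 (\<lambda>xi. of_real xi * int_ptrans_sq k p q xi) xi / of_real (xi powr e))
    = dil_diff3 (ptrans k (u q)) xi / of_real (xi powr e) - dil_diff3 (ptrans k (u p)) xi / of_real (xi powr e)" for xi
    unfolding diff_divide_distrib[symmetric] dil_diff3_ptrans_diff by (rule lin3_divide)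
  ultimately have "((\<lambda>xi. dil_diff3 (ptrans k (u q)) xi / of_real (xi powr e) - dil_diff3 (ptrans k (u p)) xi / of_real (xi powr e)) \<longlongrightarrow> - \<i> * (of_real c * l)) (at_right 0)"
    by simp
  moreover have "((\<lambda>xi. dil_diff3 (ptrans k (u q)) xi / of_real (xi powr e) - dil_diff3 (ptrans k (u p)) xi / of_real (xi powr e)) \<longlongrightarrow> 0 - 0) (at_right 0)"
    by (intro tendsto_diff small wp wq)
  ultimately have "- \<i> * (of_real c * l) = 0 - 0"
    by (rule tendsto_unique[OF trivial_limit_at_right_real])
  \<comment> \<open>A zero of c would make 2^e equal to 1, 2, 4 or 8, hence a an integer, against 0
    < a < 1.\<close>
  moreover have "c \<noteq> 0"
  proof -
    have "X \<noteq> 2 powr real n" for n :: nat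
    proof
      assume "X = 2 powr real n"
      then have "e = real n" unfolding X_def by (subst (asm) powr_inj) auto
      then have "a = real n - 2 \<or> a = real n - 3" using e by auto
      then have "a \<in> \<int>" by auto
      then obtain m where "a = of_int m" by (auto elim: Ints_cases)
      then show False using a0 a1 by simp
    qed
    from this[of 0] this[of 1] this[of 2] this[of 3] show ?thesis by (simp add: c_def)
  qed
  ultimately show "l = 0" by simp
qed

end

text \<open>At order xi^{2+a} the coefficient is the time integral of F_k(., 0) over [p, q], which
  is (q - p) F_k(0, 0) by conservation. Conservation also carries the vanishing to all times of
  [0, T], beyond the interval [p, q].\<close>

lemma ptrans_0_eq_0:
  assumes p: "0 \<le> p" and pq: "p < q" and q: "q \<le> T"
    and wp: "weighted_L2 (7/2 + a) r2 (u p)" and wq: "weighted_L2 (7/2 + a) r2 (u q)"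
    and t: "t \<in> {0..T}"
  shows "ptrans k (u t) 0 = 0"
proof -
  have pq': "p \<le> q" using pq by simp
  have const: "ptrans k (u t) 0 = ptrans k (u 0) 0" if "t \<in> {0..T}" for t
    using ptrans_0_const[of 0 t] that by auto
  have "int_ptrans k p q 0 = 0"
  proof (rule leading_coefficient_zero[OF p pq' q wp wq])
    show "((\<lambda>xi. complex_of_real (xi * \<bar>xi\<bar> powr (a + 1)) * int_ptrans k p q xi / complex_of_real (xi powr (2 + a))) \<longlongrightarrow> int_ptrans k p q 0) (at_right 0)"
    proof (rule Lim_transform_eventually[OF tendsto_int_ptrans[OF p pq' q]])
      have "int_ptrans k p q xi = complex_of_real (xi * \<bar>xi\<bar> powr (a + 1)) * int_ptrans k p q xi / complex_of_real (xi powr (2 + a))" if "xi > 0" for xi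
        unfolding pos_powr[OF p pq' q that] using that by simp
      then show "\<forall>\<^sub>F xi in at_right 0. int_ptrans k p q xi = complex_of_real (xi * \<bar>xi\<bar> powr (a + 1)) * int_ptrans k p q xi / complex_of_real (xi powr (2 + a))"
        by (auto simp only: eventually_at intro!: exI[of _ 1])
    qed
    \<comment> \<open>The order r = 2 valid at every time is enough here, since 2 + 1 > 2 +
      a.\<close>
    show "cmod (dil_diff2 (int_ptrans (k + 2) p q) x) \<le> (360 * fact (k + 2) * energy_bound * (q - p)) * x powr 2" if "0 < x" "x \<le> 1" for x
      using dil_diff2_int_ptrans_le[OF p pq' q, of "k + 2" x] that by (simp add: powr_numeral)
  qed (use a1 in auto)
  moreover have "int_ptrans k p q 0 = integral {p..q} (\<lambda>_. ptrans k (u 0) 0)"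
    unfolding int_ptrans_def by (intro integral_cong const) (use p q in auto)
  ultimately have "ptrans k (u 0) 0 = 0" using pq by simp
  then show ?thesis using const[OF t] by simp
qed

text \<open>With F_0(., 0) = 0 the integrated dispersive term is xi^{2+a} times xi M + O(xi^2), so
  its coefficient at xi^{3+a} is the time integral of M. The difficulty is the term xi F_2: its
  second difference must be smaller than xi^{2+a} throughout [p, q], while the strong decay is
  assumed at p and q only.\<close>

lemma first_moment_integral_eq_0:
  assumes p: "0 \<le> p" and pq: "p < q" and q: "q \<le> T"
    and wp: "weighted_L2 (7/2 + a) r2 (u p)" and wq: "weighted_L2 (7/2 + a) r2 (u q)"
  shows "((\<lambda>\<tau>. first_moment (u \<tau>)) has_integral 0) {p..q}"
proof -
  have pq': "p \<le> q" using pq by simp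
  \<comment> \<open>Strictly between a and 1: the order 2 + b beats the required 2 + a and is still
    dominated by the cubic terms below.\<close>
  define b where "b = (1 + a) / 2"
  note F0 = ptrans_0_eq_0[OF p pq q wp wq]
  have CS0: "0 \<le> energy_bound" and CZ0: "0 \<le> Znorm_bound" using CS0[OF p pq' q] CZ0[OF p pq' q] by auto
  have IF0: "int_ptrans k p t 0 = 0" if "p \<le> t" "t \<le> q" for k t
    unfolding int_ptrans_def using integral_cong[of "{p..t}" "\<lambda>\<tau>. ptrans k (u \<tau>) 0" "\<lambda>_. 0"] F0 that p q by simp
  \<comment> \<open>Time p has the order 2 + b by decay, and the equation for F_2 carries it to t.
    The increments are O(x^3) or O(x^{3+a}), because F_2(., 0) = 0 in the dispersive term and the
    other two terms have an explicit factor x.\<close>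
  have ptrans_le: "\<exists>C. \<forall>t\<in>{p..q}. \<forall>x. 0 < x \<and> x \<le> 1 \<longrightarrow> cmod (dil_diff2 (ptrans 2 (u t)) x) \<le> C * x powr (2 + b)"
  proof -
    define L where "L = q - p"
    define C0 where "C0 = 360 * fact 2 * sqrt (energy (7/2 + a) r2 (u p) * rho_mass)"
    define C1 where "C1 = (8 powr (3 + a) + 7 * 4 powr (3 + a) + 14 * 2 powr (3 + a) + 8) * (3 * fact 2 * energy_bound * L)"
    define C2 where "C2 = 36 * (45 * fact (2 + 2) * energy_bound * L)"
    define C3 where "C3 = 36 * (15 * fact 2 * Znorm_bound * L)"
    have "cmod (dil_diff2 (ptrans 2 (u t)) x) \<le> (C0 + C1 + C2 + C3) * x powr (2 + b)" if t: "t \<in> {p..q}" and x: "0 < x" "x \<le> 1" for t x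
    proof -
      have pt: "p \<le> t" and tT: "t \<le> T" using t q by auto
      have L: "0 \<le> t - p" "t - p \<le> L" using t by (auto simp: L_def)
      have x3: "x powr 3 \<le> x powr (2 + b)" "x powr (3 + a) \<le> x powr (2 + b)"
        by (rule powr_mono'; use x a0 a1 in \<open>simp add: b_def\<close>)+
      have i0: "cmod (dil_diff2 (ptrans 2 (u p)) x) \<le> C0 * x powr (2 + b)"
        using dil_diff2_ptrans_powr_le[OF wp a0 a1, of 2 x] x by (simp add: C0_def b_def)
      \<comment> \<open>36 = 4 * 9, where 4 comes from \<open>dil_diff2_shift\<close> and 9 = 2 *
        2^2 + 1 from the differences at 2 x and at x.\<close>
      have shift: "cmod (dil_diff2 (\<lambda>x. of_real x * f x) x) \<le> 36 * (B * L) * x powr (2 + b)"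
        if f: "\<And>x. cmod (dil_diff1 f x) \<le> B * x\<^sup>2 * (t - p)" and B: "0 \<le> B" for f :: "real \<Rightarrow> complex" and B
      proof -
        have "cmod (2 * dil_diff1 f (2 * x) - dil_diff1 f x) \<le> 2 * (B * (2 * x)\<^sup>2 * (t - p)) + B * x\<^sup>2 * (t - p)"
          by (intro norm_diff_le norm_mult_numeral_le f)
        also have "\<dots> = 9 * (B * (t - p)) * x\<^sup>2" by (simp add: power_mult_distrib)
        also have "\<dots> \<le> 9 * (B * L) * x\<^sup>2" using B L by (intro mult_right_mono mult_left_mono) auto
        finally have "4 * x * cmod (2 * dil_diff1 f (2 * x) - dil_diff1 f x) \<le> 4 * x * (9 * (B * L) * x\<^sup>2)"
          using x by (intro mult_left_mono) auto
        also have "\<dots> = 36 * (B * L) * x powr 3" using x by (simp add: powr_numeral power2_eq_square power3_eq_cube)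
        also have "\<dots> \<le> 36 * (B * L) * x powr (2 + b)" using B L by (intro mult_left_mono x3) auto
        finally show ?thesis unfolding dil_diff2_shift using x by (simp add: norm_mult)
      qed
      \<comment> \<open>No cancellation is exploited for this term: \<open>int_ptrans 2 p t\<close>
        vanishes at 0, which supplies the extra power of y, and the triangle inequality does the
        rest.\<close>
      have i1: "cmod (dil_diff2 (\<lambda>xi. complex_of_real (xi * \<bar>xi\<bar> powr (a + 1)) * int_ptrans 2 p t xi) x) \<le> C1 * x powr (2 + b)"
      proof -
        have "cmod (complex_of_real (y * \<bar>y\<bar> powr (a + 1)) * int_ptrans 2 p t y) \<le> (3 * fact 2 * energy_bound * L) * y powr (3 + a)" if y: "y > 0" for y
        proof -
          have "cmod (int_ptrans 2 p t y) \<le> 3 * fact 2 * energy_bound * y * (t - p)"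
            using int_ptrans_diff_le[OF p pt tT, of 2 y] IF0[of t 2] t y by simp
          also have "\<dots> \<le> 3 * fact 2 * energy_bound * y * L"
            using y CS0 L by (intro mult_left_mono) auto
          finally have "y powr (2 + a) * cmod (int_ptrans 2 p t y) \<le> y powr (2 + a) * (3 * fact 2 * energy_bound * y * L)"
            by (intro mult_left_mono) auto
          also have "\<dots> = (3 * fact 2 * energy_bound * L) * y powr (3 + a)"
            using y powr_add[of y "2 + a" 1] by (simp add: add.commute)
          finally show ?thesis unfolding pos_powr[OF p pq' q y] by (simp add: norm_mult)
        qed
        from dil_diff2_le_powr[OF this x(1)] have "cmod (dil_diff2 (\<lambda>xi. complex_of_real (xi * \<bar>xi\<bar> powr (a + 1)) * int_ptrans 2 p t xi) x) \<le> C1 * x powr (3 + a)"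
          by (simp add: C1_def)
        also have "\<dots> \<le> C1 * x powr (2 + b)"
          using CS0 pq' by (intro mult_left_mono x3) (auto simp: C1_def L_def intro!: mult_nonneg_nonneg add_nonneg_nonneg)
        finally show ?thesis .
      qed
      have i2: "cmod (dil_diff2 (\<lambda>x. of_real x * int_ptrans (2 + 2) p t x) x) \<le> C2 * x powr (2 + b)"
        unfolding C2_def by (rule shift[OF dil_diff1_int_ptrans_le[OF p pt tT]]) (use CS0 in auto)
      have i3: "cmod (dil_diff2 (\<lambda>x. of_real x * int_ptrans_sq 2 p t x) x) \<le> C3 * x powr (2 + b)"
        unfolding C3_def by (rule shift[OF dil_diff1_int_ptrans_sq_le[OF p pt tT]]) (use CZ0 in auto)
      have "dil_diff2 (ptrans 2 (u t)) x = dil_diff2 (ptrans 2 (u p)) x + (- \<i> * dil_diff2 (\<lambda>xi. complex_of_real (xi * \<bar>xi\<bar> powr (a + 1)) * int_ptrans 2 p t xi) x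
    + \<i> * dil_diff2 (\<lambda>xi. of_real xi * int_ptrans (2 + 2) p t xi) x + (- \<i> / 2) * dil_diff2 (\<lambda>xi. of_real xi * int_ptrans_sq 2 p t xi) x)"
        using dil_diff2_ptrans_diff[OF p pt tT, of 2 x] by (simp only: diff_eq_eq add.commute)
      also have "cmod \<dots> \<le> C0 * x powr (2 + b) + (C1 * x powr (2 + b) + C2 * x powr (2 + b) + C3 * x powr (2 + b))"
      proof (intro norm_add_le i0)
        have "cmod (- \<i> / 2 * dil_diff2 (\<lambda>xi. of_real xi * int_ptrans_sq 2 p t xi) x) = cmod (dil_diff2 (\<lambda>xi. of_real xi * int_ptrans_sq 2 p t xi) x) / 2"
          by (simp add: norm_mult norm_divide)
        also have "\<dots> \<le> cmod (dil_diff2 (\<lambda>xi. of_real xi * int_ptrans_sq 2 p t xi) x)" by simp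
        finally show "cmod (- \<i> / 2 * dil_diff2 (\<lambda>xi. of_real xi * int_ptrans_sq 2 p t xi) x) \<le> C3 * x powr (2 + b)"
          using i3 by linarith
      qed (use i1 i2 in \<open>simp_all add: norm_mult\<close>)
      finally show ?thesis by (simp add: algebra_simps)
    qed
    then show ?thesis by blast
  qed
  then obtain C where C: "\<And>t x. t \<in> {p..q} \<Longrightarrow> 0 < x \<Longrightarrow> x \<le> 1 \<Longrightarrow> cmod (dil_diff2 (ptrans 2 (u t)) x) \<le> C * x powr (2 + b)"
    by blast
  have MMi: "((\<lambda>\<tau>. first_moment (u \<tau>)) has_integral integral {p..q} (\<lambda>\<tau>. first_moment (u \<tau>))) {p..q}"
    by (intro integrable_integral integrable_continuous_real continuous_on_subset[OF continuous_on_first_moment]) (use p q in auto)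
  have "integral {p..q} (\<lambda>\<tau>. first_moment (u \<tau>)) = 0"
  proof (rule leading_coefficient_zero[OF p pq' q wp wq])
    let ?M = "integral {p..q} (\<lambda>\<tau>. first_moment (u \<tau>))"
    have "cmod (int_ptrans 0 p q xi - xi * ?M) \<le> 3 * energy_bound * xi\<^sup>2 * (q - p)" for xi
    proof (rule has_integral_norm_le[OF p pq' q has_integral_diff[OF int_ptrans_has_integral[OF p pq' q] has_integral_mult_right[OF MMi]]])
      fix t assume t: "t \<in> {p..q}"
      then have t': "t \<in> {0..T}" using p q by auto
      have "3 * sqrt (energy r1 r2 (u t) * rho_mass) * xi\<^sup>2 \<le> 3 * energy_bound * xi\<^sup>2"
        by (intro mult_right_mono mult_left_mono energy_bound t') auto
      then show "cmod (ptrans 0 (u t) xi - of_real xi * first_moment (u t)) \<le> 3 * energy_bound * xi\<^sup>2"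
        using ptrans_Taylor_le[OF w_u[OF t'] r1, of xi] F0[OF t', of 0] by simp
    qed
    then have bd: "cmod (int_ptrans 0 p q xi / xi - ?M) \<le> (3 * energy_bound * (q - p)) * xi powr 1" if "xi > 0" for xi
    proof -
      have "int_ptrans 0 p q xi / xi - ?M = (int_ptrans 0 p q xi - xi * ?M) / xi"
        using that by (simp add: field_simps)
      then show ?thesis
        using \<open>\<And>xi. cmod (int_ptrans 0 p q xi - xi * ?M) \<le> 3 * energy_bound * xi\<^sup>2 * (q - p)\<close>[of xi] that
        by (simp add: norm_divide divide_le_eq power2_eq_square mult_ac)
    qed
    have "((\<lambda>xi. int_ptrans 0 p q xi / xi) \<longlongrightarrow> ?M) (at_right 0)"
      by (rule LIM_zero_cancel, rule Lim_null_comparison[OF _ tendsto_powr_at_right_0[of 1 "3 * energy_bound * (q - p)"]])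
        (use bd in \<open>auto simp: eventually_at intro!: exI[of _ 1]\<close>)
    moreover have "int_ptrans 0 p q xi / xi = complex_of_real (xi * \<bar>xi\<bar> powr (a + 1)) * int_ptrans 0 p q xi / complex_of_real (xi powr (3 + a))" if "xi > 0" for xi
      using that powr_add[of xi "2 + a" 1] unfolding pos_powr[OF p pq' q that] by (simp add: add.commute field_simps)
    ultimately show "((\<lambda>xi. complex_of_real (xi * \<bar>xi\<bar> powr (a + 1)) * int_ptrans 0 p q xi / complex_of_real (xi powr (3 + a))) \<longlongrightarrow> ?M) (at_right 0)"
      by (elim Lim_transform_eventually) (auto simp: eventually_at intro!: exI[of _ 1])
    show "cmod (dil_diff2 (int_ptrans (0 + 2) p q) x) \<le> (C * (q - p)) * x powr (2 + b)" if x: "0 < x" "x \<le> 1" for x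
    proof -
      have "cmod (dil_diff2 (int_ptrans 2 p q) x) \<le> (C * x powr (2 + b)) * (q - p)"
        by (rule has_integral_norm_le[OF p pq' q dil_diff2_int_ptrans[OF p pq' q]]) (use C x in auto)
      then show ?thesis by (simp add: mult_ac numeral_2_eq_2)
    qed
  qed (use a1 in \<open>auto simp: b_def\<close>)
  then show ?thesis using MMi by simp
qed

text \<open>Dividing the equation for F_0 by xi and letting xi tend to 0, the dispersive term keeps
  xi^{a+1} and disappears, F_2(., 0) vanishes, and only the quadratic term survives. This is M' =
  -(i/2) Q_0(., 0) in integrated form.\<close>

lemma first_moment_diff:
  assumes p: "0 \<le> p" and pq: "p \<le> q" and q: "q \<le> T" and F0: "\<And>k t. t \<in> {0..T} \<Longrightarrow> ptrans k (u t) 0 = 0"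
  shows "first_moment (u q) - first_moment (u p) = - \<i> / 2 * int_ptrans_sq 0 p q 0"
proof -
  have M: "((\<lambda>xi. ptrans 0 (u t) xi / xi) \<longlongrightarrow> first_moment (u t)) (at_right 0)" if t: "t \<in> {0..T}" for t
  proof (rule LIM_zero_cancel, rule Lim_null_comparison[OF _ tendsto_powr_at_right_0[of 1 "3 * energy_bound"]])
    have "cmod (ptrans 0 (u t) xi / xi - first_moment (u t)) \<le> 3 * energy_bound * xi powr 1" if xi: "xi > 0" for xi
    proof -
      have "3 * sqrt (energy r1 r2 (u t) * rho_mass) * xi\<^sup>2 \<le> 3 * energy_bound * xi\<^sup>2"
        by (intro mult_right_mono mult_left_mono energy_bound t) auto
      then have "cmod (ptrans 0 (u t) xi - of_real xi * first_moment (u t)) \<le> 3 * energy_bound * xi\<^sup>2"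
        using ptrans_Taylor_le[OF w_u[OF t] r1, of xi] F0[OF t, of 0] by simp
      moreover have "ptrans 0 (u t) xi / xi - first_moment (u t) = (ptrans 0 (u t) xi - xi * first_moment (u t)) / xi"
        using xi by (simp add: field_simps)
      ultimately show ?thesis
        using xi by (simp add: norm_divide divide_le_eq power2_eq_square mult_ac)
    qed
    then show "\<forall>\<^sub>F xi in at_right 0. cmod (ptrans 0 (u t) xi / xi - first_moment (u t)) \<le> 3 * energy_bound * xi powr 1"
      by (auto simp: eventually_at intro!: exI[of _ 1])
  qed simp
  have IF0: "int_ptrans k p q 0 = 0" for k
    unfolding int_ptrans_def using integral_cong[of "{p..q}" "\<lambda>\<tau>. ptrans k (u \<tau>) 0" "\<lambda>_. 0"] F0 p q by simp
  have "((\<lambda>xi. ptrans 0 (u q) xi / xi - ptrans 0 (u p) xi / xi) \<longlongrightarrow> first_moment (u q) - first_moment (u p)) (at_right 0)"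
    by (intro tendsto_diff M) (use p pq q in auto)
  moreover have "((\<lambda>xi. ptrans 0 (u q) xi / xi - ptrans 0 (u p) xi / xi) \<longlongrightarrow> - \<i> * (of_real 0 * int_ptrans 0 p q 0) + \<i> * int_ptrans (0 + 2) p q 0 + (- \<i> / 2) * int_ptrans_sq 0 p q 0) (at_right 0)"
  proof (rule Lim_transform_eventually)
    show "((\<lambda>xi. - \<i> * (of_real (1 * xi powr (a + 1)) * int_ptrans 0 p q xi) + \<i> * int_ptrans (0 + 2) p q xi + (- \<i> / 2) * int_ptrans_sq 0 p q xi)
      \<longlongrightarrow> - \<i> * (of_real 0 * int_ptrans 0 p q 0) + \<i> * int_ptrans (0 + 2) p q 0 + (- \<i> / 2) * int_ptrans_sq 0 p q 0) (at_right 0)"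
      by (intro tendsto_add tendsto_mult tendsto_const tendsto_of_real tendsto_powr_at_right_0 tendsto_int_ptrans[OF p pq q] tendsto_int_ptrans_sq[OF p pq q]) (use a0 in simp)
    have "- \<i> * (of_real (1 * xi powr (a + 1)) * int_ptrans 0 p q xi) + \<i> * int_ptrans (0 + 2) p q xi + (- \<i> / 2) * int_ptrans_sq 0 p q xi = ptrans 0 (u q) xi / xi - ptrans 0 (u p) xi / xi" if "xi > 0" for xi
      unfolding diff_divide_distrib[symmetric] ptrans_diff_eq[OF p pq q] using that by (simp add: field_simps)
    then show "\<forall>\<^sub>F xi in at_right 0. - \<i> * (of_real (1 * xi powr (a + 1)) * int_ptrans 0 p q xi) + \<i> * int_ptrans (0 + 2) p q xi + (- \<i> / 2) * int_ptrans_sq 0 p q xi = ptrans 0 (u q) xi / xi - ptrans 0 (u p) xi / xi"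
      by (auto simp: eventually_at intro!: exI[of _ 1])
  qed
  ultimately have "first_moment (u q) - first_moment (u p) = - \<i> * (of_real 0 * int_ptrans 0 p q 0) + \<i> * int_ptrans (0 + 2) p q 0 + (- \<i> / 2) * int_ptrans_sq 0 p q 0"
    by (rule tendsto_unique[OF trivial_limit_at_right_real])
  then show ?thesis using IF0 by simp
qed

end

section \<open>Uniqueness and conclusion\<close>

text \<open>The inversion formula is inserted for one of the two factors f and the integrals are
  exchanged; (2 pi)^2 is the constant of inversion in the plane.\<close>

lemma fourier2_square:
  assumes f: "integrable lborel f" and fh: "integrable lborel (fourier2 f)"
  shows "fourier2 (\<lambda>p. (f p)\<^sup>2) q = (LINT q'|lborel. fourier2 f q' * fourier2 f (q - q')) / (2 * pi)\<^sup>2"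
proof -
  have [measurable]: "f \<in> borel_measurable borel" using f by auto
  have fc: "integrable lborel (\<lambda>p. complex_of_real (f p))" using f by simp
  note [measurable] = fourier2_measurable[OF f]
  have int: "integrable (lborel \<Otimes>\<^sub>M lborel) (\<lambda>(q', p). fourier2 f q' * complex_of_real (f p) * cis (- (p \<bullet> (q - q'))))"
    using integrable_unimodular_mult[OF integrable_mult_tensor[OF fh fc], of "\<lambda>(q', p). cis (- (p \<bullet> (q - q')))"]
    by (simp add: case_prod_beta')
  have "fourier2 (\<lambda>p. (f p)\<^sup>2) q = (LINT p|lborel. (complex_of_real (f p) * cis (- (p \<bullet> q))) * complex_of_real (f p))"
    unfolding fourier2_inner by (intro Bochner_Integration.integral_cong refl) (simp add: power2_eq_square mult_ac)
  also have "\<dots> = (LINT p|lborel. (complex_of_real (f p) * cis (- (p \<bullet> q))) * ((LINT q'|lborel. fourier2 f q' * cis (p \<bullet> q')) / (2 * pi)\<^sup>2))"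
  proof (rule integral_cong_AE)
    show "AE p in lborel. complex_of_real (f p) * cis (- (p \<bullet> q)) * complex_of_real (f p)
      = complex_of_real (f p) * cis (- (p \<bullet> q)) * ((LINT q'|lborel. fourier2 f q' * cis (p \<bullet> q')) / (2 * pi)\<^sup>2)"
      using fourier_inversion[OF f fh] by eventually_elim simp
  qed measurable
  also have "\<dots> = (LINT p|lborel. LINT q'|lborel. fourier2 f q' * complex_of_real (f p) * cis (- (p \<bullet> (q - q')))) / (2 * pi)\<^sup>2"
  proof -
    have "(complex_of_real (f p) * cis (- (p \<bullet> q))) * ((LINT q'|lborel. fourier2 f q' * cis (p \<bullet> q')) / (2 * pi)\<^sup>2)
      = (LINT q'|lborel. fourier2 f q' * complex_of_real (f p) * cis (- (p \<bullet> (q - q')))) / (2 * pi)\<^sup>2" for p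
    proof -
      have "(LINT q'|lborel. fourier2 f q' * complex_of_real (f p) * cis (- (p \<bullet> (q - q'))))
        = (LINT q'|lborel. (complex_of_real (f p) * cis (- (p \<bullet> q))) * (fourier2 f q' * cis (p \<bullet> q')))"
      proof (intro Bochner_Integration.integral_cong refl)
        fix q'
        have "cis (- (p \<bullet> (q - q'))) = cis (- (p \<bullet> q)) * cis (p \<bullet> q')"
          by (simp add: cis_mult inner_diff_right)
        then show "fourier2 f q' * complex_of_real (f p) * cis (- (p \<bullet> (q - q')))
          = (complex_of_real (f p) * cis (- (p \<bullet> q))) * (fourier2 f q' * cis (p \<bullet> q'))" by simp
      qed
      then show ?thesis by (simp only: integral_mult_right_zero times_divide_eq_right)
    qed
    then show ?thesis by (simp only: integral_divide_zero)
  qed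
  also have "(LINT p|lborel. LINT q'|lborel. fourier2 f q' * complex_of_real (f p) * cis (- (p \<bullet> (q - q'))))
    = (LINT q'|lborel. LINT p|lborel. fourier2 f q' * complex_of_real (f p) * cis (- (p \<bullet> (q - q'))))"
    using lborel_pair.Fubini_integral[OF int] by simp
  also have "\<dots> = (LINT q'|lborel. fourier2 f q' * fourier2 f (q - q'))"
    unfolding fourier2_inner[of f "q - _"] by (simp only: integral_mult_right_zero mult.assoc)
  finally show ?thesis .
qed

context zk_solution
begin

section \<open>Uniform L^1 bounds in frequency and the nonlinear estimate\<close>

definition sobolev_symbol :: "real \<times> real \<Rightarrow> real" where
  "sobolev_symbol q = (1 + (fst q)\<^sup>2) powr ((1 + a) * s) + (1 + (snd q)\<^sup>2) powr (2 * s)"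

lemma u_hat_weighted_integrable:
  assumes t: "t \<in> {0..T}"
  shows "integrable lborel (\<lambda>q. sobolev_symbol q * (cmod (u_hat t q))\<^sup>2)" "(LINT q|lborel. sobolev_symbol q * (cmod (u_hat t q))\<^sup>2) \<le> Znorm_bound"
proof -
  have i: "integrable lborel (\<lambda>q. (1 + (fst q)\<^sup>2) powr ((1 + a) * s) * (cmod (u_hat t q))\<^sup>2)"
    "integrable lborel (\<lambda>q. (1 + (snd q)\<^sup>2) powr (2 * s) * (cmod (u_hat t q))\<^sup>2)"
    using Z_u[OF t] by (simp_all add: Zspace_def aniso_H_def case_prod_beta')
  then show "integrable lborel (\<lambda>q. sobolev_symbol q * (cmod (u_hat t q))\<^sup>2)"
    by (simp add: sobolev_symbol_def distrib_right)
  have "(LINT q|lborel. sobolev_symbol q * (cmod (u_hat t q))\<^sup>2) = (LINT q|lborel. (1 + (fst q)\<^sup>2) powr ((1 + a) * s) * (cmod (u_hat t q))\<^sup>2)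
    + (LINT q|lborel. (1 + (snd q)\<^sup>2) powr (2 * s) * (cmod (u_hat t q))\<^sup>2)"
    using i by (simp add: sobolev_symbol_def distrib_right)
  also have "\<dots> \<le> Znorm_sq a s r1 r2 (u t)"
    using energy_nonneg[of r1 r2 "u t"] by (simp add: Znorm_sq_def energy_def)
  finally show "(LINT q|lborel. sobolev_symbol q * (cmod (u_hat t q))\<^sup>2) \<le> Znorm_bound" using Znorm_bound[OF t] by simp
qed

text \<open>Let X = 1 + xi^2, Y = 1 + eta^2, w = 1 + |xi| and h the modulus of the transform. Both
  Sobolev exponents are at least 4, so the symbol dominates X^4 + Y^4 >= 2 (X Y)^2. Then w h <= (X
  Y)^2 h^2 + w^2 / (4 (X Y)^2), where w^2 <= 4 X Y and 1 / (X Y) is \<open>rho\<close>. Both terms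
  on the right are integrable with bounds uniform in time.\<close>

lemma u_hat_pointwise: "(1 + \<bar>fst q\<bar>) * cmod (u_hat t q) \<le> sobolev_symbol q * (cmod (u_hat t q))\<^sup>2 + rho q"
proof -
  define X where "X = 1 + (fst q)\<^sup>2"
  define Y where "Y = 1 + (snd q)\<^sup>2"
  define h where "h = cmod (u_hat t q)"
  have X: "X \<ge> 1" and Y: "Y \<ge> 1" by (simp_all add: X_def Y_def)
  have "X powr 4 \<le> X powr ((1 + a) * s)"
    using X a0 s4 mult_mono[of 1 "1 + a" 4 s] by (intro powr_mono) auto
  moreover have "Y powr 4 \<le> Y powr (2 * s)"
    using Y s4 by (intro powr_mono) auto
  ultimately have "X ^ 4 + Y ^ 4 \<le> sobolev_symbol q"
    using X Y by (simp add: sobolev_symbol_def X_def Y_def powr_numeral)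
  moreover have "2 * ((X * Y)\<^sup>2) \<le> X ^ 4 + Y ^ 4"
  proof -
    have "0 \<le> (X\<^sup>2 - Y\<^sup>2)\<^sup>2" by simp
    then show ?thesis by (simp add: power2_eq_square power4_eq_xxxx algebra_simps)
  qed
  ultimately have G: "2 * (X * Y)\<^sup>2 \<le> sobolev_symbol q" by simp
  have XY: "X * Y > 0" using X Y by simp
  have r: "rho q = 1 / (X * Y)" by (simp add: rho_def X_def Y_def)
  have b: "(1 + \<bar>fst q\<bar>)\<^sup>2 \<le> 2 * X"
  proof -
    have "0 \<le> (\<bar>fst q\<bar> - 1)\<^sup>2" by simp
    then show ?thesis by (simp add: X_def power2_diff power2_sum)
  qed
  define w where "w = 1 + \<bar>fst q\<bar>"
  have "0 \<le> (2 * (X * Y)\<^sup>2 * h - w)\<^sup>2" by simp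
  then have "4 * (X * Y)\<^sup>2 * (w * h) \<le> 4 * ((X * Y)\<^sup>2 * (X * Y)\<^sup>2) * h\<^sup>2 + w\<^sup>2"
    by (simp add: power2_eq_square algebra_simps)
  also have "w\<^sup>2 \<le> 4 * (X * Y)"
  proof -
    have "4 * X * 1 \<le> 4 * X * Y" by (intro mult_left_mono) (use X Y in auto)
    moreover have "w\<^sup>2 \<le> 2 * X" using b by (simp add: w_def)
    ultimately show ?thesis using X by linarith
  qed
  finally have "(X * Y)\<^sup>2 * (4 * (w * h)) \<le> (X * Y)\<^sup>2 * (4 * ((X * Y)\<^sup>2 * h\<^sup>2 + rho q))"
    unfolding r using XY by (simp add: field_simps power2_eq_square)
  then have "4 * (w * h) \<le> 4 * ((X * Y)\<^sup>2 * h\<^sup>2 + rho q)"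
    by (rule mult_left_le_imp_le) (use X Y in simp)
  then have "w * h \<le> (X * Y)\<^sup>2 * h\<^sup>2 + rho q" by (rule mult_left_le_imp_le) simp
  also have "\<dots> \<le> sobolev_symbol q * h\<^sup>2 + rho q"
    using G by (intro add_right_mono mult_right_mono) (auto intro: order_trans[of _ "2 * (X * Y)\<^sup>2"])
  finally show ?thesis by (simp add: w_def h_def)
qed

definition u_hat_bound :: real where "u_hat_bound = Znorm_bound + rho_mass"

lemma u_hat_integrable:
  assumes t: "t \<in> {0..T}"
  shows "integrable lborel (\<lambda>q. (1 + \<bar>fst q\<bar>) * cmod (u_hat t q))" "(LINT q|lborel. (1 + \<bar>fst q\<bar>) * cmod (u_hat t q)) \<le> u_hat_bound"
proof -
  note [measurable] = u_hat_measurable[OF t]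
  have i: "integrable lborel (\<lambda>q. sobolev_symbol q * (cmod (u_hat t q))\<^sup>2 + rho q)"
    by (intro Bochner_Integration.integrable_add u_hat_weighted_integrable t integrable_rho)
  show j: "integrable lborel (\<lambda>q. (1 + \<bar>fst q\<bar>) * cmod (u_hat t q))"
  proof (rule Bochner_Integration.integrable_bound[OF i])
    show "AE q in lborel. norm ((1 + \<bar>fst q\<bar>) * cmod (u_hat t q)) \<le> norm (sobolev_symbol q * (cmod (u_hat t q))\<^sup>2 + rho q)"
    proof (rule AE_I2)
      fix q :: "real \<times> real"
      have "norm ((1 + \<bar>fst q\<bar>) * cmod (u_hat t q)) = (1 + \<bar>fst q\<bar>) * cmod (u_hat t q)" by simp
      also have "\<dots> \<le> norm (sobolev_symbol q * (cmod (u_hat t q))\<^sup>2 + rho q)"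
        unfolding real_norm_def by (rule order_trans[OF u_hat_pointwise abs_ge_self])
      finally show "norm ((1 + \<bar>fst q\<bar>) * cmod (u_hat t q)) \<le> norm (sobolev_symbol q * (cmod (u_hat t q))\<^sup>2 + rho q)" .
    qed
  qed measurable
  have "(LINT q|lborel. (1 + \<bar>fst q\<bar>) * cmod (u_hat t q)) \<le> (LINT q|lborel. sobolev_symbol q * (cmod (u_hat t q))\<^sup>2 + rho q)"
    by (intro integral_mono j i u_hat_pointwise)
  also have "\<dots> = (LINT q|lborel. sobolev_symbol q * (cmod (u_hat t q))\<^sup>2) + rho_mass"
    unfolding rho_mass_def by (intro Bochner_Integration.integral_add u_hat_weighted_integrable t integrable_rho)
  finally show "(LINT q|lborel. (1 + \<bar>fst q\<bar>) * cmod (u_hat t q)) \<le> u_hat_bound"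
    using u_hat_weighted_integrable(2)[OF t] by (simp add: u_hat_bound_def)
qed

lemma fourier2_u_integrable:
  assumes t: "t \<in> {0..T}"
  shows "integrable lborel (u_hat t)"
    "integrable lborel (\<lambda>q. \<bar>fst q\<bar> * cmod (u_hat t q))" "(LINT q|lborel. \<bar>fst q\<bar> * cmod (u_hat t q)) \<le> u_hat_bound"
proof -
  note [measurable] = u_hat_measurable[OF t]
  show "integrable lborel (u_hat t)"
    by (rule Bochner_Integration.integrable_bound[OF u_hat_integrable(1)[OF t]])
      (auto intro!: AE_I2 simp: distrib_right)
  show i: "integrable lborel (\<lambda>q. \<bar>fst q\<bar> * cmod (u_hat t q))"
    by (rule Bochner_Integration.integrable_bound[OF u_hat_integrable(1)[OF t]])
      (auto intro!: AE_I2 mult_right_mono simp: abs_mult)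
  have "(LINT q|lborel. \<bar>fst q\<bar> * cmod (u_hat t q)) \<le> (LINT q|lborel. (1 + \<bar>fst q\<bar>) * cmod (u_hat t q))"
    by (intro integral_mono i u_hat_integrable t mult_right_mono) auto
  then show "(LINT q|lborel. \<bar>fst q\<bar> * cmod (u_hat t q)) \<le> u_hat_bound" using u_hat_integrable(2)[OF t] by simp
qed

text \<open>The factor |xi| is distributed over the convolution by |xi| <= |xi'| + |xi - xi'|. In
  each half one factor is integrated together with its |xi| and the other is bounded by Y; the two
  halves cancel the 1/2, and 1 / (2 pi)^2 is estimated by 1. The derivative in u u_x is thus paid by
  the L^1 bound, and the estimate is linear in Y.\<close>

lemma nonlinearity_le:
  assumes t: "t \<in> {0..T}" and Y: "\<And>q. cmod (u_hat t q) \<le> Y"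
  shows "\<bar>fst q\<bar> / 2 * cmod (usq_hat t q) \<le> u_hat_bound * Y"
proof -
  note [measurable] = u_hat_measurable[OF t]
  let ?g = "\<lambda>q. \<bar>fst q\<bar> * cmod (u_hat t q)"
  have Y0: "0 \<le> Y" using Y[of 0] norm_ge_zero order_trans by blast
  have g: "integrable lborel ?g" and gr: "integrable lborel (\<lambda>q'. ?g (q - q'))"
    and gr': "(LINT q'|lborel. ?g (q - q')) = (LINT q'|lborel. ?g q')"
    using fourier2_u_integrable(2)[OF t] integrable_lborel_affine[OF fourier2_u_integrable(2)[OF t], of "- 1" q]
      integral_lborel_affine[of ?g "- 1" q] by simp_all
  have i: "integrable lborel (\<lambda>q'. Y * ?g q' + Y * ?g (q - q'))" using g gr by simp
  have pt: "\<bar>fst q\<bar> * cmod (u_hat t q' * u_hat t (q - q')) \<le> Y * ?g q' + Y * ?g (q - q')" for q'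
  proof -
    have "\<bar>fst q\<bar> * cmod (u_hat t q' * u_hat t (q - q')) \<le> (\<bar>fst q'\<bar> + \<bar>fst (q - q')\<bar>) * (cmod (u_hat t q') * cmod (u_hat t (q - q')))"
      unfolding norm_mult by (intro mult_right_mono) auto
    also have "\<dots> = \<bar>fst q'\<bar> * cmod (u_hat t q') * cmod (u_hat t (q - q')) + \<bar>fst (q - q')\<bar> * cmod (u_hat t (q - q')) * cmod (u_hat t q')"
      by (simp add: algebra_simps)
    also have "\<dots> \<le> \<bar>fst q'\<bar> * cmod (u_hat t q') * Y + \<bar>fst (q - q')\<bar> * cmod (u_hat t (q - q')) * Y"
      by (intro add_mono mult_left_mono Y) auto
    finally show ?thesis by (simp add: mult_ac)
  qed
  have "\<bar>fst q\<bar> * cmod (LINT q'|lborel. u_hat t q' * u_hat t (q - q')) \<le> \<bar>fst q\<bar> * (LINT q'|lborel. cmod (u_hat t q' * u_hat t (q - q')))"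
    by (intro mult_left_mono integral_norm_bound) simp
  also have "\<dots> = (LINT q'|lborel. \<bar>fst q\<bar> * cmod (u_hat t q' * u_hat t (q - q')))"
    by (rule integral_mult_right_zero[symmetric])
  also have "\<dots> \<le> (LINT q'|lborel. Y * ?g q' + Y * ?g (q - q'))"
    by (rule integral_mono_AE'[OF i]) (use pt Y0 in \<open>auto intro!: AE_I2 add_nonneg_nonneg mult_nonneg_nonneg\<close>)
  also have "\<dots> = 2 * Y * (LINT q'|lborel. ?g q')"
    using g gr gr' by simp
  also have "\<dots> \<le> 2 * Y * u_hat_bound"
    by (intro mult_left_mono fourier2_u_integrable(3)[OF t]) (use Y0 in simp)
  finally have 1: "\<bar>fst q\<bar> * cmod (LINT q'|lborel. u_hat t q' * u_hat t (q - q')) \<le> 2 * Y * u_hat_bound" .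
  have "1 \<le> (2 * pi)\<^sup>2" using pi_gt3 by (intro one_le_power) simp
  then have "cmod (usq_hat t q) \<le> cmod (LINT q'|lborel. u_hat t q' * u_hat t (q - q')) / 1"
    unfolding fourier2_square[OF u_integrable[OF t] fourier2_u_integrable(1)[OF t]] norm_divide
    by (intro divide_left_mono) (auto simp: norm_power norm_mult)
  then have "\<bar>fst q\<bar> * cmod (usq_hat t q) \<le> 2 * Y * u_hat_bound"
    using 1 mult_left_mono[of "cmod (usq_hat t q)" _ "\<bar>fst q\<bar>"] by fastforce
  then show ?thesis by (simp add: mult_ac)
qed

section \<open>Uniqueness from one time at which the transform vanishes\<close>

lemma u_hat_has_vector_derivative:
  assumes t: "t \<in> {0..T}"
  shows "((\<lambda>t. u_hat t q) has_vector_derivative rhs t q) (at t within {0..T})"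
proof -
  have "((\<lambda>x. integral {0..x} (\<lambda>\<tau>. rhs \<tau> q)) has_vector_derivative rhs t q) (at t within {0..T})"
    by (intro integral_has_vector_derivative continuous_on_rhs_time t) simp
  from has_vector_derivative_add[OF has_vector_derivative_const this, of "u_hat 0 q"]
  have h: "((\<lambda>x. u_hat 0 q + integral {0..x} (\<lambda>\<tau>. rhs \<tau> q)) has_vector_derivative rhs t q) (at t within {0..T})"
    by simp
  show ?thesis
  proof (rule has_vector_derivative_transform[OF t _ h])
    fix x assume "x \<in> {0..T}"
    then have "u_hat x q - u_hat 0 q = integral {0..x} (\<lambda>\<tau>. rhs \<tau> q)"
      by (intro u_hat_diff) auto
    then show "u_hat x q = u_hat 0 q + integral {0..x} (\<lambda>\<tau>. rhs \<tau> q)"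
      by (metis add.commute diff_add_cancel)
  qed
qed

text \<open>Gronwall by iteration: the bound for n is uniform in frequency and may be taken as Y in
  \<open>nonlinearity_le\<close>; integrating it from \<open>sg\<close> raises the power and
  supplies the factor 1 / (n + 1). The absolute value covers times on both sides of
  \<open>sg\<close>.\<close>

lemma u_hat_iterated_bound:
  assumes sg: "sg \<in> {0..T}" and z: "\<And>q. u_hat sg q = 0"
  shows "t \<in> {0..T} \<Longrightarrow> cmod (u_hat t q) \<le> 2 * energy_bound * (u_hat_bound * \<bar>t - sg\<bar>) ^ n / fact n"
proof (induction n arbitrary: t q)
  case 0
  then show ?case using norm_u_hat_le by simp
next
  case (Suc n)
  \<comment> \<open>The linear part has the purely imaginary but unbounded symbol i om.
    Multiplication by \<open>cis (- om * t)\<close> removes it without changing moduli, so that only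
    N has to be estimated.\<close>
  define om where "om = - fst q * \<bar>fst q\<bar> powr (a + 1) + fst q * (snd q)\<^sup>2"
  define N where "N t = - (\<i> * complex_of_real (fst q / 2) * usq_hat t q)" for t
  have rhs_eq: "rhs t q = \<i> * om * u_hat t q + N t" for t
    by (simp add: rhs_def om_def N_def algebra_simps)
  define w where "w t = cis (- om * t) * u_hat t q" for t
  have w': "(w has_vector_derivative (cis (- om * t) * N t)) (at t within {0..T})" if "t \<in> {0..T}" for t
  proof -
    have c: "((\<lambda>t. cis (- om * t)) has_vector_derivative (- om) *\<^sub>R (\<i> * cis (- om * t))) (at t within {0..T})"
      unfolding cis_conv_exp
    proof -
      have "((\<lambda>t. - om * t) has_vector_derivative (- om)) (at t within {0..T})"
        by (auto intro!: derivative_eq_intros simp: has_real_derivative_iff_has_vector_derivative[symmetric])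
      from vector_diff_chain_within[OF this has_vector_derivative_iexp]
      show "((\<lambda>t. iexp (- om * t)) has_vector_derivative (- om) *\<^sub>R (\<i> * iexp (- om * t))) (at t within {0..T})"
        by (simp only: o_def)
    qed
    have "((\<lambda>t. cis (- om * t) * u_hat t q) has_vector_derivative (cis (- om * t) * rhs t q + (- om) *\<^sub>R (\<i> * cis (- om * t)) * u_hat t q)) (at t within {0..T})"
      by (rule has_vector_derivative_mult[OF c u_hat_has_vector_derivative[OF that]])
    moreover have "cis (- om * t) * rhs t q + (- om) *\<^sub>R (\<i> * cis (- om * t)) * u_hat t q = cis (- om * t) * N t"
      unfolding rhs_eq by (simp add: scaleR_conv_of_real distrib_left)
    ultimately show ?thesis unfolding w_def by simp
  qed
  have CU0: "0 \<le> u_hat_bound"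
    using fourier2_u_integrable(3)[OF sg] Bochner_Integration.integral_nonneg[of lborel "\<lambda>q. \<bar>fst q\<bar> * cmod (u_hat sg q)"] by (simp add: z)
  have CS0: "0 \<le> energy_bound" using energy_bound_nonneg[OF sg] .
  have Nle: "cmod (cis (- om * \<tau>) * N \<tau>) \<le> u_hat_bound * (2 * energy_bound * (u_hat_bound * \<bar>\<tau> - sg\<bar>) ^ n / fact n)" if "\<tau> \<in> {0..T}" for \<tau>
    using nonlinearity_le[OF that Suc.IH[OF that], of q] by (simp add: N_def norm_mult norm_divide)
  define B where "B = 2 * energy_bound * u_hat_bound ^ Suc n / fact n"
  have Nle': "cmod (cis (- om * \<tau>) * N \<tau>) \<le> B * \<bar>\<tau> - sg\<bar> ^ n" if "\<tau> \<in> {0..T}" for \<tau>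
    using Nle[OF that] by (simp add: B_def power_mult_distrib mult_ac)
  have "cmod (w t - w sg) \<le> B * \<bar>t - sg\<bar> ^ Suc n / Suc n"
  proof -
    consider "t = sg" | "sg < t" | "t < sg" by linarith
    then show ?thesis
    proof cases
      case 1
      then show ?thesis by simp
    next
      case 2
      have sub: "{sg..t} \<subseteq> {0..T}" using sg Suc.prems by auto
      have wc: "(w has_vector_derivative (cis (- om * x) * N x)) (at x within {sg..t})" if "x \<in> {sg..t}" for x
        using has_vector_derivative_within_subset[OF w' sub] that sub by auto
      have i: "((\<lambda>x. cis (- om * x) * N x) has_integral (w t - w sg)) {sg..t}"
        by (rule fundamental_theorem_of_calculus) (use wc 2 in auto)
      have j: "((\<lambda>x. B * (x - sg) ^ n) has_integral (B * (t - sg) ^ Suc n / Suc n - B * (sg - sg) ^ Suc n / Suc n)) {sg..t}"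
      proof (rule fundamental_theorem_of_calculus)
        show "((\<lambda>x. B * (x - sg) ^ Suc n / Suc n) has_vector_derivative B * (x - sg) ^ n) (at x within {sg..t})" for x
          unfolding has_real_derivative_iff_has_vector_derivative[symmetric]
          by (auto intro!: derivative_eq_intros simp del: power_Suc of_nat_Suc)
      qed (use 2 in simp)
      have "cmod (w t - w sg) \<le> B * (t - sg) ^ Suc n / Suc n - B * (sg - sg) ^ Suc n / Suc n"
        unfolding integral_unique[OF i, symmetric] integral_unique[OF j, symmetric]
      proof (rule integral_norm_bound_integral[OF has_integral_integrable[OF i] has_integral_integrable[OF j]])
        fix x assume x: "x \<in> {sg..t}"
        then have "x \<in> {0..T}" using sub by blast
        from Nle'[OF this] show "cmod (cis (- om * x) * N x) \<le> B * (x - sg) ^ n"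
          using x by simp
      qed
      then show ?thesis using 2 by simp
    next
      case 3
      have sub: "{t..sg} \<subseteq> {0..T}" using sg Suc.prems by auto
      have wc: "(w has_vector_derivative (cis (- om * x) * N x)) (at x within {t..sg})" if "x \<in> {t..sg}" for x
        using has_vector_derivative_within_subset[OF w' sub] that sub by auto
      have i: "((\<lambda>x. cis (- om * x) * N x) has_integral (w sg - w t)) {t..sg}"
        by (rule fundamental_theorem_of_calculus) (use wc 3 in auto)
      have j: "((\<lambda>x. B * (sg - x) ^ n) has_integral (- B * (sg - sg) ^ Suc n / Suc n - - B * (sg - t) ^ Suc n / Suc n)) {t..sg}"
      proof (rule fundamental_theorem_of_calculus)
        show "((\<lambda>x. - B * (sg - x) ^ Suc n / Suc n) has_vector_derivative B * (sg - x) ^ n) (at x within {t..sg})" for x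
          unfolding has_real_derivative_iff_has_vector_derivative[symmetric]
          by (auto intro!: derivative_eq_intros simp del: power_Suc of_nat_Suc)
      qed (use 3 in simp)
      have "cmod (w sg - w t) \<le> - B * (sg - sg) ^ Suc n / Suc n - - B * (sg - t) ^ Suc n / Suc n"
        unfolding integral_unique[OF i, symmetric] integral_unique[OF j, symmetric]
      proof (rule integral_norm_bound_integral[OF has_integral_integrable[OF i] has_integral_integrable[OF j]])
        fix x assume x: "x \<in> {t..sg}"
        then have "x \<in> {0..T}" using sub by blast
        from Nle'[OF this] show "cmod (cis (- om * x) * N x) \<le> B * (sg - x) ^ n"
          using x by simp
      qed
      then show ?thesis using 3 by (simp add: norm_minus_commute)
    qed
  qed
  moreover have "w sg = 0" by (simp add: w_def z)
  moreover have "cmod (w t) = cmod (u_hat t q)" by (simp add: w_def norm_mult)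
  ultimately show ?case
    by (simp add: B_def power_mult_distrib field_simps)
qed

text \<open>The iterated bounds are terms of an exponential series and tend to 0, so the transform
  vanishes identically; inversion returns this to u(t) almost everywhere.\<close>

lemma u_eq_0:
  assumes sg: "sg \<in> {0..T}" and z: "\<And>q. u_hat sg q = 0" and t: "t \<in> {0..T}"
  shows "AE p in lborel. u t p = 0"
proof -
  have uh0: "u_hat t q = 0" for q
  proof -
    have "(\<lambda>n. 2 * energy_bound * ((u_hat_bound * \<bar>t - sg\<bar>) ^ n / fact n)) \<longlonglongrightarrow> 2 * energy_bound * 0"
    proof (intro tendsto_intros)
      show "(\<lambda>n. (u_hat_bound * \<bar>t - sg\<bar>) ^ n / fact n) \<longlonglongrightarrow> 0"
        using summable_LIMSEQ_zero[OF summable_exp[of "u_hat_bound * \<bar>t - sg\<bar>"]] by (simp add: field_simps)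
    qed
    then have "cmod (u_hat t q) \<le> 2 * energy_bound * 0"
      by (rule LIMSEQ_le_const) (use u_hat_iterated_bound[OF sg z t, of q] in auto)
    then show ?thesis by simp
  qed
  have "u_hat t = (\<lambda>_. 0)" using uh0 by auto
  then show ?thesis
    using fourier_inversion[OF u_integrable[OF t] fourier2_u_integrable(1)[OF t]] by simp
qed

text \<open>Defined through \<open>ptrans_sq\<close>, so that its time integral is the real part of
  the quantity in \<open>first_moment_diff\<close>. The positive weight 1 / (1 + y^2) makes it
  detect whether u(t) vanishes.\<close>

definition local_mass :: "real \<Rightarrow> real" where "local_mass t = Re (ptrans_sq 0 (u t) 0)"

lemma local_mass_eq:
  assumes t: "t \<in> {0..T}"
  shows "local_mass t = (LINT p|lborel. (u t p)\<^sup>2 * (1 / (1 + (snd p)\<^sup>2)))"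
    "integrable lborel (\<lambda>p. (u t p)\<^sup>2 * (1 / (1 + (snd p)\<^sup>2)))"
proof -
  have i: "integrable lborel (\<lambda>p. complex_of_real ((u t p)\<^sup>2) * (ee (fst p * 0) * laplace_ker 0 (snd p)))"
    by (rule ptrans_sq_integrable[OF w_u[OF t]])
  have e: "Re (complex_of_real ((u t p)\<^sup>2) * (ee (fst p * 0) * laplace_ker 0 (snd p))) = (u t p)\<^sup>2 * (1 / (1 + (snd p)\<^sup>2))" for p
    by (simp add: Re_laplace_ker_0)
  show "local_mass t = (LINT p|lborel. (u t p)\<^sup>2 * (1 / (1 + (snd p)\<^sup>2)))"
    unfolding local_mass_def ptrans_def integral_Re[OF i, symmetric] e ..
  show "integrable lborel (\<lambda>p. (u t p)\<^sup>2 * (1 / (1 + (snd p)\<^sup>2)))"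
    using integrable_Re[OF i] unfolding e .
qed

lemma local_mass_nonneg: "t \<in> {0..T} \<Longrightarrow> 0 \<le> local_mass t"
  unfolding local_mass_eq by (intro Bochner_Integration.integral_nonneg) simp

lemma local_mass_eq_0_imp:
  assumes t: "t \<in> {0..T}" and e: "local_mass t = 0"
  shows "u_hat t q = 0"
proof -
  have "AE p in lborel. (u t p)\<^sup>2 * (1 / (1 + (snd p)\<^sup>2)) = 0"
    using integral_nonneg_eq_0_iff_AE[OF local_mass_eq(2)[OF t]] e local_mass_eq(1)[OF t] by simp
  then have ae: "AE p in lborel. u t p = 0"
  proof eventually_elim
    case (elim p)
    have "1 + (snd p)\<^sup>2 \<noteq> 0" using zero_le_power2[of "snd p"] by linarith
    with elim show ?case by simp
  qed
  note [measurable] = u_measurable[OF t]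
  have "u_hat t q = (LINT p::real \<times> real|lborel. (0::complex))"
    unfolding fourier2_inner by (rule integral_cong_AE) (use ae in auto)
  then show ?thesis by simp
qed

text \<open>If the mass were positive throughout, X = Re (i M) would be strictly increasing. Mean
  zero over [p, q] forces X > 0 at the right end q, and mean zero over [q, w] forces X < 0 at the
  left end q: the contradiction sits at the middle time.\<close>

lemma zero_somewhere:
  assumes ts: "0 \<le> p" "p < q" "q < w" "w \<le> T"
    and wt: "weighted_L2 (7/2 + a) r2 (u p)" "weighted_L2 (7/2 + a) r2 (u q)" "weighted_L2 (7/2 + a) r2 (u w)"
  shows "\<exists>t\<in>{0..T}. local_mass t = 0"
proof (rule ccontr)
  assume neg: "\<not> (\<exists>t\<in>{0..T}. local_mass t = 0)"
  have pos: "local_mass t > 0" if "t \<in> {0..T}" for t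
    using neg local_mass_nonneg[OF that] that by force
  have F0: "ptrans k (u t) 0 = 0" if "t \<in> {0..T}" for k t
    by (rule ptrans_0_eq_0[of p q]) (use ts wt that in auto)
  define X where "X t = Re (\<i> * first_moment (u t))" for t
  have cont_e: "continuous_on {c..d} local_mass" if "0 \<le> c" "d \<le> T" for c d
    unfolding local_mass_def by (intro continuous_intros continuous_on_subset[OF continuous_on_ptrans_sq]) (use that in auto)
  have cont_X: "continuous_on {c..d} X" if "0 \<le> c" "d \<le> T" for c d
    unfolding X_def by (intro continuous_intros continuous_on_subset[OF continuous_on_first_moment]) (use that in auto)
  \<comment> \<open>The increment of M is -i/2 times the time integral of Q_0(., 0); the factor i in
    X turns its real part into half the time integral of the mass.\<close>
  have incr: "X c < X d" if "0 \<le> c" "c < d" "d \<le> T" for c d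
  proof -
    have m: "first_moment (u d) - first_moment (u c) = - \<i> / 2 * int_ptrans_sq 0 c d 0"
      by (rule first_moment_diff) (use that F0 in auto)
    have "((\<lambda>t. Re (ptrans_sq 0 (u t) 0)) has_integral Re (int_ptrans_sq 0 c d 0)) {c..d}"
      using int_ptrans_sq_has_integral[of c d 0 0] that has_integral_linear[OF _ bounded_linear_Re, of _ _ "{c..d}"] by (auto simp: o_def)
    then have I: "integral {c..d} local_mass = Re (int_ptrans_sq 0 c d 0)" unfolding local_mass_def by (rule integral_unique)
    have "integral {c..d} (\<lambda>_. 0) < integral {c..d} local_mass"
      by (rule integral_less_real) (use that pos cont_e in auto)
    moreover have "X d - X c = Re (\<i> * (first_moment (u d) - first_moment (u c)))" by (simp add: X_def right_diff_distrib)
    then have "X d - X c = Re (int_ptrans_sq 0 c d 0) / 2" unfolding m by simp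
    ultimately show ?thesis using I by simp
  qed
  have X0: "integral {c..d} X = 0" if "((\<lambda>t. first_moment (u t)) has_integral 0) {c..d}" for c d
  proof -
    have "(X has_integral 0) {c..d}"
      using has_integral_linear[OF has_integral_mult_right[OF that, of \<i>] bounded_linear_Re]
      by (simp add: o_def X_def[abs_def])
    then show ?thesis by (rule integral_unique)
  qed
  have "integral {p..q} X < integral {p..q} (\<lambda>_. X q)"
    by (rule integral_less_real) (use ts incr cont_X in auto)
  moreover have "integral {p..q} X = 0"
    by (rule X0, rule first_moment_integral_eq_0) (use ts wt in auto)
  ultimately have "X q > 0" using ts by (simp add: zero_less_mult_iff)
  have "integral {q..w} (\<lambda>_. X q) < integral {q..w} X"
    by (rule integral_less_real) (use ts incr cont_X in auto)
  moreover have "integral {q..w} X = 0"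
    by (rule X0, rule first_moment_integral_eq_0) (use ts wt in auto)
  ultimately have "X q < 0" using ts by (simp add: mult_less_0_iff)
  with \<open>X q > 0\<close> show False by simp
qed

end

theorem theorem1p3:
  fixes a s r1 r2 T :: real
    and phi :: "real \<times> real \<Rightarrow> real"
    and u :: "real \<Rightarrow> real \<times> real \<Rightarrow> real"
    and t1 t2 t3 :: real
  assumes "0 < a" and "a < 1" and "s \<ge> 4" and "r1 > 3" and "r2 > 3"
    and "cont_Z a s r1 r2 T u"
    and "solves_IVP a T phi u"
    and "t1 \<in> {0..T}" and "t2 \<in> {0..T}" and "t3 \<in> {0..T}"
    and "t1 \<noteq> t2" and "t1 \<noteq> t3" and "t2 \<noteq> t3"
    and "\<And>j. j \<in> {t1, t2, t3} \<Longrightarrow> Zspace a s (7/2 + a) r2 (u j)"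
  shows "\<forall>t\<in>{0..T}. AE p in lborel. u t p = 0"
proof -
  interpret zk_solution a s r1 r2 T phi u
    by unfold_locales (use assms in auto)
  have wt: "weighted_L2 (7/2 + a) r2 (u j)" if "j \<in> {t1, t2, t3}" for j
    using assms(14)[OF that] by (simp add: Zspace_def)
  obtain p q w where pqw: "p < q" "q < w" "{p, q, w} = {t1, t2, t3}"
  proof -
    consider "t1 < t2 \<and> t2 < t3" | "t1 < t3 \<and> t3 < t2" | "t2 < t1 \<and> t1 < t3" | "t2 < t3 \<and> t3 < t1"
      | "t3 < t1 \<and> t1 < t2" | "t3 < t2 \<and> t2 < t1"
      using assms(11-13) by linarith
    then show ?thesis
    proof cases
      case 1
      then show ?thesis by (intro that[of t1 t2 t3]) auto
    next
      case 2
      then show ?thesis by (intro that[of t1 t3 t2]) auto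
    next
      case 3
      then show ?thesis by (intro that[of t2 t1 t3]) auto
    next
      case 4
      then show ?thesis by (intro that[of t2 t3 t1]) auto
    next
      case 5
      then show ?thesis by (intro that[of t3 t1 t2]) auto
    next
      case 6
      then show ?thesis by (intro that[of t3 t2 t1]) auto
    qed
  qed
  then have m: "p \<in> {t1, t2, t3}" "q \<in> {t1, t2, t3}" "w \<in> {t1, t2, t3}" by auto
  then have "0 \<le> p" "w \<le> T" using assms(8-10) by auto
  then obtain sg where sg: "sg \<in> {0..T}" "local_mass sg = 0"
    using zero_somewhere[of p q w] pqw wt m by auto
  show ?thesis
    using u_eq_0[OF sg(1) local_mass_eq_0_imp[OF sg]] by blast
qed

end
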